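(* Let $(\Lambda V,d)$ be an elliptic minimal Sullivan algebra with $d=\sum_{i\ge k}d_i$, $k\ge2$, $d_i(V)\subset\Lambda^iV$ (where $(\Lambda V,d_k)$ is not necessarily elliptic), and let $f$ represent the generating class of $\mathrm{Ext}_{(\Lambda V,d_k)}(\mathbb{K},(\Lambda V,d_k))$. Then either the Eilenberg-Moore spectral sequence $$E_k^{p,q}=\mathrm{Ext}^{p,q}_{(\Lambda V,d_k)}(\mathbb{K},(\Lambda V,d_k))\Rightarrow\mathrm{Ext}^{p+q}_{(\Lambda V,d)}(\mathbb{K},(\Lambda V,d))$$ degenerates at $E_k$ and $[f]$ generates $\mathrm{Ext}^*_{(\Lambda V,d)}(\mathbb{K},(\Lambda V,d))$, or else $[f^t]$ is the generating class of $\mathrm{Ext}^*_{(\Lambda V,d)}(\mathbb{K},(\Lambda V,d))$, where $f^t$ is the element constructed from $f$ by the procedure described in the context.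
   Context: $\mathbb{K}$ is a field of characteristic zero; $(\Lambda V,d)$ is $1$-connected; elliptic means $\dim V<\infty$ and $\dim H(\Lambda V,d)<\infty$. Let $\Lambda V\otimes\Lambda sV$ be the semifree resolution (acyclic closure) of $\mathbb{K}$ over $(\Lambda V,d)$, with $|sv|=|v|-1$ and differential extending $d$ by $d(sv)=v-s(dv)$, where on products $s(v_1\cdots v_r)=v_1\cdots v_{r-1}\,sv_r$ up to sign. Let $A=\mathrm{Hom}_{\Lambda V}(\Lambda V\otimes\Lambda sV,\Lambda V)$ with $D(g)=d\circ g+(-1)^{|g|+1}g\circ d$, so $H(A,D)=\mathrm{Ext}_{(\Lambda V,d)}(\mathbb{K},(\Lambda V,d))$. The same definition with $d_k$ in place of $d$ gives $D_k$ and $\mathrm{Ext}_{(\Lambda V,d_k)}(\mathbb{K},(\Lambda V,d_k))$; for $i>k$, $D_i$ is the part of $D$ induced by $d_i$, so $D=\sum_{i\ge k}D_i$. The filtration $F^pA=\{g: g(\Lambda sV)\subset\Lambda^{\ge p}V\}$ induces the spectral sequence in the claim. Since $\dim V<\infty$, $(\Lambda V,d_k)$ and $(\Lambda V,d)$ are Gorenstein (their Ext spaces are one-dimensional) of the same formal dimension $N$ (the total degree of the generator); a nonzero element is called the generating class. Let $(p,q)$, $p+q=N$, be the unique bidegree with $\mathrm{Ext}^{p,q}_{(\Lambda V,d_k)}(\mathbb{K},(\Lambda V,d_k))\neq0$; the representative $f\in A^N$ satisfies $f(\Lambda sV)\subset\Lambda^{\ge p}V$ and $Df(\Lambda sV)\subset\Lambda^{\ge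 p+k-1}V$. **Construction of $f^t$** (when $Df\neq0$). Write $Df=h_0^0+\cdots+h_t^0$ with $h_i^0(\Lambda sV)\subset\Lambda^{p+k-1+i}V$ and $h_t^0\ne0$. Inductively choose $\xi_1,\dots,\xi_{t+1}\in A^N$ with $D_k\xi_1=h_0^0$ and $$D_k\xi_{i+1}=h_i^i:=h_i^0-D_{k+i}\xi_1-D_{k+i-1}\xi_2-\cdots-D_{k+1}\xi_i\qquad(1\le i\le t).$$ Put $f^t=f-\xi_1-\cdots-\xi_t$; if $Df^t\ne0$ (then $Df^t=h_t^t=D\xi_{t+1}$), $f^t$ is replaced by $f^t-\xi_{t+1}$. When $Df=0$ one is in the first alternative of the claim.
   Formalization: The choices ξ_i must satisfy ξ_1∈F^p with f−ξ_1 still nonzero in Ext for d_k, ξ_i∈F^{p+1} for i≥2, and Df^t=h_t^t=Dξ_{t+1} if Df^t≠0 (else ξ_1=f could give f^t=0). That such ξ_i exist is not claimed; instead some η∈F^{p+1} is shown with [f−η] generating. *)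

theory Defs
  imports Complex_Main "HOL-Library.Function_Algebras"
begin

text \<open>
  The ring type \<open>'b\<close> carries the whole algebra \<open>\<Lambda>V \<otimes> \<Lambda>sV = \<Lambda>(V \<oplus> sV)\<close> over the field \<open>'k\<close>;
  \<open>\<Lambda>V\<close> and \<open>\<Lambda>sV\<close> are the subalgebras generated by a homogeneous basis
  \<open>v\<^sub>0, \<dots>, v\<^sub>n\<^sub>-\<^sub>1\<close> of \<open>V\<close> and by the suspended basis \<open>sv\<^sub>0, \<dots>, sv\<^sub>n\<^sub>-\<^sub>1\<close> of \<open>sV\<close>.
  Here \<open>dg i\<close> is the degree of \<open>v\<^sub>i\<close>, and \<open>sv\<^sub>i\<close> has degree \<open>dg i - 1\<close>.
\<close>

record ('k, 'b) gens =
  sm :: "'k \<Rightarrow> 'b \<Rightarrow> 'b"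
  rk :: nat
  dg :: "nat \<Rightarrow> nat"
  gv :: "nat \<Rightarrow> 'b"
  gs :: "nat \<Rightarrow> 'b"

definition ksign :: "int \<Rightarrow> 'b::ring_1 \<Rightarrow> 'b" where
  "ksign m a = (if even m then a else - a)"

section \<open>The free graded commutative algebra\<close>

definition mono :: "('k, 'b::ring_1) gens \<Rightarrow> (nat \<Rightarrow> nat) \<times> (nat \<Rightarrow> nat) \<Rightarrow> 'b" where
  "mono G = (\<lambda>(a, b). prod_list (map (\<lambda>i. gv G i ^ a i) [0..<rk G])
                       * prod_list (map (\<lambda>i. gs G i ^ b i) [0..<rk G]))"

text \<open>Exponents of the ordered monomials: odd generators occur at most once.\<close>

definition expos :: "('k, 'b) gens \<Rightarrow> ((nat \<Rightarrow> nat) \<times> (nat \<Rightarrow> nat)) set" where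
  "expos G = {(a, b). (\<forall>i\<ge>rk G. a i = 0 \<and> b i = 0) \<and>
     (\<forall>i<rk G. (odd (dg G i) \<longrightarrow> a i \<le> 1) \<and> (even (dg G i) \<longrightarrow> b i \<le> 1))}"

definition vlen :: "('k, 'b) gens \<Rightarrow> (nat \<Rightarrow> nat) \<Rightarrow> int" where
  "vlen G a = (\<Sum>i<rk G. int (a i))"

definition mdeg :: "('k, 'b) gens \<Rightarrow> (nat \<Rightarrow> nat) \<times> (nat \<Rightarrow> nat) \<Rightarrow> int" where
  "mdeg G = (\<lambda>(a, b). \<Sum>i<rk G. int (a i) * int (dg G i) + int (b i) * (int (dg G i) - 1))"

text \<open>
  Over a field of characteristic zero, an algebra generated by graded commuting elements is the
  free graded commutative algebra on them iff the ordered monomials form a basis.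
\<close>

definition free_gca :: "('k::field_char_0, 'b::ring_1) gens \<Rightarrow> bool" where
  "free_gca G \<longleftrightarrow>
     vector_space (sm G) \<and>
     (\<forall>c x y. sm G c (x * y) = sm G c x * y \<and> sm G c (x * y) = x * sm G c y) \<and>
     (\<forall>i<rk G. \<forall>j<rk G.
        gv G i * gv G j = ksign (int (dg G i) * int (dg G j)) (gv G j * gv G i) \<and>
        gv G i * gs G j = ksign (int (dg G i) * (int (dg G j) - 1)) (gs G j * gv G i) \<and>
        gs G i * gs G j = ksign ((int (dg G i) - 1) * (int (dg G j) - 1)) (gs G j * gs G i)) \<and>
     inj_on (mono G) (expos G) \<and>
     \<not> module.dependent (sm G) (mono G ` expos G) \<and>
     module.span (sm G) (mono G ` expos G) = UNIV"

definition mspan ::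
  "('k::field_char_0, 'b::ring_1) gens \<Rightarrow> ((nat \<Rightarrow> nat) \<times> (nat \<Rightarrow> nat) \<Rightarrow> bool) \<Rightarrow> 'b set" where
  "mspan G P = module.span (sm G) (mono G ` {e \<in> expos G. P e})"

definition Deg :: "('k::field_char_0, 'b::ring_1) gens \<Rightarrow> int \<Rightarrow> 'b set" where
  "Deg G m = mspan G (\<lambda>e. mdeg G e = m)"

definition LV :: "('k::field_char_0, 'b::ring_1) gens \<Rightarrow> 'b set" where
  "LV G = mspan G (\<lambda>(a, b). vlen G b = 0)"

definition LsV :: "('k::field_char_0, 'b::ring_1) gens \<Rightarrow> 'b set" where
  "LsV G = mspan G (\<lambda>(a, b). vlen G a = 0)"

definition LVlen :: "('k::field_char_0, 'b::ring_1) gens \<Rightarrow> int \<Rightarrow> 'b set" where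
  "LVlen G p = mspan G (\<lambda>(a, b). vlen G a = p \<and> vlen G b = 0)"

definition LVge :: "('k::field_char_0, 'b::ring_1) gens \<Rightarrow> int \<Rightarrow> 'b set" where
  "LVge G p = mspan G (\<lambda>(a, b). vlen G a \<ge> p \<and> vlen G b = 0)"

text \<open>\<open>\<Lambda>\<^sup>pV \<otimes> sV\<close>\<close>

definition LVsV :: "('k::field_char_0, 'b::ring_1) gens \<Rightarrow> int \<Rightarrow> 'b set" where
  "LVsV G p = mspan G (\<lambda>(a, b). vlen G a = p \<and> vlen G b = 1)"

section \<open>Sullivan algebras\<close>

text \<open>Graded derivations of degree 1 of a graded subalgebra \<open>S\<close>.\<close>

definition derivation_on ::
  "('k::field_char_0, 'b::ring_1) gens \<Rightarrow> 'b set \<Rightarrow> ('b \<Rightarrow> 'b) \<Rightarrow> bool" where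
  "derivation_on G S \<theta> \<longleftrightarrow>
     (\<forall>x\<in>S. \<forall>y\<in>S. \<theta> (x + y) = \<theta> x + \<theta> y) \<and>
     (\<forall>c. \<forall>x\<in>S. \<theta> (sm G c x) = sm G c (\<theta> x)) \<and>
     (\<forall>m. \<forall>x\<in>S \<inter> Deg G m. \<theta> x \<in> S \<inter> Deg G (m + 1)) \<and>
     (\<forall>m. \<forall>x\<in>S \<inter> Deg G m. \<forall>y\<in>S. \<theta> (x * y) = \<theta> x * y + ksign m (x * \<theta> y))"

text \<open>
  A 1-connected minimal Sullivan algebra \<open>(\<Lambda>V, d)\<close> with \<open>dim V < \<infinity>\<close>: the generators have degree
  at least 2 and \<open>d\<close> has no linear part; the nilpotence condition of Sullivan algebras is then
  automatic for degree reasons.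
\<close>

definition minimal_sullivan ::
  "('k::field_char_0, 'b::ring_1) gens \<Rightarrow> ('b \<Rightarrow> 'b) \<Rightarrow> bool" where
  "minimal_sullivan G d \<longleftrightarrow>
     free_gca G \<and> (\<forall>i<rk G. 2 \<le> dg G i) \<and>
     derivation_on G (LV G) d \<and> (\<forall>x\<in>LV G. d (d x) = 0) \<and>
     (\<forall>i<rk G. d (gv G i) \<in> LVge G 2)"

text \<open>
  \<open>d = \<Sum>\<^sub>i\<^sub>\<ge>\<^sub>k d\<^sub>i\<close> with derivations \<open>d\<^sub>i\<close> such that \<open>d\<^sub>i(V) \<subseteq> \<Lambda>\<^sup>iV\<close>.  As \<open>d\<^sub>i\<close> has degree 1 and raises
  word length by \<open>i - 1\<close>, only finitely many \<open>d\<^sub>i\<close> are nonzero on a given element, so the sum below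
  is always over a finite set.
\<close>

definition word_decomposition ::
  "('k::field_char_0, 'b::ring_1) gens \<Rightarrow> nat \<Rightarrow> ('b \<Rightarrow> 'b) \<Rightarrow> (nat \<Rightarrow> 'b \<Rightarrow> 'b) \<Rightarrow> bool" where
  "word_decomposition G k d di \<longleftrightarrow>
     (\<forall>i\<ge>k. derivation_on G (LV G) (di i) \<and> (\<forall>j<rk G. di i (gv G j) \<in> LVlen G (int i))) \<and>
     (\<forall>x\<in>LV G. d x = (\<Sum>i | i \<ge> k \<and> di i x \<noteq> 0. di i x))"

text \<open>\<open>dim V < \<infinity>\<close> is built into \<open>gens\<close>; what remains is \<open>dim H(\<Lambda>V, d) < \<infinity>\<close>.\<close>

definition elliptic :: "('k::field_char_0, 'b::ring_1) gens \<Rightarrow> ('b \<Rightarrow> 'b) \<Rightarrow> bool" where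
  "elliptic G d \<longleftrightarrow>
     (\<exists>B. finite B \<and> B \<subseteq> {x \<in> LV G. d x = 0} \<and>
          {x \<in> LV G. d x = 0} \<subseteq> module.span (sm G) (B \<union> d ` LV G))"

section \<open>The acyclic closure\<close>

text \<open>
  The linear map \<open>s\<close> sends \<open>v\<close> to \<open>sv\<close> and a product \<open>v\<^sub>1\<cdots>v\<^sub>r\<close> to \<open>\<plusminus> v\<^sub>1\<cdots>v\<^sub>r\<^sub>-\<^sub>1 sv\<^sub>r\<close>.  On a commutative
  algebra this depends on which factor is written last (and on the sign), so \<open>s\<close> is any linear
  map of degree -1 that turns one factor of a word into an element of \<open>sV\<close>, i.e.
  \<open>s(\<Lambda>\<^sup>rV) \<subseteq> \<Lambda>\<^sup>r\<^sup>-\<^sup>1V \<otimes> sV\<close>.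
\<close>

definition suspension_map ::
  "('k::field_char_0, 'b::ring_1) gens \<Rightarrow> ('b \<Rightarrow> 'b) \<Rightarrow> bool" where
  "suspension_map G s \<longleftrightarrow>
     Vector_Spaces.linear (sm G) (sm G) s \<and>
     (\<forall>i<rk G. s (gv G i) = gs G i) \<and>
     (\<forall>r\<ge>1. \<forall>m. s ` (LVlen G r \<inter> Deg G m) \<subseteq> LVsV G (r - 1) \<inter> Deg G (m - 1))"

text \<open>The derivation of \<open>\<Lambda>V \<otimes> \<Lambda>sV\<close> extending \<open>d\<close> with \<open>d(sv) = v - s(dv)\<close>.\<close>

definition closure_diff ::
  "('k::field_char_0, 'b::ring_1) gens \<Rightarrow> ('b \<Rightarrow> 'b) \<Rightarrow> ('b \<Rightarrow> 'b) \<Rightarrow> ('b \<Rightarrow> 'b) \<Rightarrow> bool" where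
  "closure_diff G s d \<delta> \<longleftrightarrow>
     derivation_on G UNIV \<delta> \<and>
     (\<forall>i<rk G. \<delta> (gv G i) = d (gv G i) \<and> \<delta> (gs G i) = gv G i - s (d (gv G i)))"

text \<open>The part of that derivation induced by a summand \<open>d\<^sub>i\<close> of \<open>d\<close>, for \<open>i > k\<close>.\<close>

definition closure_part ::
  "('k::field_char_0, 'b::ring_1) gens \<Rightarrow> ('b \<Rightarrow> 'b) \<Rightarrow> ('b \<Rightarrow> 'b) \<Rightarrow> ('b \<Rightarrow> 'b) \<Rightarrow> bool" where
  "closure_part G s d \<delta> \<longleftrightarrow>
     derivation_on G UNIV \<delta> \<and>
     (\<forall>i<rk G. \<delta> (gv G i) = d (gv G i) \<and> \<delta> (gs G i) = - s (d (gv G i)))"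

text \<open>
  Once \<open>\<delta>\<^sup>2 = 0\<close>, \<open>(\<Lambda>V \<otimes> \<Lambda>sV, \<delta>)\<close> is a semifree resolution of the ground field: acyclicity follows
  by filtering by the total word length in \<open>V \<oplus> sV\<close>, whose associated graded differential is the
  Koszul differential \<open>sv \<mapsto> v\<close>.
\<close>

definition acyclic_closure ::
  "('k::field_char_0, 'b::ring_1) gens \<Rightarrow> ('b \<Rightarrow> 'b) \<Rightarrow> ('b \<Rightarrow> 'b) \<Rightarrow> ('b \<Rightarrow> 'b) \<Rightarrow> bool" where
  "acyclic_closure G s d \<delta> \<longleftrightarrow>
     suspension_map G s \<and> closure_diff G s d \<delta> \<and> (\<forall>x. \<delta> (\<delta> x) = 0)"

section \<open>The complex \<open>A\<close> and \<open>Ext\<close>\<close>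

text \<open>\<open>A\<^sup>m\<close>: the \<open>\<Lambda>V\<close>-linear maps \<open>\<Lambda>V \<otimes> \<Lambda>sV \<rightarrow> \<Lambda>V\<close> of degree \<open>m\<close>.\<close>

definition HomA :: "('k::field_char_0, 'b::ring_1) gens \<Rightarrow> int \<Rightarrow> ('b \<Rightarrow> 'b) set" where
  "HomA G m = {g. Vector_Spaces.linear (sm G) (sm G) g \<and>
     (\<forall>j. g ` Deg G j \<subseteq> LV G \<inter> Deg G (j + m)) \<and>
     (\<forall>j. \<forall>x\<in>LV G \<inter> Deg G j. \<forall>y. g (x * y) = ksign (m * j) (x * g y))}"

text \<open>\<open>D(g) = d \<circ> g + (-1)\<^bsup>m+1\<^esup> g \<circ> d\<close> for \<open>g \<in> A\<^sup>m\<close>; \<open>\<delta>\<close> restricts to \<open>d\<close> on \<open>\<Lambda>V\<close>.\<close>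

definition homD :: "('b::ring_1 \<Rightarrow> 'b) \<Rightarrow> int \<Rightarrow> ('b \<Rightarrow> 'b) \<Rightarrow> 'b \<Rightarrow> 'b" where
  "homD \<delta> m g = (\<lambda>x. \<delta> (g x) + ksign (m + 1) (g (\<delta> x)))"

text \<open>\<open>f \<in> A\<^sup>N\<close> is a cocycle with nonzero class in \<open>Ext\<close>.\<close>

definition nonzero_class ::
  "('k::field_char_0, 'b::ring_1) gens \<Rightarrow> ('b \<Rightarrow> 'b) \<Rightarrow> int \<Rightarrow> ('b \<Rightarrow> 'b) \<Rightarrow> bool" where
  "nonzero_class G \<delta> N f \<longleftrightarrow>
     f \<in> HomA G N \<and> homD \<delta> N f = 0 \<and> f \<notin> homD \<delta> (N - 1) ` HomA G (N - 1)"

text \<open>\<open>Ext\<^sup>*\<close> is one-dimensional, spanned by the class of \<open>f \<in> A\<^sup>N\<close>.\<close>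

definition generates_Ext ::
  "('k::field_char_0, 'b::ring_1) gens \<Rightarrow> ('b \<Rightarrow> 'b) \<Rightarrow> int \<Rightarrow> ('b \<Rightarrow> 'b) \<Rightarrow> bool" where
  "generates_Ext G \<delta> N f \<longleftrightarrow>
     nonzero_class G \<delta> N f \<and>
     (\<forall>g\<in>HomA G N. homD \<delta> N g = 0 \<longrightarrow>
        (\<exists>c. \<exists>\<eta>\<in>HomA G (N - 1). g = (\<lambda>x. sm G c (f x)) + homD \<delta> (N - 1) \<eta>)) \<and>
     (\<forall>m. m \<noteq> N \<longrightarrow> (\<forall>g\<in>HomA G m. homD \<delta> m g = 0 \<longrightarrow> g \<in> homD \<delta> (m - 1) ` HomA G (m - 1)))"

section \<open>The Eilenberg-Moore spectral sequence\<close>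

definition Fil :: "('k::field_char_0, 'b::ring_1) gens \<Rightarrow> int \<Rightarrow> int \<Rightarrow> ('b \<Rightarrow> 'b) set" where
  "Fil G p m = {g \<in> HomA G m. g ` LsV G \<subseteq> LVge G p}"

text \<open>
  \<open>Ext\<^bsup>p,q\<^esup> = F\<^sup>pH\<^bsup>p+q\<^esup> / F\<^bsup>p+1\<^esup>H\<^bsup>p+q\<^esup>\<close> for \<open>H = H(A, D)\<close> with the induced filtration.
\<close>

definition Ext_bideg_nonzero ::
  "('k::field_char_0, 'b::ring_1) gens \<Rightarrow> ('b \<Rightarrow> 'b) \<Rightarrow> int \<Rightarrow> int \<Rightarrow> bool" where
  "Ext_bideg_nonzero G \<delta> p q \<longleftrightarrow>
     (\<exists>g\<in>Fil G p (p + q). homD \<delta> (p + q) g = 0 \<and>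
        \<not> (\<exists>g'\<in>Fil G (p + 1) (p + q). \<exists>\<eta>\<in>HomA G (p + q - 1).
              homD \<delta> (p + q) g' = 0 \<and> g = g' + homD \<delta> (p + q - 1) \<eta>))"

text \<open>
  \<open>ss_Z G \<delta> r p m\<close> is the set \<open>Z\<^sub>r\<^bsup>p,m-p\<^esup>\<close> of elements of \<open>F\<^sup>pA\<^sup>m\<close> with \<open>D\<close> in \<open>F\<^bsup>p+r\<^esup>\<close>, and
  \<open>ss_B G \<delta> r p m\<close> is \<open>Z\<^bsub>r-1\<^esub>\<^bsup>p+1\<^esup> + D Z\<^bsub>r-1\<^esub>\<^bsup>p-r+1\<^esup>\<close>, so that \<open>E\<^sub>r\<^bsup>p,m-p\<^esup> = ss_Z / ss_B\<close> and \<open>D\<close> induces the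
  differential of \<open>E\<^sub>r\<close>, of bidegree \<open>(r, 1 - r)\<close>.
\<close>

definition ss_Z ::
  "('k::field_char_0, 'b::ring_1) gens \<Rightarrow> ('b \<Rightarrow> 'b) \<Rightarrow> int \<Rightarrow> int \<Rightarrow> int \<Rightarrow> ('b \<Rightarrow> 'b) set" where
  "ss_Z G \<delta> r p m = {g \<in> Fil G p m. homD \<delta> m g \<in> Fil G (p + r) (m + 1)}"

definition ss_B ::
  "('k::field_char_0, 'b::ring_1) gens \<Rightarrow> ('b \<Rightarrow> 'b) \<Rightarrow> int \<Rightarrow> int \<Rightarrow> int \<Rightarrow> ('b \<Rightarrow> 'b) set" where
  "ss_B G \<delta> r p m = {g + homD \<delta> (m - 1) \<eta> | g \<eta>.
     g \<in> ss_Z G \<delta> (r - 1) (p + 1) m \<and> \<eta> \<in> ss_Z G \<delta> (r - 1) (p - r + 1) (m - 1)}"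

definition degenerates_at ::
  "('k::field_char_0, 'b::ring_1) gens \<Rightarrow> ('b \<Rightarrow> 'b) \<Rightarrow> int \<Rightarrow> bool" where
  "degenerates_at G \<delta> k \<longleftrightarrow>
     (\<forall>r\<ge>k. \<forall>p m. homD \<delta> m ` ss_Z G \<delta> r p m \<subseteq> ss_B G \<delta> r (p + r) (m + 1))"

section \<open>The construction of \<open>f\<^sup>t\<close>\<close>

text \<open>
  \<open>\<delta>i k\<close> is the differential belonging to \<open>d\<^sub>k\<close> and \<open>\<delta>i i\<close>, for \<open>i > k\<close>, the part induced by \<open>d\<^sub>i\<close>.
  \<open>corr_h \<dots> h \<xi> i\<close> is \<open>h\<^sub>i\<^sup>i = h\<^sub>i\<^sup>0 - D\<^bsub>k+i\<^esub> \<xi>\<^sub>1 - \<dots> - D\<^bsub>k+1\<^esub> \<xi>\<^sub>i\<close> (in particular \<open>h\<^sub>0\<^sup>0\<close> for \<open>i = 0\<close>).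
\<close>

definition corr_h ::
  "(nat \<Rightarrow> 'b::ring_1 \<Rightarrow> 'b) \<Rightarrow> nat \<Rightarrow> int \<Rightarrow> (nat \<Rightarrow> 'b \<Rightarrow> 'b) \<Rightarrow> (nat \<Rightarrow> 'b \<Rightarrow> 'b) \<Rightarrow> nat \<Rightarrow> 'b \<Rightarrow> 'b" where
  "corr_h \<delta>i k N h \<xi> i = h i - (\<Sum>j = 1..i. homD (\<delta>i (k + i + 1 - j)) N (\<xi> j))"

definition corr_f :: "('b::ring_1 \<Rightarrow> 'b) \<Rightarrow> (nat \<Rightarrow> 'b \<Rightarrow> 'b) \<Rightarrow> nat \<Rightarrow> 'b \<Rightarrow> 'b" where
  "corr_f f \<xi> t = f - (\<Sum>j = 1..t. \<xi> j)"

text \<open>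
  \<open>h\<close> and \<open>\<xi>\<close> are choices made in the construction.  The last conjunct is the property
  \<open>Df\<^sup>t = h\<^sub>t\<^sup>t = D\<xi>\<^bsub>t+1\<^esub>\<close> of the choices in the case \<open>Df\<^sup>t \<noteq> 0\<close>.
\<close>

definition correction_run ::
  "('k::field_char_0, 'b::ring_1) gens \<Rightarrow> ('b \<Rightarrow> 'b) \<Rightarrow> (nat \<Rightarrow> 'b \<Rightarrow> 'b) \<Rightarrow> nat \<Rightarrow> int \<Rightarrow> int \<Rightarrow>
   ('b \<Rightarrow> 'b) \<Rightarrow> nat \<Rightarrow> (nat \<Rightarrow> 'b \<Rightarrow> 'b) \<Rightarrow> (nat \<Rightarrow> 'b \<Rightarrow> 'b) \<Rightarrow> bool" where
  "correction_run G \<delta> \<delta>i k p N f t h \<xi> \<longleftrightarrow>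
     homD \<delta> N f = (\<Sum>i\<le>t. h i) \<and>
     (\<forall>i\<le>t. h i \<in> HomA G (N + 1) \<and> h i ` LsV G \<subseteq> LVlen G (p + int k - 1 + int i)) \<and>
     h t \<noteq> 0 \<and>
     (\<forall>i\<le>t. \<xi> (i + 1) \<in> HomA G N \<and> homD (\<delta>i k) N (\<xi> (i + 1)) = corr_h \<delta>i k N h \<xi> i) \<and>
     (homD \<delta> N (corr_f f \<xi> t) \<noteq> 0 \<longrightarrow>
        homD \<delta> N (corr_f f \<xi> t) = corr_h \<delta>i k N h \<xi> t \<and>
        corr_h \<delta>i k N h \<xi> t = homD \<delta> N (\<xi> (t + 1)))"

text \<open>
  The equations for the \<open>\<xi>\<^sub>j\<close> determine them only up to \<open>D\<^sub>k\<close>-cocycles, and such a cocycle could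
  cancel the class of \<open>f\<close>: as \<open>D\<^sub>k f = 0\<close> forces \<open>h\<^sub>0\<^sup>0 = 0\<close>, even \<open>\<xi>\<^sub>1 = f\<close> solves \<open>D\<^sub>k \<xi>\<^sub>1 = h\<^sub>0\<^sup>0\<close>.
  Corrections are therefore taken in the filtration suggested by the word lengths of the
  \<open>h\<^sub>i\<^sup>i\<close>: \<open>\<xi>\<^sub>1\<close> lies in \<open>F\<^sup>p\<close>, the later ones lie in \<open>F\<^bsup>p+1\<^esup>\<close>, and \<open>f - \<xi>\<^sub>1\<close> still represents a
  nonzero class for \<open>d\<^sub>k\<close>.  For \<open>\<xi>\<^sub>1 = 0\<close> the conditions on \<open>\<xi>\<^sub>1\<close> hold automatically.
\<close>

definition keeps_class ::
  "('k::field_char_0, 'b::ring_1) gens \<Rightarrow> ('b \<Rightarrow> 'b) \<Rightarrow> int \<Rightarrow> int \<Rightarrow>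
   ('b \<Rightarrow> 'b) \<Rightarrow> nat \<Rightarrow> (nat \<Rightarrow> 'b \<Rightarrow> 'b) \<Rightarrow> bool" where
  "keeps_class G \<delta>k p N f t \<xi> \<longleftrightarrow>
     \<xi> 1 \<in> Fil G p N \<and> nonzero_class G \<delta>k N (f - \<xi> 1) \<and>
     (\<forall>j\<in>{2..t + 1}. \<xi> j \<in> Fil G (p + 1) N)"

text \<open>\<open>f\<^sup>t\<close>, replaced by \<open>f\<^sup>t - \<xi>\<^bsub>t+1\<^esub>\<close> when it is not a cocycle.\<close>

definition corrected ::
  "('b::ring_1 \<Rightarrow> 'b) \<Rightarrow> int \<Rightarrow> ('b \<Rightarrow> 'b) \<Rightarrow> nat \<Rightarrow> (nat \<Rightarrow> 'b \<Rightarrow> 'b) \<Rightarrow> 'b \<Rightarrow> 'b" where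
  "corrected \<delta> N f t \<xi> =
     (if homD \<delta> N (corr_f f \<xi> t) = 0 then corr_f f \<xi> t else corr_f f \<xi> t - \<xi> (t + 1))"

end

(* The complex A is Hom(Lambda sV, Lambda V).  Its differential D is the sum of the Koszul part dual to
sv |-> v and of a remainder that increases the length in V.  The operator g |-> sum of
(d/dv_i) o g o (sv_i .) is a contraction of the Koszul part up to a weight that vanishes at a single
coordinate, so the Koszul cohomology is one-dimensional.  As the contraction lowers the length in V by
only one, a perturbation argument, convergent for degree reasons, shows that the cohomology of D
is one-dimensional, in a degree and filtration that do not depend on D, and that a coboundary in F^q is
D of an element of F^(q-1).  The last fact gives degeneration, and the comparison with D_k: since
D - D_k maps F^q to F^(q+2), if f - eta = D xi with eta in F^(p+1), then xi can be taken in F^(p-1),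
so f - D_k xi is a D_k-cocycle in F^(p+1), thus a D_k-coboundary, and the class of f is zero. *)

theory Submission
  imports Defs
begin

text \<open>The obstacle is convergence. The remainder of D gains at least one in the length in V
  and the contraction loses one, so a round of the perturbation need not advance in length alone.
  Progress shows in a second weight, \<open>len_wt\<close> times the length in V of the output minus
  the length in sV of the input: each contraction evaluates the map at an input that is one factor
  \<open>sv\<close> longer, and this gains one. As \<open>len_wt\<close> exceeds the degree of every
  generator, the weight is at least m on all maps of degree m, and at a fixed input the degree also
  bounds it from above, so the series of corrections is finite at each argument. The length
  filtration is carried through the same inductions, because the index q - 1 must come out of them
  as well. The exceptional coordinate has the product of the \<open>sv\<close> with v of even degree
  as input and the product of the v of odd degree as output. Degree and filtration of the class can
  therefore be read off the degrees of the generators.\<close>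

lemma ksign_add [simp]: "ksign m (x + y) = ksign m x + ksign m y"
  and ksign_diff [simp]: "ksign m (x - y) = ksign m x - ksign m y"
  and ksign_minus [simp]: "ksign m (- x) = - ksign m x"
  and ksign_zero [simp]: "ksign m 0 = 0"
  and ksign_0 [simp]: "ksign 0 x = x"
  and ksign_mult_left [simp]: "ksign m x * y = ksign m (x * y)"
  and ksign_mult_right [simp]: "x * ksign m y = ksign m (x * y)"
  and ksign_ksign [simp]: "ksign m (ksign n x) = ksign (m + n) x"
  by (auto simp: ksign_def)

lemma ksign_eq_zero_iff [simp]: "ksign m x = 0 \<longleftrightarrow> x = 0"
  by (simp add: ksign_def)

lemma ksign_sum: "ksign m (sum f A) = (\<Sum>i\<in>A. ksign m (f i))"
  by (auto simp: ksign_def sum_negf)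

lemma ksign_cong: "even m \<longleftrightarrow> even n \<Longrightarrow> x = y \<Longrightarrow> ksign m x = ksign n y"
  by (simp add: ksign_def)

lemma ksign_neg_cong: "even m \<longleftrightarrow> odd n \<Longrightarrow> x = y \<Longrightarrow> ksign m x = - ksign n y"
  by (simp add: ksign_def)

text \<open>Degrees of at least 2 put every suspended generator in positive degree, so a word in sV
  is no longer than its degree (\<open>vlen_le_mdeg\<close>). The lower bound
  \<open>Hom_filt\<close> rests on this.\<close>

locale graded_free =
  fixes G :: "('k::field_char_0, 'b::ring_1) gens"
  assumes free: "free_gca G" and dg_ge_2: "i < rk G \<Longrightarrow> 2 \<le> dg G i"
begin

sublocale V: vector_space "sm G"
  using free by (simp add: free_gca_def)

abbreviation scl (infixr \<open>*s\<close> 75) where "c *s x \<equiv> sm G c x"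
abbreviation lin where "lin \<equiv> Vector_Spaces.linear (sm G) (sm G)"
abbreviation n where "n \<equiv> rk G"
abbreviation va where "va e \<equiv> vlen G (fst e)"
abbreviation vb where "vb e \<equiv> vlen G (snd e)"

section \<open>Linear maps over the ground field\<close>

lemma lin_iff: "lin f \<longleftrightarrow> (\<forall>x y. f (x + y) = f x + f y) \<and> (\<forall>c x. f (c *s x) = c *s f x)"
  unfolding Vector_Spaces.linear_iff using V.vector_space_axioms by blast

lemma linI: "(\<And>x y. f (x + y) = f x + f y) \<Longrightarrow> (\<And>c x. f (c *s x) = c *s f x) \<Longrightarrow> lin f"
  by (simp add: lin_iff)

lemma lin_add: "lin f \<Longrightarrow> f (x + y) = f x + f y"
  and lin_scale: "lin f \<Longrightarrow> f (c *s x) = c *s f x"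
  by (auto simp: lin_iff)

lemma lin_zero: "lin f \<Longrightarrow> f 0 = 0"
  using lin_scale[of f 0 0] by simp

lemma lin_neg: "lin f \<Longrightarrow> f (- x) = - f x"
  using lin_scale[of f "-1" x] by simp

lemma lin_diff: "lin f \<Longrightarrow> f (x - y) = f x - f y"
  using lin_add[of f x "- y"] lin_neg[of f y] by simp

lemma lin_sum: "lin f \<Longrightarrow> f (sum h A) = (\<Sum>i\<in>A. f (h i))"
  by (induction A rule: infinite_finite_induct) (auto simp: lin_zero lin_add)

lemma lin_ksign: "lin f \<Longrightarrow> f (ksign m x) = ksign m (f x)"
  by (simp add: ksign_def lin_neg)

lemma scale_mult_left [simp]: "(c *s x) * y = c *s (x * y)"
  and scale_mult_right [simp]: "x * (c *s y) = c *s (x * y)"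
  using free unfolding free_gca_def by metis+

lemma ksign_scale [simp]: "ksign m (c *s x) = c *s ksign m x"
  by (simp add: ksign_def)

lemma lin_compose: "lin f \<Longrightarrow> lin g \<Longrightarrow> lin (\<lambda>x. f (g x))"
  and lin_plus: "lin f \<Longrightarrow> lin g \<Longrightarrow> lin (\<lambda>x. f x + g x)"
  and lin_minus: "lin f \<Longrightarrow> lin g \<Longrightarrow> lin (\<lambda>x. f x - g x)"
  and lin_signed: "lin f \<Longrightarrow> lin (\<lambda>x. ksign m (f x))"
  and lin_scaled: "lin f \<Longrightarrow> lin (\<lambda>x. c *s f x)"
  and lin_mult_left: "lin f \<Longrightarrow> lin (\<lambda>x. y * f x)"
  and lin_mult_right: "lin f \<Longrightarrow> lin (\<lambda>x. f x * y)"
  and lin_const_zero: "lin (\<lambda>x. 0)"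
  and lin_id: "lin (\<lambda>x. x)"
  by (auto simp: lin_iff algebra_simps V.scale_right_distrib V.scale_right_diff_distrib
      V.scale_left_commute)

lemma lin_setsum: "(\<And>i. i \<in> I \<Longrightarrow> lin (f i)) \<Longrightarrow> lin (\<lambda>x. \<Sum>i\<in>I. f i x)"
  by (induction I rule: infinite_finite_induct) (auto simp: lin_const_zero lin_plus)

lemmas lin_intros = lin_plus lin_minus lin_signed lin_scaled lin_mult_left
  lin_mult_right lin_const_zero lin_id lin_setsum

section \<open>Monomials\<close>

text \<open>All \<open>2n\<close> generators in one list: first the \<open>v\<^sub>i\<close>, then the \<open>sv\<^sub>i\<close>.\<close>

definition gen :: "nat \<Rightarrow> 'b" where
  "gen l = (if l < n then gv G l else gs G (l - n))"

definition gd :: "nat \<Rightarrow> int" where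
  "gd l = (if l < n then int (dg G l) else int (dg G (l - n)) - 1)"

definition ex :: "(nat \<Rightarrow> nat) \<times> (nat \<Rightarrow> nat) \<Rightarrow> nat \<Rightarrow> nat" where
  "ex e l = (if l < n then fst e l else snd e (l - n))"

definition upd :: "nat \<Rightarrow> nat \<Rightarrow> (nat \<Rightarrow> nat) \<times> (nat \<Rightarrow> nat) \<Rightarrow> (nat \<Rightarrow> nat) \<times> (nat \<Rightarrow> nat)" where
  "upd l c e = (if l < n then ((fst e)(l := c), snd e) else (fst e, (snd e)(l - n := c)))"

abbreviation inc where "inc l e \<equiv> upd l (Suc (ex e l)) e"
abbreviation dec where "dec l e \<equiv> upd l (ex e l - 1) e"

lemma ex_upd: "ex (upd l c e) l' = (if l' = l then c else ex e l')"
  by (auto simp: ex_def upd_def)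

lemma upd_upd [simp]: "upd l c (upd l c' e) = upd l c e"
  by (auto simp: upd_def)

lemma upd_ex [simp]: "upd l (ex e l) e = e"
  by (auto simp: upd_def ex_def)

lemma upd_commute: "l \<noteq> l' \<Longrightarrow> upd l c (upd l' c' e) = upd l' c' (upd l c e)"
  by (auto simp: upd_def fun_upd_twist)

lemma gen_simps [simp]: "l < n \<Longrightarrow> gen l = gv G l" "gen (n + l) = gs G l"
  and gd_simps [simp]: "l < n \<Longrightarrow> gd l = int (dg G l)" "gd (n + l) = int (dg G l) - 1"
  and ex_nth [simp]: "l < n \<Longrightarrow> ex e l = fst e l" "ex e (n + l) = snd e l"
  by (auto simp: gen_def gd_def ex_def)

lemma gen_commute:
  assumes "l < 2 * n" "l' < 2 * n"
  shows "gen l * gen l' = ksign (gd l * gd l') (gen l' * gen l)"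
proof -
  have vv: "gv G i * gv G j = ksign (int (dg G i) * int (dg G j)) (gv G j * gv G i)"
    and vs: "gv G i * gs G j = ksign (int (dg G i) * (int (dg G j) - 1)) (gs G j * gv G i)"
    and ss: "gs G i * gs G j = ksign ((int (dg G i) - 1) * (int (dg G j) - 1)) (gs G j * gs G i)"
    if "i < n" "j < n" for i j
    using free that unfolding free_gca_def by blast+
  have sv: "gs G j * gv G i = ksign ((int (dg G j) - 1) * int (dg G i)) (gv G i * gs G j)"
    if "i < n" "j < n" for i j
    unfolding vs[OF that] by (simp add: ksign_def)
  consider "l < n" "l' < n" | "l < n" "\<not> l' < n" | "\<not> l < n" "l' < n" | "\<not> l < n" "\<not> l' < n"
    by blast
  then show ?thesis
    using assms vv[of l l'] vs[of l "l' - n"] sv[of l' "l - n"] ss[of "l - n" "l' - n"]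
    by cases (simp_all add: gen_def gd_def)
qed

text \<open>Graded commutativity only shows that twice the square vanishes; characteristic zero
  allows division by 2.\<close>

lemma gen_square_zero:
  assumes "l < 2 * n" "odd (gd l)"
  shows "gen l * gen l = 0"
proof -
  have "gen l * gen l = - (gen l * gen l)"
    using gen_commute[OF assms(1,1)] assms(2) by (simp add: ksign_def)
  then have "2 *s (gen l * gen l) = 0"
    using V.scale_left_distrib[of 1 1 "gen l * gen l"] by (simp add: eq_neg_iff_add_eq_0)
  then show ?thesis by (simp add: V.scale_eq_0_iff)
qed

text \<open>The index list is arbitrary so that an ordered monomial can be cut at the place where a
  generator is inserted.\<close>

definition monol :: "(nat \<Rightarrow> nat) \<Rightarrow> nat list \<Rightarrow> 'b" where
  "monol c L = prod_list (map (\<lambda>l. gen l ^ c l) L)"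

lemma monol_simps [simp]: "monol c [] = 1" "monol c (l # L) = gen l ^ c l * monol c L"
  "monol c (L @ L') = monol c L * monol c L'"
  by (auto simp: monol_def)

lemma monol_cong: "(\<And>l. l \<in> set L \<Longrightarrow> c l = c' l) \<Longrightarrow> monol c L = monol c' L"
  unfolding monol_def by (intro arg_cong[where f = prod_list] map_cong) auto

lemma mono_eq_monol: "mono G e = monol (ex e) [0..<2 * n]"
proof -
  have "[0..<2 * n] = [0..<n] @ map (\<lambda>i. i + n) [0..<n]"
    using upt_add_eq_append[of 0 n n] by (simp add: mult_2 map_add_upt)
  then have "monol (ex e) [0..<2 * n] =
      monol (ex e) [0..<n] * prod_list (map (\<lambda>i. gen (i + n) ^ ex e (i + n)) [0..<n])"
    by (simp add: monol_def comp_def)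
  also have "monol (ex e) [0..<n] = prod_list (map (\<lambda>i. gv G i ^ fst e i) [0..<n])"
    unfolding monol_def by (intro arg_cong[where f = prod_list] map_cong) auto
  also have "map (\<lambda>i. gen (i + n) ^ ex e (i + n)) [0..<n] = map (\<lambda>i. gs G i ^ snd e i) [0..<n]"
    by (simp add: gen_def ex_def)
  finally show ?thesis by (simp add: mono_def split_beta)
qed

text \<open>With the common numbering, the two parity conditions on v and on sv become one: a
  generator of odd degree \<open>gd\<close> occurs at most once.\<close>

lemma expos_iff: "e \<in> expos G \<longleftrightarrow>
  (\<forall>i\<ge>n. fst e i = 0 \<and> snd e i = 0) \<and> (\<forall>l<2 * n. odd (gd l) \<longrightarrow> ex e l \<le> 1)"
proof -
  have "(\<forall>l<2 * n. odd (gd l) \<longrightarrow> ex e l \<le> 1) \<longleftrightarrow>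
    (\<forall>l<n. odd (gd l) \<longrightarrow> ex e l \<le> 1) \<and> (\<forall>l<n. odd (gd (n + l)) \<longrightarrow> ex e (n + l) \<le> 1)"
    (is "?L \<longleftrightarrow> ?R")
  proof
    assume ?R
    show ?L
    proof (intro allI impI)
      fix l assume "l < 2 * n" "odd (gd l)"
      then show "ex e l \<le> 1"
        using \<open>?R\<close> by (cases "l < n") (auto simp: not_less le_iff_add)
    qed
  next
    assume L: ?L
    show ?R
    proof (intro conjI allI impI)
      show "ex e l \<le> 1" if "l < n" "odd (gd l)" for l
        using L[rule_format, of l] that by simp
      show "ex e (n + l) \<le> 1" if "l < n" "odd (gd (n + l))" for l
        using L[rule_format, of "n + l"] that by simp
    qed
  qed
  then show ?thesis
    by (cases e) (simp add: expos_def, blast)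
qed

lemma expos_ex_le: "e \<in> expos G \<Longrightarrow> l < 2 * n \<Longrightarrow> odd (gd l) \<Longrightarrow> ex e l \<le> 1"
  by (simp add: expos_iff)

lemma expos_upd:
  assumes "e \<in> expos G" "l < 2 * n" "odd (gd l) \<Longrightarrow> c \<le> 1"
  shows "upd l c e \<in> expos G"
  using assms unfolding expos_iff by (auto simp: ex_upd) (auto simp: upd_def)

lemma expos_dec: "e \<in> expos G \<Longrightarrow> l < 2 * n \<Longrightarrow> dec l e \<in> expos G"
  by (rule expos_upd) (auto dest: expos_ex_le)

lemma expos_eqI:
  assumes "e \<in> expos G" "e' \<in> expos G" "\<And>l. l < 2 * n \<Longrightarrow> ex e l = ex e' l"
  shows "e = e'"
proof (intro prod_eqI ext)
  fix i
  show "fst e i = fst e' i"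
    using assms(3)[of i] assms(1,2) by (cases "i < n") (auto simp: expos_iff)
  show "snd e i = snd e' i"
    using assms(3)[of "n + i"] assms(1,2) by (cases "i < n") (auto simp: expos_iff)
qed

lemma zero_expos: "((\<lambda>_. 0), (\<lambda>_. 0)) \<in> expos G"
  by (simp add: expos_def)

lemma expos_fst: "e \<in> expos G \<Longrightarrow> (fst e, \<lambda>_. 0) \<in> expos G"
  and expos_snd: "e \<in> expos G \<Longrightarrow> (\<lambda>_. 0, snd e) \<in> expos G"
  by (auto simp: expos_def)

lemma expos_pair: "(a, \<lambda>_. 0) \<in> expos G \<Longrightarrow> (\<lambda>_. 0, b) \<in> expos G \<Longrightarrow> (a, b) \<in> expos G"
  by (auto simp: expos_def)

lemma vlen_zero [simp]: "vlen G (\<lambda>_. 0) = 0"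
  by (simp add: vlen_def)

lemma vlen_nonneg [simp]: "0 \<le> vlen G a"
  by (simp add: vlen_def sum_nonneg)

lemma expos_va_zero: "e \<in> expos G \<Longrightarrow> va e = 0 \<Longrightarrow> fst e = (\<lambda>_. 0)"
  and expos_vb_zero: "e \<in> expos G \<Longrightarrow> vb e = 0 \<Longrightarrow> snd e = (\<lambda>_. 0)"
  by (auto simp: vlen_def sum_nonneg_eq_0_iff expos_iff fun_eq_iff) (meson not_le lessThan_iff)+

lemma mono_mult: "mono G (a, \<lambda>_. 0) * mono G (\<lambda>_. 0, b) = mono G (a, b)"
proof -
  have "prod_list (map (\<lambda>i. 1::'b) xs) = 1" for xs :: "nat list"
    by (induction xs) auto
  then show ?thesis by (simp add: mono_def)
qed

lemma mono_zero [simp]: "mono G (\<lambda>_. 0, \<lambda>_. 0) = 1"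
proof -
  have "prod_list (map (\<lambda>i. 1::'b) xs) = 1" for xs :: "nat list"
    by (induction xs) auto
  then show ?thesis by (simp add: mono_def)
qed

lemma sum_split_gens: "(\<Sum>l<2 * n. f l) = (\<Sum>i<n. f i) + (\<Sum>i<n. f (n + i) :: int)"
proof -
  have "{..<2 * n} = {..<n} \<union> {n..<2 * n}" by auto
  then have "(\<Sum>l<2 * n. f l) = (\<Sum>i<n. f i) + (\<Sum>l\<in>{n..<2 * n}. f l)"
    by (simp add: sum.union_disjoint ivl_disj_int)
  also have "(\<Sum>l\<in>{n..<2 * n}. f l) = (\<Sum>i<n. f (n + i))"
    by (rule sum.reindex_bij_witness[of _ "\<lambda>i. n + i" "\<lambda>l. l - n"]) auto
  finally show ?thesis .
qed

lemma mdeg_eq: "mdeg G e = (\<Sum>l<2 * n. int (ex e l) * gd l)"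
  unfolding sum_split_gens mdeg_def split_beta sum.distrib by simp

lemma va_eq: "va e = (\<Sum>l<2 * n. int (ex e l) * (if l < n then 1 else 0))"
  and vb_eq: "vb e = (\<Sum>l<2 * n. int (ex e l) * (if l < n then 0 else 1))"
  unfolding sum_split_gens vlen_def by simp_all

text \<open>Degree and both word lengths are additive in the exponents, with \<open>gd\<close> and
  two indicator functions as weights, so one computation serves all three.\<close>

lemma weight_upd:
  assumes "l < 2 * n"
  shows "(\<Sum>l'<2 * n. int (ex (upd l c e) l') * w l') =
    (\<Sum>l'<2 * n. int (ex e l') * w l') + (int c - int (ex e l)) * w l"
proof -
  have "(\<Sum>l'<2 * n. int (ex (upd l c e) l') * w l') =
      (\<Sum>l'\<in>{..<2 * n} - {l}. int (ex e l') * w l') + int c * w l"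
    using assms by (subst sum.remove[of _ l]) (auto simp: ex_upd)
  moreover have "(\<Sum>l'<2 * n. int (ex e l') * w l') =
      (\<Sum>l'\<in>{..<2 * n} - {l}. int (ex e l') * w l') + int (ex e l) * w l"
    using assms by (subst sum.remove[of _ l]) auto
  ultimately show ?thesis by (simp add: algebra_simps)
qed

lemma mdeg_upd: "l < 2 * n \<Longrightarrow> mdeg G (upd l c e) = mdeg G e + (int c - int (ex e l)) * gd l"
  and va_upd: "l < 2 * n \<Longrightarrow>
    va (upd l c e) = va e + (if l < n then int c - int (ex e l) else 0)"
  and vb_upd: "l < 2 * n \<Longrightarrow>
    vb (upd l c e) = vb e + (if l < n then 0 else int c - int (ex e l))"
  unfolding mdeg_eq va_eq vb_eq by (simp_all add: weight_upd)

text \<open>\<open>sgn_at l c\<close> is the exponent of the sign of moving \<open>gen l\<close> past all earlier generators.\<close>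

definition sgn_at :: "nat \<Rightarrow> (nat \<Rightarrow> nat) \<Rightarrow> int" where
  "sgn_at l c = gd l * (\<Sum>l'<l. int (c l') * gd l')"

lemma gen_monol:
  assumes "l < 2 * n" "set L \<subseteq> {..<2 * n}"
  shows "gen l * monol c L = ksign (gd l * (\<Sum>l'\<leftarrow>L. int (c l') * gd l')) (monol c L * gen l)"
  using assms(2)
proof (induction L)
  case (Cons l' L)
  have pow: "gen l * gen l' ^ j = ksign (gd l * (int j * gd l')) (gen l' ^ j * gen l)" for j
  proof (induction j)
    case (Suc j)
    have "gen l * gen l' ^ Suc j = ksign (gd l * gd l') (gen l' * (gen l * gen l' ^ j))"
      using gen_commute[OF assms(1), of l'] Cons.prems
      by (metis (no_types, lifting) insert_subset ksign_mult_left lessThan_iff list.set(2)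
          mult.assoc power_Suc)
    then show ?case
      unfolding Suc.IH by (simp add: mult.assoc algebra_simps)
  qed simp
  have "gen l * monol c (l' # L) = (gen l * gen l' ^ c l') * monol c L"
    by (simp add: mult.assoc)
  also have "\<dots> = ksign (gd l * (int (c l') * gd l')) (gen l' ^ c l' * (gen l * monol c L))"
    unfolding pow by (simp add: mult.assoc)
  finally show ?case
    using Cons by (simp add: mult.assoc algebra_simps)
qed simp

text \<open>This remains true when \<open>inc l e\<close> leaves \<open>expos\<close>: both sides
  then vanish, by \<open>gen_mono_zero\<close>.\<close>

lemma gen_mono:
  assumes "l < 2 * n"
  shows "gen l * mono G e = ksign (sgn_at l (ex e)) (mono G (inc l e))"
proof -
  have split: "[0..<2 * n] = [0..<l] @ l # [Suc l..<2 * n]"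
    using assms upt_add_eq_append[of 0 l "2 * n - l"] by (simp add: upt_conv_Cons)
  have sum: "(\<Sum>l'\<leftarrow>[0..<l]. int (ex e l') * gd l') = (\<Sum>l'<l. int (ex e l') * gd l')"
    by (simp add: interv_sum_list_conv_sum_set_nat lessThan_atLeast0)
  have "gen l * mono G e =
      (gen l * monol (ex e) [0..<l]) * (gen l ^ ex e l * monol (ex e) [Suc l..<2 * n])"
    unfolding mono_eq_monol split by (simp add: mult.assoc)
  also have "\<dots> = ksign (sgn_at l (ex e))
      (monol (ex e) [0..<l] * (gen l ^ Suc (ex e l) * monol (ex e) [Suc l..<2 * n]))"
    using assms by (subst gen_monol) (auto simp: sgn_at_def sum mult.assoc)
  also have "monol (ex e) [0..<l] = monol (ex (inc l e)) [0..<l]"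
    by (rule monol_cong) (auto simp: ex_upd)
  also have "monol (ex e) [Suc l..<2 * n] = monol (ex (inc l e)) [Suc l..<2 * n]"
    by (rule monol_cong) (auto simp: ex_upd)
  finally show ?thesis
    unfolding mono_eq_monol split monol_simps by (simp only: ex_upd[of l _ e l] simp_thms if_True)
qed

lemma gen_mono_zero:
  assumes "l < 2 * n" "odd (gd l)" "ex e l \<ge> 1"
  shows "gen l * mono G e = 0"
proof -
  have "inc l (dec l e) = e"
    using assms(3) by (simp add: ex_upd)
  then have "mono G e = ksign (sgn_at l (ex (dec l e))) (gen l * mono G (dec l e))"
    using gen_mono[OF assms(1), of "dec l e"] by (simp add: ksign_def)
  then show ?thesis
    using gen_square_zero[OF assms(1,2)] by (simp add: mult.assoc[symmetric])
qed

text \<open>The induction peels off one generator and stays inside \<open>expos\<close>. It is the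
  form in which rules for multiplication by a generator spread to all monomials.\<close>

lemma mono_induct [consumes 1, case_names one gen]:
  assumes "e \<in> expos G"
    and one: "P (\<lambda>_. 0, \<lambda>_. 0)"
    and gen: "\<And>l e. l < 2 * n \<Longrightarrow> e \<in> expos G \<Longrightarrow> inc l e \<in> expos G \<Longrightarrow> P e \<Longrightarrow> P (inc l e)"
  shows "P e"
  using assms(1)
proof (induction "\<Sum>l<2 * n. ex e l" arbitrary: e)
  case 0
  then have "e = (\<lambda>_. 0, \<lambda>_. 0)"
    by (intro expos_eqI zero_expos) (auto simp: ex_def)
  then show ?case using one by simp
next
  case (Suc N)
  then obtain l where l: "l < 2 * n" "ex e l > 0"
    by (metis (no_types, lifting) lessThan_iff nat.distinct(1) neq0_conv sum.neutral)
  have inc: "inc l (dec l e) = e"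
    using l by (simp add: ex_upd)
  have "(\<Sum>l<2 * n. ex e l) = ex e l + (\<Sum>l\<in>{..<2 * n} - {l}. ex e l)"
    using l by (intro sum.remove) auto
  moreover have "(\<Sum>l'<2 * n. ex (dec l e) l') = ex e l - 1 + (\<Sum>l\<in>{..<2 * n} - {l}. ex e l)"
    using l by (subst sum.remove[of _ l]) (auto simp: ex_upd)
  ultimately have "N = (\<Sum>l'<2 * n. ex (dec l e) l')"
    using Suc.hyps(2) l(2) by linarith
  then have "P (dec l e)"
    using Suc.hyps(1) expos_dec[OF Suc.prems l(1)] by blast
  then show ?case
    by (metis gen[OF l(1) expos_dec[OF Suc.prems l(1)]] inc Suc.prems)
qed

section \<open>Coordinates with respect to the monomial basis\<close>

text \<open>The value 0 outside \<open>expos\<close> makes every support a set of admissible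
  exponents, on which \<open>mono G\<close> is injective; coordinates can thus be named by exponents
  instead of basis elements.\<close>

definition coef :: "(nat \<Rightarrow> nat) \<times> (nat \<Rightarrow> nat) \<Rightarrow> 'b \<Rightarrow> 'k" where
  "coef e x = (if e \<in> expos G then V.representation (mono G ` expos G) x (mono G e) else 0)"

definition supp :: "'b \<Rightarrow> ((nat \<Rightarrow> nat) \<times> (nat \<Rightarrow> nat)) set" where
  "supp x = {e. coef e x \<noteq> 0}"

lemma basis: "V.independent (mono G ` expos G)" "x \<in> V.span (mono G ` expos G)"
  "inj_on (mono G) (expos G)"
  using free by (auto simp: free_gca_def)

lemma coef_add [simp]: "coef e (x + y) = coef e x + coef e y"
  and coef_diff [simp]: "coef e (x - y) = coef e x - coef e y"
  and coef_scale [simp]: "coef e (c *s x) = c * coef e x"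
  and coef_zero [simp]: "coef e 0 = 0"
  using basis
  by (simp_all add: coef_def V.representation_add V.representation_diff V.representation_scale
      V.representation_zero)

lemma coef_neg [simp]: "coef e (- x) = - coef e x"
  using coef_diff[of e 0 x] by simp

lemma coef_sum: "coef e (sum f A) = (\<Sum>i\<in>A. coef e (f i))"
  by (induction A rule: infinite_finite_induct) auto

lemma coef_mono: "e' \<in> expos G \<Longrightarrow> coef e (mono G e') = (if e = e' then 1 else 0)"
  using basis inj_onD[OF basis(3)] by (auto simp: coef_def V.representation_basis)

lemma coef_ksign_eq_0 [simp]: "coef e (ksign m x) = 0 \<longleftrightarrow> coef e x = 0"
  by (simp add: ksign_def)

lemma supp_expos: "e \<in> supp x \<Longrightarrow> e \<in> expos G"
  by (auto simp: supp_def coef_def split: if_splits)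

lemma supp_finite: "finite (supp x)"
proof -
  have "mono G ` supp x \<subseteq> {b. V.representation (mono G ` expos G) x b \<noteq> 0}"
    by (auto simp: supp_def coef_def split: if_splits)
  then have "finite (mono G ` supp x)"
    by (rule finite_subset) (rule V.finite_representation)
  moreover have "inj_on (mono G) (supp x)"
    by (rule inj_on_subset[OF basis(3)]) (auto simp: supp_def coef_def split: if_splits)
  ultimately show ?thesis
    by (rule finite_imageD)
qed

lemma expand_superset:
  assumes "finite S" "supp x \<subseteq> S" "S \<subseteq> expos G"
  shows "x = (\<Sum>e\<in>S. coef e x *s mono G e)"
proof -
  have inj: "inj_on (mono G) S"
    using basis(3) assms(3) by (rule inj_on_subset)
  have "b \<in> mono G ` S" if b: "V.representation (mono G ` expos G) x b \<noteq> 0" for b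
  proof -
    obtain e where "e \<in> expos G" "b = mono G e"
      using V.representation_ne_zero[OF b] by blast
    then show ?thesis
      using b subsetD[OF assms(2), of e] by (simp add: supp_def coef_def)
  qed
  then have "(\<Sum>b | V.representation (mono G ` expos G) x b \<noteq> 0.
        V.representation (mono G ` expos G) x b *s b) =
      (\<Sum>b\<in>mono G ` S. V.representation (mono G ` expos G) x b *s b)"
    using assms(1) by (intro sum.mono_neutral_left) auto
  then have "x = (\<Sum>b\<in>mono G ` S. V.representation (mono G ` expos G) x b *s b)"
    using V.sum_nonzero_representation_eq[OF basis(1) basis(2)[of x]] by simp
  also have "\<dots> = (\<Sum>e\<in>S. coef e x *s mono G e)"
    unfolding sum.reindex[OF inj] using assms(3) by (intro sum.cong) (auto simp: coef_def)
  finally show ?thesis .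
qed

lemma expand: "x = (\<Sum>e\<in>supp x. coef e x *s mono G e)"
  by (rule expand_superset[OF supp_finite subset_refl]) (auto intro: supp_expos)

lemma supp_add: "supp (x + y) \<subseteq> supp x \<union> supp y"
  and supp_diff: "supp (x - y) \<subseteq> supp x \<union> supp y"
  and supp_scale: "supp (c *s x) \<subseteq> supp x"
  and supp_ksign [simp]: "supp (ksign m x) = supp x"
  and supp_zero [simp]: "supp 0 = {}"
  and supp_uminus [simp]: "supp (- x) = supp x"
  by (auto simp: supp_def)

lemma supp_sum: "supp (sum f A) \<subseteq> (\<Union>i\<in>A. supp (f i))"
  using sum.not_neutral_contains_not_neutral by (fastforce simp: supp_def coef_sum)

lemma supp_mono: "e \<in> expos G \<Longrightarrow> supp (mono G e) = {e}"
  by (auto simp: supp_def coef_mono)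

lemma supp_empty_iff: "supp x = {} \<longleftrightarrow> x = 0"
  using trans[OF expand[of x] sum.neutral] by auto

lemma supp_lin:
  assumes "lin f"
  shows "supp (f x) \<subseteq> (\<Union>e\<in>supp x. supp (f (mono G e)))"
proof -
  have "f x = (\<Sum>e\<in>supp x. coef e x *s f (mono G e))"
    using arg_cong[OF expand, of f x] by (simp only: lin_sum[OF assms] lin_scale[OF assms])
  then show ?thesis
    using supp_sum[of "\<lambda>e. coef e x *s f (mono G e)" "supp x"] supp_scale by fastforce
qed

text \<open>All graded pieces and filtration steps are spanned by monomials, so membership in them
  becomes a condition on supports. The later counts of degrees and lengths are made in this
  form.\<close>

lemma mspan_iff: "x \<in> mspan G P \<longleftrightarrow> (\<forall>e\<in>supp x. P e)"
proof
  assume "x \<in> mspan G P"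
  then have "supp x \<subseteq> Collect P"
    unfolding mspan_def
  proof (induction rule: V.span_induct_alt)
    case (step c x y)
    then obtain e where e: "x = mono G e" "e \<in> expos G" "P e" by auto
    show ?case
      using supp_add[of "c *s x" y] supp_scale[of c x] step.IH e by (auto simp: supp_mono)
  qed simp
  then show "\<forall>e\<in>supp x. P e" by auto
next
  assume *: "\<forall>e\<in>supp x. P e"
  have "(\<Sum>e\<in>supp x. coef e x *s mono G e) \<in> mspan G P"
    unfolding mspan_def using * supp_expos
    by (intro V.span_sum V.span_scale V.span_base) auto
  then show "x \<in> mspan G P" by (simp only: expand[symmetric])
qed

lemma Deg_iff: "x \<in> Deg G m \<longleftrightarrow> (\<forall>e\<in>supp x. mdeg G e = m)"
  and LV_iff: "x \<in> LV G \<longleftrightarrow> (\<forall>e\<in>supp x. vb e = 0)"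
  and LsV_iff: "x \<in> LsV G \<longleftrightarrow> (\<forall>e\<in>supp x. va e = 0)"
  and LVlen_iff: "x \<in> LVlen G p \<longleftrightarrow> (\<forall>e\<in>supp x. va e = p \<and> vb e = 0)"
  and LVge_iff: "x \<in> LVge G p \<longleftrightarrow> (\<forall>e\<in>supp x. va e \<ge> p \<and> vb e = 0)"
  and LVsV_iff: "x \<in> LVsV G p \<longleftrightarrow> (\<forall>e\<in>supp x. va e = p \<and> vb e = 1)"
  by (auto simp: Deg_def LV_def LsV_def LVlen_def LVge_def LVsV_def mspan_iff split_beta)

lemma supp_induct [consumes 1, case_names zero add scale mono]:
  assumes S: "\<forall>e\<in>supp x. P e"
    and "Q 0" "\<And>x y. Q x \<Longrightarrow> Q y \<Longrightarrow> Q (x + y)" "\<And>c x. Q x \<Longrightarrow> Q (c *s x)"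
    and "\<And>e. e \<in> expos G \<Longrightarrow> P e \<Longrightarrow> Q (mono G e)"
  shows "Q x"
proof -
  have "Q (\<Sum>e\<in>S. coef e x *s mono G e)" if "finite S" "S \<subseteq> supp x" for S
    using that assms supp_expos by (induction S) auto
  then have "Q (\<Sum>e\<in>supp x. coef e x *s mono G e)"
    by (simp add: supp_finite)
  then show ?thesis by (simp only: expand[symmetric])
qed

lemma lin_eq_on:
  assumes "lin f" "lin g" "\<forall>e\<in>supp x. P e"
    and "\<And>e. e \<in> expos G \<Longrightarrow> P e \<Longrightarrow> f (mono G e) = g (mono G e)"
  shows "f x = g x"
  using assms(3)
  by (induction rule: supp_induct) (auto simp: assms lin_zero lin_add lin_scale)

lemma lin_eqI:
  assumes "lin f" "lin g" "\<And>e. e \<in> expos G \<Longrightarrow> f (mono G e) = g (mono G e)"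
  shows "f x = g x"
  using lin_eq_on[of f g x "\<lambda>_. True"] assms by auto

definition lext :: "((nat \<Rightarrow> nat) \<times> (nat \<Rightarrow> nat) \<Rightarrow> 'b) \<Rightarrow> 'b \<Rightarrow> 'b" where
  "lext F x = (\<Sum>e\<in>supp x. coef e x *s F e)"

lemma lext_superset: "finite S \<Longrightarrow> supp x \<subseteq> S \<Longrightarrow> lext F x = (\<Sum>e\<in>S. coef e x *s F e)"
  unfolding lext_def by (rule sum.mono_neutral_left) (auto simp: supp_def)

lemma lext_lin: "lin (lext F)"
proof (rule linI)
  fix x y c
  have "finite (supp x \<union> supp y)" by (simp add: supp_finite)
  then show "lext F (x + y) = lext F x + lext F y"
    using lext_superset[of "supp x \<union> supp y"] supp_add[of x y]
    by (simp add: V.scale_left_distrib sum.distrib)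
  show "lext F (c *s x) = c *s lext F x"
    using lext_superset[OF supp_finite[of x] supp_scale[of c x], of F]
    by (simp add: lext_def V.scale_sum_right)
qed

lemma lext_mono: "e \<in> expos G \<Longrightarrow> lext F (mono G e) = F e"
  by (simp add: lext_def supp_mono coef_mono)

section \<open>Supports of products\<close>

lemma mono_inc: "l < 2 * n \<Longrightarrow> mono G (inc l e) = ksign (sgn_at l (ex e)) (gen l * mono G e)"
  using gen_mono[of l e] by (simp add: ksign_def)

lemma supp_gen_mult:
  assumes "l < 2 * n" "e \<in> supp (gen l * x)"
  shows "\<exists>e'\<in>supp x. e = inc l e'"
proof -
  have "lin (\<lambda>x. gen l * x)" by (intro lin_intros)
  from supp_lin[OF this, of x] obtain e'
    where e': "e' \<in> supp x" "e \<in> supp (gen l * mono G e')"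
    using assms(2) by blast
  then have "\<not> (odd (gd l) \<and> ex e' l \<ge> 1)"
    using gen_mono_zero[OF assms(1), of e'] by (auto simp: supp_empty_iff)
  then have "inc l e' \<in> expos G"
    by (intro expos_upd assms supp_expos[OF e'(1)]) auto
  then show ?thesis
    using e' by (auto simp: gen_mono[OF assms(1)] supp_mono)
qed

text \<open>Reordering generators only changes signs or gives zero, so the algebra is graded by the
  whole vector of exponents; degree and both lengths then add up in
  \<open>supp_multE\<close>.\<close>

lemma supp_mult:
  assumes "e \<in> supp (x * y)"
  shows "\<exists>e1\<in>supp x. \<exists>e2\<in>supp y. \<forall>l<2 * n. ex e l = ex e1 l + ex e2 l"
proof -
  have *: "\<exists>e2\<in>supp y. \<forall>l<2 * n. ex e l = ex e1 l + ex e2 l"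
    if "e1 \<in> expos G" "e \<in> supp (mono G e1 * y)" for e1 e
    using that
  proof (induction e1 arbitrary: e rule: mono_induct)
    case one
    then show ?case by (auto simp: ex_def)
  next
    case (gen l e1)
    then have "e \<in> supp (gen l * (mono G e1 * y))"
      by (simp add: mono_inc mult.assoc)
    then obtain e' where e': "e' \<in> supp (mono G e1 * y)" "e = inc l e'"
      using supp_gen_mult[OF gen(1)] by blast
    then obtain e2 where "e2 \<in> supp y" "\<forall>l<2 * n. ex e' l = ex e1 l + ex e2 l"
      using gen.IH[OF e'(1)] by blast
    moreover from this(2) have "\<forall>l'<2 * n. ex (inc l e') l' = ex (inc l e1) l' + ex e2 l'"
      using gen(1) by (simp add: ex_upd)
    ultimately show ?case
      unfolding e'(2) by blast
  qed
  have "lin (\<lambda>x. x * y)" by (intro lin_intros)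
  from supp_lin[OF this, of x] obtain e1 where "e1 \<in> supp x" "e \<in> supp (mono G e1 * y)"
    using assms by blast
  with *[of e1 e] show ?thesis
    using supp_expos by blast
qed

lemma supp_multE:
  assumes "e \<in> supp (x * y)"
  obtains e1 e2 where "e1 \<in> supp x" "e2 \<in> supp y" "mdeg G e = mdeg G e1 + mdeg G e2"
    "va e = va e1 + va e2" "vb e = vb e1 + vb e2"
proof -
  obtain e1 e2 where "e1 \<in> supp x" "e2 \<in> supp y" "\<forall>l<2 * n. ex e l = ex e1 l + ex e2 l"
    using supp_mult[OF assms] by blast
  then show thesis
    by (intro that[of e1 e2]) (auto simp: mdeg_eq va_eq vb_eq sum.distrib[symmetric] algebra_simps
        intro!: sum.cong)
qed

lemma ex_zero [simp]: "ex (\<lambda>_. 0, \<lambda>_. 0) l = 0"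
  by (simp add: ex_def)

lemma gen_eq_mono: "l < 2 * n \<Longrightarrow> gen l = mono G (upd l 1 (\<lambda>_. 0, \<lambda>_. 0))"
  using gen_mono[of l "(\<lambda>_. 0, \<lambda>_. 0)"] by (simp add: sgn_at_def)

lemma supp_gen: "l < 2 * n \<Longrightarrow> supp (gen l) = {upd l 1 (\<lambda>_. 0, \<lambda>_. 0)}"
  unfolding gen_eq_mono by (intro supp_mono expos_upd zero_expos) auto

lemma mdeg_zero [simp]: "mdeg G (\<lambda>_. 0, \<lambda>_. 0) = 0"
  by (simp add: mdeg_eq)

lemma gen_Deg: "l < 2 * n \<Longrightarrow> gen l \<in> Deg G (gd l)"
  by (simp add: Deg_iff supp_gen mdeg_upd)

lemma supp_one [simp]: "supp 1 = {(\<lambda>_. 0, \<lambda>_. 0)}"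
  using supp_mono[OF zero_expos] by simp

section \<open>Partial derivatives\<close>

text \<open>The left partial derivative: the sign brings one copy of the generator to the front
  before it is deleted, and the exponent counts the copies. At exponent 0 the truncated
  \<open>dec\<close> does no harm, since the coefficient is 0.\<close>

definition partial_d :: "nat \<Rightarrow> 'b \<Rightarrow> 'b" where
  "partial_d l = lext (\<lambda>e. of_nat (ex e l) *s ksign (sgn_at l (ex e)) (mono G (dec l e)))"

lemma partial_d_lin: "lin (partial_d l)"
  by (simp add: partial_d_def lext_lin)

lemma partial_d_mono: "e \<in> expos G \<Longrightarrow>
  partial_d l (mono G e) = of_nat (ex e l) *s ksign (sgn_at l (ex e)) (mono G (dec l e))"
  by (simp add: partial_d_def lext_mono)

lemma sgn_at_upd: "sgn_at l (ex (upd l' c e)) =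
  sgn_at l (ex e) + (if l' < l then gd l * ((int c - int (ex e l')) * gd l') else 0)"
proof (cases "l' < l")
  case True
  have "(\<Sum>i<l. int (ex (upd l' c e) i) * gd i) =
      int c * gd l' + (\<Sum>i\<in>{..<l} - {l'}. int (ex e i) * gd i)"
    using True by (subst sum.remove[of _ l']) (auto simp: ex_upd)
  moreover have "(\<Sum>i<l. int (ex e i) * gd i) =
      int (ex e l') * gd l' + (\<Sum>i\<in>{..<l} - {l'}. int (ex e i) * gd i)"
    using True by (subst sum.remove[of _ l']) auto
  ultimately show ?thesis
    using True by (simp add: sgn_at_def algebra_simps)
next
  case False
  then have "(\<Sum>i<l. int (ex (upd l' c e) i) * gd i) = (\<Sum>i<l. int (ex e i) * gd i)"
    by (intro sum.cong) (auto simp: ex_upd)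
  with False show ?thesis by (simp add: sgn_at_def)
qed

text \<open>The canonical relation of a Weyl or Clifford algebra: the graded commutator of a
  derivative and a multiplication by a generator is the Kronecker delta.\<close>

lemma partial_d_gen_mono:
  assumes "l < 2 * n" "l' < 2 * n" "e \<in> expos G"
  shows "partial_d l (gen l' * mono G e) =
    ksign (gd l * gd l') (gen l' * partial_d l (mono G e)) + (if l = l' then mono G e else 0)"
\<comment> \<open>If an odd \<open>gen l'\<close> already occurs, the left side is zero. For
  \<open>l = l'\<close> the two terms on the right must cancel, and they do because
  \<open>gd l\<close> is odd.\<close>
proof (cases "odd (gd l') \<and> ex e l' \<ge> 1")
  case True
  then have zero: "gen l' * mono G e = 0"
    using gen_mono_zero assms by simp
  show ?thesis
  proof (cases "l = l'")
    case l: True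
    have "ex e l = 1"
      using True expos_ex_le[OF assms(3,1)] l by simp
    moreover from this have "gen l * mono G (dec l e) = ksign (sgn_at l (ex e)) (mono G e)"
      using upd_ex[of l e] by (subst gen_mono[OF assms(1)]) (simp add: ex_upd sgn_at_upd)
    moreover have "ksign (gd l * gd l + (sgn_at l (ex e) + sgn_at l (ex e))) (mono G e) = - mono G e"
      using True l by (simp add: ksign_def)
    ultimately show ?thesis
      using l zero by (simp add: partial_d_mono[OF assms(3)] lin_zero[OF partial_d_lin] add.assoc)
  next
    case False
    then have "gen l' * mono G (dec l e) = 0"
      using True by (intro gen_mono_zero assms) (auto simp: ex_upd)
    with False zero show ?thesis
      by (simp add: partial_d_mono[OF assms(3)] lin_zero[OF partial_d_lin])
  qed
next
  case False
  then have inc: "inc l' e \<in> expos G"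
    by (intro expos_upd assms) auto
  have L: "partial_d l (gen l' * mono G e) = of_nat (ex (inc l' e) l) *s
      ksign (sgn_at l' (ex e) + sgn_at l (ex (inc l' e))) (mono G (dec l (inc l' e)))"
    by (simp add: gen_mono[OF assms(2)] lin_ksign[OF partial_d_lin] partial_d_mono[OF inc])
  have R: "gen l' * partial_d l (mono G e) = of_nat (ex e l) *s
      ksign (sgn_at l (ex e) + sgn_at l' (ex (dec l e))) (mono G (inc l' (dec l e)))"
    by (simp add: gen_mono[OF assms(2)] partial_d_mono[OF assms(3)])
  show ?thesis
  proof (cases "l = l'")
    case l: True
    show ?thesis
    proof (cases "ex e l = 0")
      case True
      with l show ?thesis
        unfolding L R using upd_ex[of l e] by (simp add: ex_upd sgn_at_upd ksign_def)
    next
      \<comment> \<open>An exponent that is positive and may still be raised belongs to an even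
        generator, so all signs are trivial and the coefficients simply add.\<close>
      case e: False
      then have ev: "even (gd l)" using False l by auto
      then have "even (sgn_at l c)" for c by (simp add: sgn_at_def)
      then show ?thesis
        unfolding L R using l e ev
        by (simp add: ex_upd ksign_def V.scale_left_distrib add.commute)
    qed
  next
    case l: False
    show ?thesis
    proof (cases "ex e l = 0")
      case True
      with l show ?thesis unfolding L R by (simp add: ex_upd)
    next
      case e: False
      have "mono G (dec l (inc l' e)) = mono G (inc l' (dec l e))"
        using l by (simp add: ex_upd upd_commute[of l l'])
      then show ?thesis
        unfolding L R using l e
        by (auto simp: ex_upd sgn_at_upd of_nat_diff algebra_simps intro!: ksign_cong)
    qed
  qed
qed

lemma partial_d_gen:
  assumes "l < 2 * n" "l' < 2 * n"
  shows "partial_d l (gen l' * x) = ksign (gd l * gd l') (gen l' * partial_d l x) + (if l = l' then x else 0)"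
proof -
  have "lin (\<lambda>x. partial_d l (gen l' * x))"
    "lin (\<lambda>x. ksign (gd l * gd l') (gen l' * partial_d l x) + (if l = l' then x else 0))"
    by (cases "l = l'"; auto intro!: lin_intros lin_compose[OF partial_d_lin] partial_d_lin)+
  then show ?thesis
    by (rule lin_eqI) (rule partial_d_gen_mono[OF assms])
qed

lemma supp_partial_d:
  assumes "e' \<in> supp (partial_d l x)"
  shows "\<exists>e\<in>supp x. ex e l > 0 \<and> e' = dec l e"
proof (cases "l < 2 * n")
  case True
  obtain e where e: "e \<in> supp x" "e' \<in> supp (partial_d l (mono G e))"
    using supp_lin[OF partial_d_lin, of l x] assms by blast
  then have "ex e l > 0"
    by (cases "ex e l") (auto simp: partial_d_mono supp_expos)
  with e show ?thesis
    using supp_scale[of "of_nat (ex e l)" "ksign (sgn_at l (ex e)) (mono G (dec l e))"]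
      supp_mono[OF expos_dec[OF supp_expos[OF e(1)] True]]
    by (auto simp: partial_d_mono supp_expos)
next
  case False
  then have "ex e l = 0" if "e \<in> expos G" for e
    using that by (auto simp: expos_iff ex_def)
  then show ?thesis
    using supp_lin[OF partial_d_lin, of l x] assms by (auto simp: partial_d_mono supp_expos)
qed

section \<open>Derivations and the Koszul differential\<close>

text \<open>The Leibniz rule is imposed only for left multiplication by generators. This determines
  the map on all monomials, needs no statement about degrees, and passes to differences of
  derivations.\<close>

definition gder :: "('b \<Rightarrow> 'b) \<Rightarrow> bool" where
  "gder \<rho> \<longleftrightarrow> lin \<rho> \<and> \<rho> 1 = 0 \<and>
     (\<forall>l<2 * n. \<forall>x. \<rho> (gen l * x) = \<rho> (gen l) * x + ksign (gd l) (gen l * \<rho> x))"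

lemma gder_lin: "gder \<rho> \<Longrightarrow> lin \<rho>"
  and gder_one: "gder \<rho> \<Longrightarrow> \<rho> 1 = 0"
  and gder_gen: "gder \<rho> \<Longrightarrow> l < 2 * n \<Longrightarrow>
    \<rho> (gen l * x) = \<rho> (gen l) * x + ksign (gd l) (gen l * \<rho> x)"
  by (simp_all add: gder_def)

lemma gder_diff: "gder \<rho> \<Longrightarrow> gder \<sigma> \<Longrightarrow> gder (\<lambda>x. \<rho> x - \<sigma> x)"
  unfolding gder_def by (auto intro!: lin_intros simp: algebra_simps)

lemma derivation_gder:
  assumes "derivation_on G UNIV \<rho>"
  shows "gder \<rho>"
proof -
  have leib: "\<rho> (x * y) = \<rho> x * y + ksign m (x * \<rho> y)" if "x \<in> Deg G m" for x y m
    using assms that by (simp add: derivation_on_def)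
  have "1 \<in> Deg G 0" by (simp add: Deg_iff)
  from leib[OF this, of 1] have "\<rho> 1 = 0" by simp
  then show ?thesis
    using assms leib gen_Deg by (auto simp: gder_def lin_iff derivation_on_def)
qed

text \<open>A derivation replaces one generator of a word by its image, so the changes of the pair
  of lengths that occur on generators are the only ones that occur at all.\<close>

lemma gder_shift:
  assumes \<rho>: "gder \<rho>"
    and Sh: "\<And>l e. l < 2 * n \<Longrightarrow> e \<in> supp (\<rho> (gen l)) \<Longrightarrow>
      (va e - (if l < n then 1 else 0), vb e - (if l < n then 0 else 1)) \<in> Sh"
    and e': "e' \<in> supp (\<rho> x)"
  shows "\<exists>e\<in>supp x. (va e' - va e, vb e' - vb e) \<in> Sh"
proof -
  have *: "(va e' - va e, vb e' - vb e) \<in> Sh" if "e \<in> expos G" "e' \<in> supp (\<rho> (mono G e))" for e e'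
    using that
  proof (induction e arbitrary: e' rule: mono_induct)
    case one
    then show ?case by (simp add: gder_one[OF \<rho>])
  next
    case (gen l e)
    have "\<rho> (mono G (inc l e)) =
        ksign (sgn_at l (ex e)) (\<rho> (gen l) * mono G e + ksign (gd l) (gen l * \<rho> (mono G e)))"
      by (simp add: mono_inc gen(1) lin_ksign[OF gder_lin[OF \<rho>]] gder_gen[OF \<rho>])
    then have "e' \<in> supp (\<rho> (gen l) * mono G e + ksign (gd l) (gen l * \<rho> (mono G e)))"
      using gen.prems by (simp only: supp_ksign)
    then consider "e' \<in> supp (\<rho> (gen l) * mono G e)" | "e' \<in> supp (gen l * \<rho> (mono G e))"
      using supp_add by fastforce
    then show ?case
    proof cases
      case 1
      then obtain e1 where e1: "e1 \<in> supp (\<rho> (gen l))" "va e' = va e1 + va e" "vb e' = vb e1 + vb e"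
        by (rule supp_multE) (auto simp: supp_mono gen)
      then show ?thesis
        using Sh[OF gen(1) e1(1)] gen(1) by (auto simp: va_upd vb_upd split: if_splits)
    next
      case 2
      then obtain e2 where "e2 \<in> supp (\<rho> (mono G e))" "e' = inc l e2"
        using supp_gen_mult[OF gen(1)] by blast
      then show ?thesis
        using gen.IH[of e2] gen(1) by (simp add: va_upd vb_upd)
    qed
  qed
  obtain e where "e \<in> supp x" "e' \<in> supp (\<rho> (mono G e))"
    using supp_lin[OF gder_lin[OF \<rho>], of x] e' by blast
  with * show ?thesis using supp_expos by blast
qed

text \<open>The derivation with \<open>sv_j \<mapsto> v_j\<close> and
  \<open>v_j \<mapsto> 0\<close>. The form with partial derivatives lets
  \<open>partial_d_gen\<close> compute how it interacts with the contraction.\<close>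

definition koszul :: "'b \<Rightarrow> 'b" where
  "koszul x = (\<Sum>j<n. gv G j * partial_d (n + j) x)"

lemma partial_d_one [simp]: "partial_d l 1 = 0"
  using partial_d_mono[OF zero_expos, of l] by simp

lemma koszul_gen: "l < 2 * n \<Longrightarrow> koszul (gen l) = (if l < n then 0 else gv G (l - n))"
proof -
  assume l: "l < 2 * n"
  have "koszul (gen l) = (\<Sum>j<n. if j + n = l then gv G j else 0)"
    unfolding koszul_def
  proof (rule sum.cong)
    fix j assume "j \<in> {..<n}"
    then show "gv G j * partial_d (n + j) (gen l) = (if j + n = l then gv G j else 0)"
      using partial_d_gen[of "n + j" l 1] l by (auto simp: add.commute)
  qed simp
  also have "\<dots> = (\<Sum>j<n. if j = l - n \<and> n \<le> l then gv G j else 0)"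
    by (intro sum.cong) auto
  also have "\<dots> = (if l < n then 0 else gv G (l - n))"
    using l by (cases "n \<le> l") auto
  finally show ?thesis .
qed

lemma koszul_lin: "lin koszul"
  unfolding koszul_def[abs_def] by (intro lin_intros lin_setsum lin_mult_left partial_d_lin)

lemma koszul_gder: "gder koszul"
  unfolding gder_def
proof (intro conjI allI impI)
  show "lin koszul" by (rule koszul_lin)
  show "koszul 1 = 0" by (simp add: koszul_def)
  fix l x assume l: "l < 2 * n"
  have "gv G j * partial_d (n + j) (gen l * x) =
      gv G j * partial_d (n + j) (gen l) * x + ksign (gd l) (gen l * (gv G j * partial_d (n + j) x))"
    if j: "j < n" for j
  proof -
    \<comment> \<open>Moving \<open>v_j\<close> and the derivative along \<open>sv_j\<close> past
      \<open>gen l\<close> costs \<open>gd j * gd l\<close> and \<open>(gd j - 1) * gd l\<close>.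
      Together they have the parity of \<open>gd l\<close>, as an odd derivation requires.\<close>
    have c: "gv G j * gen l = ksign (gd j * gd l) (gen l * gv G j)"
      using gen_commute[of j l] j l by simp
    have "gv G j * (gen l * y) = ksign (gd j * gd l) (gen l * (gv G j * y))" for y
      using arg_cong[OF c, of "\<lambda>u. u * y"] by (simp add: mult.assoc)
    then have "gv G j * ksign (gd (n + j) * gd l) (gen l * partial_d (n + j) x) =
        ksign (gd l) (gen l * (gv G j * partial_d (n + j) x))"
      using j by (auto intro!: ksign_cong)
    moreover have "partial_d (n + j) (gen l) = (if n + j = l then 1 else 0)"
      using partial_d_gen[of "n + j" l 1] l j by auto
    ultimately show ?thesis
      using partial_d_gen[of "n + j" l x] l j by (simp add: algebra_simps)
  qed
  then show "koszul (gen l * x) = koszul (gen l) * x + ksign (gd l) (gen l * koszul x)"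
    by (simp add: koszul_def sum_distrib_left sum_distrib_right sum.distrib ksign_sum)
qed

lemma partial_d_LV: "\<forall>e\<in>supp x. vb e = 0 \<Longrightarrow> j < n \<Longrightarrow> partial_d (n + j) x = 0"
proof -
  assume x: "\<forall>e\<in>supp x. vb e = 0" and j: "j < n"
  have "supp (partial_d (n + j) x) = {}"
  proof (rule equals0I)
    fix e' assume "e' \<in> supp (partial_d (n + j) x)"
    then obtain e where e: "e \<in> supp x" "ex e (n + j) > 0"
      using supp_partial_d by blast
    then show False
      using x expos_vb_zero[OF supp_expos[OF e(1)]] by auto
  qed
  then show ?thesis by (simp add: supp_empty_iff)
qed

lemma koszul_LV: "x \<in> LV G \<Longrightarrow> koszul x = 0"
  by (simp add: koszul_def LV_iff partial_d_LV)

section \<open>The Hom complex\<close>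

abbreviation smono where "smono b \<equiv> mono G (\<lambda>_. 0, b)"
abbreviation sexpos where "sexpos b \<equiv> (\<lambda>_. 0, b) \<in> expos G"

lemma LV_add: "x \<in> LV G \<Longrightarrow> y \<in> LV G \<Longrightarrow> x + y \<in> LV G"
  and LV_diff: "x \<in> LV G \<Longrightarrow> y \<in> LV G \<Longrightarrow> x - y \<in> LV G"
  and LV_scale: "x \<in> LV G \<Longrightarrow> c *s x \<in> LV G"
  and LV_ksign: "x \<in> LV G \<Longrightarrow> ksign m x \<in> LV G"
  and LV_zero: "0 \<in> LV G"
  and Deg_add: "x \<in> Deg G j \<Longrightarrow> y \<in> Deg G j \<Longrightarrow> x + y \<in> Deg G j"
  and Deg_diff: "x \<in> Deg G j \<Longrightarrow> y \<in> Deg G j \<Longrightarrow> x - y \<in> Deg G j"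
  and Deg_scale: "x \<in> Deg G j \<Longrightarrow> c *s x \<in> Deg G j"
  and Deg_ksign: "x \<in> Deg G j \<Longrightarrow> ksign m x \<in> Deg G j"
  and Deg_zero: "0 \<in> Deg G j"
  using supp_add supp_diff supp_scale by (fastforce simp: LV_iff Deg_iff)+

lemma LV_mult: "x \<in> LV G \<Longrightarrow> y \<in> LV G \<Longrightarrow> x * y \<in> LV G"
  and Deg_mult: "x \<in> Deg G i \<Longrightarrow> y \<in> Deg G j \<Longrightarrow> x * y \<in> Deg G (i + j)"
  and LsV_mult: "x \<in> LsV G \<Longrightarrow> y \<in> LsV G \<Longrightarrow> x * y \<in> LsV G"
  unfolding LV_iff Deg_iff LsV_iff by (intro ballI, erule supp_multE, simp)+

lemma LV_sum: "(\<And>i. i \<in> I \<Longrightarrow> f i \<in> LV G) \<Longrightarrow> sum f I \<in> LV G"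
  and Deg_sum: "(\<And>i. i \<in> I \<Longrightarrow> f i \<in> Deg G j) \<Longrightarrow> sum f I \<in> Deg G j"
  by (induction I rule: infinite_finite_induct) (auto simp: LV_zero LV_add Deg_zero Deg_add)

lemma mono_Deg: "e \<in> expos G \<Longrightarrow> mono G e \<in> Deg G (mdeg G e)"
  by (simp add: Deg_iff supp_mono)

lemma mono_LV: "(a, \<lambda>_. 0) \<in> expos G \<Longrightarrow> mono G (a, \<lambda>_. 0) \<in> LV G"
  and smono_LsV: "sexpos b \<Longrightarrow> smono b \<in> LsV G"
  by (simp_all add: LV_iff LsV_iff supp_mono)

lemma gv_LV: "i < n \<Longrightarrow> gv G i \<in> LV G"
  and gs_LsV: "i < n \<Longrightarrow> gs G i \<in> LsV G"
  and gv_Deg: "i < n \<Longrightarrow> gv G i \<in> Deg G (int (dg G i))"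
  and gs_Deg: "i < n \<Longrightarrow> gs G i \<in> Deg G (int (dg G i) - 1)"
  using supp_gen[of i] supp_gen[of "n + i"] gen_Deg[of i] gen_Deg[of "n + i"]
  by (auto simp: LV_iff LsV_iff vb_upd va_upd)

lemma mdeg_split: "mdeg G (a, b) = mdeg G (a, \<lambda>_. 0) + mdeg G (\<lambda>_. 0, b)"
  by (simp add: mdeg_def sum.distrib)

lemma HomA_iff: "g \<in> HomA G m \<longleftrightarrow> lin g \<and>
    (\<forall>j. \<forall>x\<in>Deg G j. g x \<in> LV G \<inter> Deg G (j + m)) \<and>
    (\<forall>j. \<forall>x\<in>LV G \<inter> Deg G j. \<forall>y. g (x * y) = ksign (m * j) (x * g y))"
  unfolding HomA_def by blast

lemma Hom_lin: "g \<in> HomA G m \<Longrightarrow> lin g"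
  and Hom_deg: "g \<in> HomA G m \<Longrightarrow> x \<in> Deg G j \<Longrightarrow> g x \<in> Deg G (j + m)"
  and Hom_mult: "g \<in> HomA G m \<Longrightarrow> x \<in> LV G \<Longrightarrow> x \<in> Deg G j \<Longrightarrow>
    g (x * y) = ksign (m * j) (x * g y)"
  by (auto simp: HomA_iff)

text \<open>\<open>HomA\<close> constrains values only on homogeneous elements; the monomials are
  homogeneous and span.\<close>

lemma Hom_LV: "g \<in> HomA G m \<Longrightarrow> g x \<in> LV G"
proof -
  assume g: "g \<in> HomA G m"
  have "\<forall>e\<in>supp x. True" by simp
  then show ?thesis
  proof (induction rule: supp_induct)
    case (mono e)
    then show ?case using g mono_Deg[OF mono(1)] unfolding HomA_iff by blast
  qed (auto simp: lin_zero lin_add lin_scale Hom_lin[OF g] LV_zero LV_add LV_scale)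
qed

lemma Hom_gv: "g \<in> HomA G m \<Longrightarrow> i < n \<Longrightarrow>
    g (gv G i * y) = ksign (m * int (dg G i)) (gv G i * g y)"
  by (rule Hom_mult) (auto simp: gv_LV gv_Deg)

lemma Hom_mono:
  assumes "g \<in> HomA G m" "(a, b) \<in> expos G"
  shows "g (mono G (a, b)) = ksign (m * mdeg G (a, \<lambda>_. 0)) (mono G (a, \<lambda>_. 0) * g (smono b))"
  unfolding mono_mult[symmetric, of a b] using expos_fst[OF assms(2)]
  by (intro Hom_mult[OF assms(1)] mono_LV mono_Deg) auto

lemma Hom_add: "g \<in> HomA G m \<Longrightarrow> h \<in> HomA G m \<Longrightarrow> g + h \<in> HomA G m"
  and Hom_diff: "g \<in> HomA G m \<Longrightarrow> h \<in> HomA G m \<Longrightarrow> g - h \<in> HomA G m"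
  and Hom_zero: "0 \<in> HomA G m"
  and Hom_scale: "g \<in> HomA G m \<Longrightarrow> (\<lambda>x. c *s g x) \<in> HomA G m"
  unfolding HomA_iff plus_fun_def fun_diff_def zero_fun_def
  by (auto intro!: lin_intros LV_add LV_diff LV_scale LV_zero Deg_add Deg_diff Deg_scale Deg_zero
      simp: algebra_simps)

lemma Hom_eqI:
  assumes "g \<in> HomA G m" "h \<in> HomA G m" "\<And>b. sexpos b \<Longrightarrow> g (smono b) = h (smono b)"
  shows "g = h"
proof
  fix x
  show "g x = h x"
  proof (rule lin_eqI[OF Hom_lin[OF assms(1)] Hom_lin[OF assms(2)]])
    fix e assume "e \<in> expos G"
    then show "g (mono G e) = h (mono G e)"
      using Hom_mono[OF assms(1), of "fst e" "snd e"] Hom_mono[OF assms(2), of "fst e" "snd e"]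
        assms(3)[OF expos_snd] by simp
  qed
qed

text \<open>The inverse of restriction to \<Lambda>sV. The sign is the one that \<open>HomA\<close>
  prescribes for taking a coefficient from \<Lambda>V out of a map of degree m.\<close>

definition ext :: "int \<Rightarrow> ((nat \<Rightarrow> nat) \<Rightarrow> 'b) \<Rightarrow> 'b \<Rightarrow> 'b" where
  "ext m \<phi> = lext (\<lambda>e. ksign (m * mdeg G (fst e, \<lambda>_. 0)) (mono G (fst e, \<lambda>_. 0) * \<phi> (snd e)))"

lemma ext_lin: "lin (ext m \<phi>)"
  by (simp add: ext_def lext_lin)

lemma ext_smono: "sexpos b \<Longrightarrow> ext m \<phi> (smono b) = \<phi> b"
  by (simp add: ext_def lext_mono)

lemma ext_mult_smono:
  assumes x: "x \<in> LV G" "x \<in> Deg G j" and b: "sexpos b"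
  shows "ext m \<phi> (x * smono b) = ksign (m * j) (x * \<phi> b)"
proof -
  have *: "\<forall>e\<in>supp x. vb e = 0 \<and> mdeg G e = j"
    using x by (auto simp: LV_iff Deg_iff)
  show ?thesis
  proof (rule lin_eq_on[OF _ _ *, where f = "\<lambda>x. ext m \<phi> (x * smono b)" and
        g = "\<lambda>x. ksign (m * j) (x * \<phi> b)"])
    show "lin (\<lambda>x. ext m \<phi> (x * smono b))"
      by (rule lin_compose[OF ext_lin]) (intro lin_intros)
    show "lin (\<lambda>x. ksign (m * j) (x * \<phi> b))"
      by (intro lin_intros)
    fix e assume e: "e \<in> expos G" "vb e = 0 \<and> mdeg G e = j"
    then have e0: "e = (fst e, \<lambda>_. 0)"
      by (simp add: prod_eq_iff expos_vb_zero)
    then have "mono G e * smono b = mono G (fst e, b)" "(fst e, b) \<in> expos G"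
      using mono_mult[of "fst e" b] expos_pair[of "fst e" b] e(1) b by metis+
    then show "ext m \<phi> (mono G e * smono b) = ksign (m * j) (mono G e * \<phi> b)"
      using e(2) e0 by (simp add: ext_def lext_mono)
  qed
qed

lemma ext_Hom:
  assumes \<phi>: "\<And>b. sexpos b \<Longrightarrow> \<phi> b \<in> LV G \<and> \<phi> b \<in> Deg G (mdeg G (\<lambda>_. 0, b) + m)"
  shows "ext m \<phi> \<in> HomA G m"
  unfolding HomA_iff
proof (intro conjI allI ballI IntI)
  show "lin (ext m \<phi>)" by (rule ext_lin)
  fix j x
  assume "x \<in> Deg G j"
  then have *: "\<forall>e\<in>supp x. mdeg G e = j" by (simp add: Deg_iff)
  have "ext m \<phi> x \<in> LV G \<and> ext m \<phi> x \<in> Deg G (j + m)"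
    using *
  proof (induction rule: supp_induct)
    case (mono e)
    have "mdeg G e = mdeg G (fst e, \<lambda>_. 0) + mdeg G (\<lambda>_. 0, snd e)"
      using mdeg_split[of "fst e" "snd e"] by simp
    then have "mono G (fst e, \<lambda>_. 0) * \<phi> (snd e) \<in> Deg G (j + m)"
      using Deg_mult[OF mono_Deg[OF expos_fst[OF mono(1)]], of "\<phi> (snd e)"]
        \<phi>[OF expos_snd[OF mono(1)]] mono(2) by (simp add: add.assoc)
    then show ?case
      using \<phi>[OF expos_snd[OF mono(1)]] mono_LV[OF expos_fst[OF mono(1)]] mono(1)
      by (auto simp: ext_def lext_mono intro!: LV_ksign LV_mult Deg_ksign)
  qed (auto simp: lin_zero lin_add lin_scale ext_lin LV_zero LV_add LV_scale
      Deg_zero Deg_add Deg_scale)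
  then show "ext m \<phi> x \<in> LV G" "ext m \<phi> x \<in> Deg G (j + m)" by auto
next
  fix j x y
  assume x: "x \<in> LV G \<inter> Deg G j"
  show "ext m \<phi> (x * y) = ksign (m * j) (x * ext m \<phi> y)"
  proof (rule lin_eqI[where f = "\<lambda>y. ext m \<phi> (x * y)" and g = "\<lambda>y. ksign (m * j) (x * ext m \<phi> y)"])
    show "lin (\<lambda>y. ext m \<phi> (x * y))"
      by (rule lin_compose[OF ext_lin]) (intro lin_intros)
    show "lin (\<lambda>y. ksign (m * j) (x * ext m \<phi> y))"
      by (intro lin_signed lin_mult_left ext_lin)
    fix e assume e: "e \<in> expos G"
    let ?a = "mono G (fst e, \<lambda>_. 0)" and ?i = "mdeg G (fst e, \<lambda>_. 0)"
    have a: "?a \<in> LV G" "?a \<in> Deg G ?i"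
      using expos_fst[OF e] by (auto intro: mono_LV mono_Deg)
    have "x * mono G e = (x * ?a) * smono (snd e)" and e_split: "mono G e = ?a * smono (snd e)"
      using mono_mult[of "fst e" "snd e"] by (simp_all add: mult.assoc)
    then have "ext m \<phi> (x * mono G e) = ksign (m * (j + ?i)) (x * ?a * \<phi> (snd e))"
      using ext_mult_smono[of "x * ?a" "j + ?i" "snd e" m \<phi>] x a expos_snd[OF e]
      by (simp add: LV_mult Deg_mult)
    moreover have "ext m \<phi> (mono G e) = ksign (m * ?i) (?a * \<phi> (snd e))"
      using ext_mult_smono[OF a expos_snd[OF e]] e_split by simp
    ultimately show "ext m \<phi> (x * mono G e) = ksign (m * j) (x * ext m \<phi> (mono G e))"
      by (simp add: mult.assoc algebra_simps)
  qed
qed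

lemma ext_LsV:
  assumes "lin E" "\<And>b. sexpos b \<Longrightarrow> \<phi> b = E (smono b)" "z \<in> LsV G"
  shows "ext m \<phi> z = E z"
proof (rule lin_eq_on[OF ext_lin assms(1)])
  show "\<forall>e\<in>supp z. va e = 0" using assms(3) by (simp add: LsV_iff)
  fix e assume e: "e \<in> expos G" "va e = 0"
  then have "e = (\<lambda>_. 0, snd e)" by (simp add: prod_eq_iff expos_va_zero)
  then show "ext m \<phi> (mono G e) = E (mono G e)"
    using ext_smono[of "snd e" m \<phi>] assms(2)[of "snd e"] e(1) by metis
qed

section \<open>The contracting homotopy\<close>

text \<open>On \<Lambda>sV this is \<open>homD koszul m g\<close>: its first summand drops out
  because \<open>koszul\<close> kills \<Lambda>V.\<close>

definition koszul_dual :: "int \<Rightarrow> ('b \<Rightarrow> 'b) \<Rightarrow> 'b \<Rightarrow> 'b" where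
  "koszul_dual m g = ext (m + 1) (\<lambda>b. ksign (m + 1) (g (koszul (smono b))))"

text \<open>The sign is chosen so that the double sums in the anticommutator with
  \<open>koszul_dual\<close> cancel.\<close>

definition contraction_at :: "int \<Rightarrow> ('b \<Rightarrow> 'b) \<Rightarrow> 'b \<Rightarrow> 'b" where
  "contraction_at m g z =
    (\<Sum>i<n. ksign (m * (int (dg G i) - 1) + int (dg G i)) (partial_d i (g (gs G i * z))))"

text \<open>\<open>contraction_at m g\<close> is not \<Lambda>V-linear in general, as the partial
  derivative also acts on coefficients. Only its values on \<Lambda>sV are kept and extended
  linearly.\<close>

definition contraction :: "int \<Rightarrow> ('b \<Rightarrow> 'b) \<Rightarrow> 'b \<Rightarrow> 'b" where
  "contraction m g = ext (m - 1) (\<lambda>b. contraction_at m g (smono b))"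

lemma partial_d_Hom_LV: "x \<in> LV G \<Longrightarrow> i < n \<Longrightarrow> partial_d i x \<in> LV G"
proof -
  assume x: "x \<in> LV G" and i: "i < n"
  show ?thesis
    unfolding LV_iff
  proof
    fix e' assume "e' \<in> supp (partial_d i x)"
    then obtain e where "e \<in> supp x" "e' = dec i e" using supp_partial_d by blast
    then show "vb e' = 0" using x i by (simp add: LV_iff vb_upd)
  qed
qed

lemma partial_d_Deg: "x \<in> Deg G j \<Longrightarrow> l < 2 * n \<Longrightarrow> partial_d l x \<in> Deg G (j - gd l)"
proof -
  assume x: "x \<in> Deg G j" and l: "l < 2 * n"
  show ?thesis
    unfolding Deg_iff
  proof
    fix e' assume "e' \<in> supp (partial_d l x)"
    then obtain e where "e \<in> supp x" "ex e l > 0" "e' = dec l e" using supp_partial_d by blast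
    then show "mdeg G e' = j - gd l"
      using x l by (simp add: Deg_iff mdeg_upd of_nat_diff algebra_simps)
  qed
qed

lemma partial_d_LsV: "z \<in> LsV G \<Longrightarrow> j < n \<Longrightarrow> partial_d (n + j) z \<in> LsV G"
proof -
  assume z: "z \<in> LsV G" and j: "j < n"
  show ?thesis
    unfolding LsV_iff
  proof
    fix e' assume "e' \<in> supp (partial_d (n + j) z)"
    then obtain e where "e \<in> supp z" "e' = dec (n + j) e" using supp_partial_d by blast
    then show "va e' = 0" using z j by (simp add: LsV_iff va_upd)
  qed
qed

lemma koszul_Deg: "x \<in> Deg G j \<Longrightarrow> koszul x \<in> Deg G (j + 1)"
  unfolding koszul_def
proof (rule Deg_sum)
  fix i assume x: "x \<in> Deg G j" and "i \<in> {..<n}"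
  then have i: "i < n" by simp
  show "gv G i * partial_d (n + i) x \<in> Deg G (j + 1)"
    using Deg_mult[OF gv_Deg[OF i] partial_d_Deg[OF x, of "n + i"]] i by simp
qed

lemma koszul_dual_Hom: "g \<in> HomA G m \<Longrightarrow> koszul_dual m g \<in> HomA G (m + 1)"
  unfolding koszul_dual_def
proof (rule ext_Hom)
  fix b assume g: "g \<in> HomA G m" and b: "sexpos b"
  have "g (koszul (smono b)) \<in> Deg G (mdeg G (\<lambda>_. 0, b) + 1 + m)"
    by (rule Hom_deg[OF g koszul_Deg[OF mono_Deg[OF b]]])
  then show "ksign (m + 1) (g (koszul (smono b))) \<in> LV G \<and>
      ksign (m + 1) (g (koszul (smono b))) \<in> Deg G (mdeg G (\<lambda>_. 0, b) + (m + 1))"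
    using Hom_LV[OF g] by (auto intro!: LV_ksign Deg_ksign simp: algebra_simps)
qed

lemma koszul_dual_LsV: "g \<in> HomA G m \<Longrightarrow> z \<in> LsV G \<Longrightarrow> koszul_dual m g z = ksign (m + 1) (g (koszul z))"
  unfolding koszul_dual_def
  by (rule ext_LsV) (intro lin_signed lin_compose[of g koszul] koszul_lin Hom_lin | simp)+

lemma contraction_at_lin: "g \<in> HomA G m \<Longrightarrow> lin (contraction_at m g)"
  unfolding contraction_at_def[abs_def]
proof (rule lin_setsum, rule lin_signed)
  fix i assume "g \<in> HomA G m"
  then have "lin (\<lambda>z. g (gs G i * z))"
    by (rule lin_compose[OF Hom_lin lin_mult_left[OF lin_id]])
  then show "lin (\<lambda>z. partial_d i (g (gs G i * z)))"
    by (rule lin_compose[OF partial_d_lin])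
qed

lemma contraction_at_LV: "g \<in> HomA G m \<Longrightarrow> contraction_at m g z \<in> LV G"
  unfolding contraction_at_def by (intro LV_sum LV_ksign partial_d_Hom_LV Hom_LV) auto

lemma contraction_at_Deg: "g \<in> HomA G m \<Longrightarrow> z \<in> Deg G j \<Longrightarrow> contraction_at m g z \<in> Deg G (j + (m - 1))"
  unfolding contraction_at_def
proof (intro Deg_sum Deg_ksign)
  fix i assume g: "g \<in> HomA G m" and z: "z \<in> Deg G j" and "i \<in> {..<n}"
  then have i: "i < n" by simp
  have "partial_d i (g (gs G i * z)) \<in> Deg G (int (dg G i) - 1 + j + m - gd i)"
    using partial_d_Deg[OF Hom_deg[OF g Deg_mult[OF gs_Deg[OF i] z]], of i] i by simp
  moreover have "int (dg G i) - 1 + j + m - gd i = j + (m - 1)"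
    using i by simp
  ultimately show "partial_d i (g (gs G i * z)) \<in> Deg G (j + (m - 1))"
    by (simp only:)
qed

lemma contraction_Hom: "g \<in> HomA G m \<Longrightarrow> contraction m g \<in> HomA G (m - 1)"
  unfolding contraction_def by (rule ext_Hom) (simp add: contraction_at_LV contraction_at_Deg mono_Deg)

lemma contraction_LsV: "g \<in> HomA G m \<Longrightarrow> z \<in> LsV G \<Longrightarrow> contraction m g z = contraction_at m g z"
  unfolding contraction_def by (rule ext_LsV) (auto intro: contraction_at_lin)

text \<open>Both composites contain the double sum of the terms \<open>X i j\<close>, with opposite
  signs. What survives comes from the two places where the operators meet: \<open>koszul\<close>
  turns the inserted \<open>sv_i\<close> into \<open>v_i\<close>, and the derivative along
  \<open>v_i\<close> hits the factor \<open>v_j\<close> with \<open>j = i\<close>.\<close>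

lemma koszul_dual_contraction_plus_contraction_koszul_dual:
  assumes g: "g \<in> HomA G m" and z: "z \<in> LsV G"
  shows "koszul_dual (m - 1) (contraction m g) z + contraction (m + 1) (koszul_dual m g) z =
    (\<Sum>i<n. partial_d i (gv G i * g z) - ksign (int (dg G i)) (g (gs G i * partial_d (n + i) z)))"
proof -
  define X where "X i j = gv G j * partial_d i (g (gs G i * partial_d (n + j) z))" for i j
  define Y where "Y i = g (gs G i * partial_d (n + i) z)" for i
  define D where "D i = int (dg G i)" for i
  note lin_g = Hom_lin[OF g]
  have contraction_lin: "lin (contraction m g)" using contraction_Hom[OF g] by (rule Hom_lin)
  have "koszul_dual (m - 1) (contraction m g) z = ksign m (contraction m g (koszul z))"
    using koszul_dual_LsV[OF contraction_Hom[OF g] z] by simp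
  also have "contraction m g (koszul z) = (\<Sum>j<n. contraction m g (gv G j * partial_d (n + j) z))"
    by (simp add: koszul_def lin_sum[OF contraction_lin])
  also have "\<dots> = (\<Sum>j<n. ksign ((m - 1) * D j) (gv G j * contraction_at m g (partial_d (n + j) z)))"
    using z by (intro sum.cong) (auto simp: Hom_gv[OF contraction_Hom[OF g]] contraction_LsV[OF g] partial_d_LsV D_def)
  also have "\<dots> = (\<Sum>j<n. \<Sum>i<n. ksign ((m - 1) * D j + (m * (D i - 1) + D i)) (X i j))"
    by (simp add: contraction_at_def D_def X_def sum_distrib_left ksign_sum)
  also have "\<dots> = (\<Sum>i<n. \<Sum>j<n. ksign ((m - 1) * D j + (m * (D i - 1) + D i)) (X i j))"
    by (rule sum.swap)
  finally have A: "koszul_dual (m - 1) (contraction m g) z =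
      (\<Sum>i<n. \<Sum>j<n. ksign (m + ((m - 1) * D j + (m * (D i - 1) + D i))) (X i j))"
    by (simp add: ksign_sum)
  have B: "ksign ((m + 1) * (D i - 1) + D i) (partial_d i (koszul_dual m g (gs G i * z))) =
      partial_d i (gv G i * g z) - ksign (D i) (Y i) -
      (\<Sum>j<n. ksign (m + ((m - 1) * D j + (m * (D i - 1) + D i))) (X i j))"
    (is "?L = _") if i: "i < n" for i
  proof -
    have "koszul (gs G i * z) = gv G i * z + ksign (D i - 1) (gs G i * koszul z)"
      using gder_gen[OF koszul_gder, of "n + i" z] koszul_gen[of "n + i"] i by (simp add: D_def)
    then have "koszul_dual m g (gs G i * z) =
        ksign (m + 1) (g (gv G i * z) + ksign (D i - 1) (g (gs G i * koszul z)))"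
      using koszul_dual_LsV[OF g LsV_mult[OF gs_LsV[OF i] z]]
      by (simp add: lin_add[OF lin_g] lin_ksign[OF lin_g])
    moreover have "g (gv G i * z) = ksign (m * D i) (gv G i * g z)"
      by (simp add: Hom_gv[OF g i] D_def)
    moreover have "g (gs G i * koszul z) =
        (\<Sum>j<n. ksign ((D i - 1) * D j + m * D j) (gv G j * g (gs G i * partial_d (n + j) z)))"
    proof -
      have "gs G i * (gv G j * y) = ksign ((D i - 1) * D j) (gv G j * (gs G i * y))"
        if "j < n" for j y
        using arg_cong[OF gen_commute[of "n + i" j], of "\<lambda>u. u * y"] that i
        by (simp add: D_def mult.assoc)
      then show ?thesis
        by (simp add: koszul_def sum_distrib_left lin_sum[OF lin_g] lin_ksign[OF lin_g] Hom_gv[OF g]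
            D_def)
    qed
    ultimately have 1: "partial_d i (koszul_dual m g (gs G i * z)) =
        ksign (m + 1 + m * D i) (partial_d i (gv G i * g z)) +
        (\<Sum>j<n. ksign (m + 1 + (D i - 1 + ((D i - 1) * D j + m * D j)))
          (partial_d i (gv G j * g (gs G i * partial_d (n + j) z))))"
      by (simp add: lin_add[OF partial_d_lin] lin_ksign[OF partial_d_lin] lin_sum[OF partial_d_lin] ksign_sum add.assoc)
    have 2: "partial_d i (gv G j * g (gs G i * partial_d (n + j) z)) =
        ksign (D i * D j) (X i j) + (if j = i then Y i else 0)" if "j < n" for j
      using partial_d_gen[of i j] that i by (auto simp: X_def Y_def D_def)
    \<comment> \<open>The three sign checks: the term with \<open>v_i * g z\<close> keeps its sign,
      the diagonal term acquires the sign of \<open>- ksign (D i)\<close>, and each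
      \<open>X i j\<close> gets the opposite of its sign in \<open>A\<close>.\<close>
    have par: "even ((m + 1) * (D i - 1) + D i + (m + 1 + m * D i))"
      by (cases "even m"; cases "even (D i)") simp_all
    have parY: "even ((m + 1) * (D i - 1) + D i + (m + 1 + (D i - 1 + ((D i - 1) * D i + m * D i))))
        \<longleftrightarrow> odd (D i)"
      by (cases "even m"; cases "even (D i)") simp_all
    have parX: "even ((m + 1) * (D i - 1) + D i +
        (m + 1 + (D i - 1 + ((D i - 1) * D j + m * D j)) + D i * D j)) \<longleftrightarrow>
        odd (m + ((m - 1) * D j + (m * (D i - 1) + D i)))" for j
      by (cases "even m"; cases "even (D i)"; cases "even (D j)") simp_all
    have "?L = ksign ((m + 1) * (D i - 1) + D i + (m + 1 + m * D i)) (partial_d i (gv G i * g z)) +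
        (\<Sum>j<n. ksign ((m + 1) * (D i - 1) + D i + (m + 1 + (D i - 1 + ((D i - 1) * D j + m * D j))))
          (partial_d i (gv G j * g (gs G i * partial_d (n + j) z))))"
      unfolding 1 by (simp only: ksign_add ksign_sum ksign_ksign)
    also have "(\<Sum>j<n. ksign ((m + 1) * (D i - 1) + D i + (m + 1 + (D i - 1 + ((D i - 1) * D j + m * D j))))
          (partial_d i (gv G j * g (gs G i * partial_d (n + j) z)))) =
        (\<Sum>j<n. ksign ((m + 1) * (D i - 1) + D i +
          (m + 1 + (D i - 1 + ((D i - 1) * D j + m * D j)) + D i * D j)) (X i j) +
          (if j = i then ksign ((m + 1) * (D i - 1) + D i +
          (m + 1 + (D i - 1 + ((D i - 1) * D i + m * D i)))) (Y i) else 0))"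
      by (rule sum.cong) (simp_all only: 2 lessThan_iff ksign_add ksign_ksign add.assoc
          if_distrib[of "ksign _"] ksign_zero cong: if_cong)
    also have "\<dots> =
        (\<Sum>j<n. - ksign (m + ((m - 1) * D j + (m * (D i - 1) + D i))) (X i j) +
          (if j = i then - ksign (D i) (Y i) else 0))"
      by (intro sum.cong arg_cong2[where f = "(+)"] ksign_neg_cong parX if_cong refl)
        (use parY in blast)
    also have "\<dots> =
        - ksign (D i) (Y i) - (\<Sum>j<n. ksign (m + ((m - 1) * D j + (m * (D i - 1) + D i))) (X i j))"
      using i by (simp add: sum.distrib sum_negf sum_subtractf)
    also have "ksign ((m + 1) * (D i - 1) + D i + (m + 1 + m * D i)) (partial_d i (gv G i * g z)) =
        partial_d i (gv G i * g z)"
      using par by (simp add: ksign_def)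
    finally have "?L = partial_d i (gv G i * g z) + (- ksign (D i) (Y i) -
        (\<Sum>j<n. ksign (m + ((m - 1) * D j + (m * (D i - 1) + D i))) (X i j)))" .
    then show ?thesis by (simp only: add_diff_eq diff_conv_add_uminus add.assoc)
  qed
  have "contraction (m + 1) (koszul_dual m g) z =
      (\<Sum>i<n. ksign ((m + 1) * (D i - 1) + D i) (partial_d i (koszul_dual m g (gs G i * z))))"
    using contraction_LsV[OF koszul_dual_Hom[OF g] z] by (simp add: contraction_at_def D_def)
  then show ?thesis
    using A B by (simp add: sum_subtractf Y_def D_def)
qed

text \<open>The Euler operator of one generator; its eigenvalues are the exponents and will add up
  to the weight.\<close>

lemma gen_partial_d_mono:
  assumes "l < 2 * n" "e \<in> expos G"
  shows "gen l * partial_d l (mono G e) = of_nat (ex e l) *s mono G e"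
proof (cases "ex e l = 0")
  case False
  then have "gen l * mono G (dec l e) = ksign (sgn_at l (ex e)) (mono G e)"
    using upd_ex[of l e] by (subst gen_mono[OF assms(1)]) (simp add: ex_upd sgn_at_upd)
  then show ?thesis
    by (simp add: partial_d_mono[OF assms(2)] ksign_def)
qed (simp add: partial_d_mono[OF assms(2)])

section \<open>The weight of a coordinate and division by it\<close>

text \<open>The anticommutator of \<open>koszul_dual\<close> and \<open>contraction\<close> multiplies the coordinate of \<open>g\<close> at
  (output \<open>a\<close>, input \<open>b\<close>) by \<open>weight a b\<close>.\<close>

definition weight :: "(nat \<Rightarrow> nat) \<Rightarrow> (nat \<Rightarrow> nat) \<Rightarrow> int" where
  "weight a b = (\<Sum>i<n. 1 + (if even (dg G i) then 1 else - 1) * (int (a i) - int (b i)))"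

definition top_a :: "nat \<Rightarrow> nat" where
  "top_a i = (if i < n \<and> odd (dg G i) then 1 else 0)"

definition top_b :: "nat \<Rightarrow> nat" where
  "top_b i = (if i < n \<and> even (dg G i) then 1 else 0)"

lemma top_expos: "(top_a, \<lambda>_. 0) \<in> expos G" "sexpos top_b"
  by (auto simp: expos_def top_a_def top_b_def)

text \<open>No summand is negative: for even \<open>dg i\<close> it is \<open>a_i + 1 - b_i\<close>
  with \<open>b_i \<le> 1\<close>, for odd \<open>dg i\<close> it is \<open>1 - a_i + b_i\<close>
  with \<open>a_i \<le> 1\<close>. So the sum vanishes only if \<open>(a_i, b_i)\<close> is (0, 1)
  at every even and (1, 0) at every odd generator.\<close>

lemma weight_eq_0_iff:
  assumes "(a, \<lambda>_. 0) \<in> expos G" "sexpos b"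
  shows "weight a b = 0 \<longleftrightarrow> a = top_a \<and> b = top_b"
proof -
  let ?w = "\<lambda>i. 1 + (if even (dg G i) then 1 else - 1) * (int (a i) - int (b i))"
  have odd: "a i \<le> 1" if "i < n" "odd (dg G i)" for i
    using assms(1) that by (simp add: expos_def)
  have even: "b i \<le> 1" if "i < n" "even (dg G i)" for i
    using assms(2) that by (simp add: expos_def)
  have out: "a i = 0 \<and> b i = 0" if "\<not> i < n" for i
    using assms that by (simp add: expos_def)
  have nonneg: "0 \<le> ?w i" if "i < n" for i
    using odd[OF that] even[OF that] by auto
  have zero: "?w i = 0 \<longleftrightarrow> a i = top_a i \<and> b i = top_b i" if "i < n" for i
    using odd[OF that] even[OF that] that by (auto simp: top_a_def top_b_def)
  have "weight a b = 0 \<longleftrightarrow> (\<forall>i<n. ?w i = 0)"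
    unfolding weight_def using nonneg by (subst sum_nonneg_eq_0_iff) auto
  also have "\<dots> \<longleftrightarrow> (\<forall>i<n. a i = top_a i \<and> b i = top_b i)"
    using zero by blast
  also have "\<dots> \<longleftrightarrow> a = top_a \<and> b = top_b"
    using out by (auto simp: fun_eq_iff top_a_def top_b_def)
  finally show ?thesis .
qed

text \<open>The weight sees only the difference of output and input exponents, and
  \<open>koszul_dual\<close> trades a factor \<open>sv_j\<close> of the input for a factor
  \<open>v_j\<close> of the output. Hence division by the weight commutes with it, as
  \<open>gv_scal\<close> and \<open>koszul_dual_homot\<close> make precise.\<close>

lemma weight_shift:
  assumes "j < n" "b j > 0"
  shows "weight (a(j := Suc (a j))) b = weight a (b(j := b j - 1))"
  unfolding weight_def using assms by (intro sum.cong) (auto simp: of_nat_diff)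

definition diag :: "((nat \<Rightarrow> nat) \<Rightarrow> 'k) \<Rightarrow> 'b \<Rightarrow> 'b" where
  "diag c = lext (\<lambda>e. c (fst e) *s mono G e)"

lemma diag_lin: "lin (diag c)"
  and diag_mono: "e \<in> expos G \<Longrightarrow> diag c (mono G e) = c (fst e) *s mono G e"
  by (simp_all add: diag_def lext_lin lext_mono)

lemma supp_diag: "supp (diag c x) \<subseteq> supp x"
proof
  fix e' assume "e' \<in> supp (diag c x)"
  then obtain e where e: "e \<in> supp x" "e' \<in> supp (diag c (mono G e))"
    using supp_lin[OF diag_lin, of c x] by blast
  then show "e' \<in> supp x"
    using supp_scale[of "c (fst e)" "mono G e"] by (auto simp: diag_mono supp_expos supp_mono)
qed

lemma diag_LV: "x \<in> LV G \<Longrightarrow> diag c x \<in> LV G"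
  and diag_Deg: "x \<in> Deg G j \<Longrightarrow> diag c x \<in> Deg G j"
  using supp_diag[of c x] by (auto simp: LV_iff Deg_iff)

text \<open>Because \<open>inverse 0 = 0\<close>, this annihilates the coordinate of weight zero
  instead of dividing by zero; that coordinate is the correction term in
  \<open>scal_weight\<close>.\<close>

abbreviation scal where "scal b \<equiv> diag (\<lambda>a. inverse (of_int (weight a b)))"

text \<open>Multiplication by \<open>v_i\<close> followed by its derivative acts as
  \<open>1 + a_i\<close> for even and \<open>1 - a_i\<close> for odd degree. The other term is
  \<open>b_i\<close> with the opposite sign, so the index i contributes the i-th summand of
  \<open>weight\<close>.\<close>

lemma anticommutator:
  assumes g: "g \<in> HomA G m" and b: "sexpos b"
  shows "koszul_dual (m - 1) (contraction m g) (smono b) + contraction (m + 1) (koszul_dual m g) (smono b) =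
    diag (\<lambda>a. of_int (weight a b)) (g (smono b))"
proof -
  have *: "\<forall>e\<in>supp (g (smono b)). True" by simp
  have "g (gs G i * partial_d (n + i) (smono b)) = of_nat (b i) *s g (smono b)" if "i < n" for i
    using gen_partial_d_mono[of "n + i" "(\<lambda>_. 0, b)"] b that by (simp add: lin_scale[OF Hom_lin[OF g]])
  then have "koszul_dual (m - 1) (contraction m g) (smono b) + contraction (m + 1) (koszul_dual m g) (smono b) =
      (\<Sum>i<n. partial_d i (gv G i * g (smono b)) - ksign (int (dg G i)) (of_nat (b i) *s g (smono b)))"
    unfolding koszul_dual_contraction_plus_contraction_koszul_dual[OF g smono_LsV[OF b]] by simp
  also have "\<dots> = diag (\<lambda>a. of_int (weight a b)) (g (smono b))"
  proof (rule lin_eq_on[OF _ diag_lin *])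
    have "lin (\<lambda>x. partial_d i (gv G i * x))" for i
      by (rule lin_compose[OF partial_d_lin lin_mult_left[OF lin_id]])
    then show "lin (\<lambda>x. \<Sum>i<n. partial_d i (gv G i * x) - ksign (int (dg G i)) (of_nat (b i) *s x))"
      by (intro lin_setsum lin_minus lin_signed lin_scaled lin_id)
    fix e assume e: "e \<in> expos G"
    have "partial_d i (gv G i * mono G e) - ksign (int (dg G i)) (of_nat (b i) *s mono G e) =
        of_int (1 + (if even (dg G i) then 1 else - 1) * (int (fst e i) - int (b i))) *s mono G e"
      if i: "i < n" for i
    proof -
      have "partial_d i (gv G i * mono G e) =
          ksign (int (dg G i) * int (dg G i)) (of_nat (fst e i) *s mono G e) + mono G e"
        using partial_d_gen[of i i "mono G e"] gen_partial_d_mono[of i e] i e by simp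
      then show ?thesis
        by (simp add: ksign_def V.scale_left_distrib V.scale_left_diff_distrib)
    qed
    then show "(\<Sum>i<n. partial_d i (gv G i * mono G e) - ksign (int (dg G i)) (of_nat (b i) *s mono G e)) =
        diag (\<lambda>a. of_int (weight a b)) (mono G e)"
      by (simp add: diag_mono[OF e] weight_def of_int_sum V.scale_sum_left del: of_int_add of_int_mult)
  qed
  finally show ?thesis .
qed

lemma scal_weight:
  assumes x: "x \<in> LV G" and b: "sexpos b"
  shows "scal b (diag (\<lambda>a. of_int (weight a b)) x) =
    x - (if b = top_b then coef (top_a, \<lambda>_. 0) x *s mono G (top_a, \<lambda>_. 0) else 0)"
proof -
  have *: "\<forall>e\<in>supp x. vb e = 0" using x by (simp add: LV_iff)
  have "lin (\<lambda>x. coef (top_a, \<lambda>_. 0) x *s mono G (top_a, \<lambda>_. 0))"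
    by (rule linI) (simp_all add: V.scale_left_distrib)
  then have L: "lin (\<lambda>x. if b = top_b then coef (top_a, \<lambda>_. 0) x *s mono G (top_a, \<lambda>_. 0) else 0)"
    by (cases "b = top_b") (simp_all add: lin_const_zero)
  show ?thesis
  proof (rule lin_eq_on[where f = "\<lambda>x. scal b (diag (\<lambda>a. of_int (weight a b)) x)",
        OF lin_compose[OF diag_lin diag_lin] lin_minus[OF lin_id L] *])
    fix e assume e: "e \<in> expos G" "vb e = 0"
    then have e0: "e = (fst e, \<lambda>_. 0)" by (simp add: prod_eq_iff expos_vb_zero)
    have "(of_int (weight (fst e) b) :: 'k) = 0 \<longleftrightarrow> e = (top_a, \<lambda>_. 0) \<and> b = top_b"
      using weight_eq_0_iff[of "fst e" b] e0 e(1) b by (metis of_int_eq_0_iff fst_conv)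
    then show "scal b (diag (\<lambda>a. of_int (weight a b)) (mono G e)) = mono G e -
        (if b = top_b then coef (top_a, \<lambda>_. 0) (mono G e) *s mono G (top_a, \<lambda>_. 0) else 0)"
      using e(1) by (auto simp: diag_mono lin_scale[OF diag_lin] coef_mono)
  qed
qed

lemma gv_scal:
  assumes "j < n" "b j > 0"
  shows "gv G j * scal (b(j := b j - 1)) x = scal b (gv G j * x)"
proof (rule lin_eqI[where f = "\<lambda>x. gv G j * scal (b(j := b j - 1)) x"])
  show "lin (\<lambda>x. gv G j * scal (b(j := b j - 1)) x)"
    by (rule lin_mult_left[OF diag_lin])
  show "lin (\<lambda>x. scal b (gv G j * x))"
    by (rule lin_compose[OF diag_lin lin_mult_left[OF lin_id]])
  fix e assume e: "e \<in> expos G"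
  show "gv G j * scal (b(j := b j - 1)) (mono G e) = scal b (gv G j * mono G e)"
  proof (cases "odd (gd j) \<and> ex e j \<ge> 1")
    case True
    then have "gv G j * mono G e = 0"
      using gen_mono_zero[of j e] assms(1) by simp
    then show ?thesis by (simp add: diag_mono[OF e] lin_zero[OF diag_lin])
  next
    case False
    then have inc: "inc j e \<in> expos G"
      using assms(1) e by (intro expos_upd) auto
    have "gv G j * mono G e = ksign (sgn_at j (ex e)) (mono G (inc j e))"
      using gen_mono[of j e] assms(1) by simp
    moreover have "fst (inc j e) = (fst e)(j := Suc (fst e j))"
      using assms(1) by (simp add: upd_def)
    ultimately show ?thesis
      using weight_shift[of j b "fst e"] assms
      by (simp only: diag_mono[OF e] diag_mono[OF inc] lin_ksign[OF diag_lin] ksign_scale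
          scale_mult_right)
  qed
qed

section \<open>The homotopy and the exceptional coordinate\<close>

definition homot :: "int \<Rightarrow> ('b \<Rightarrow> 'b) \<Rightarrow> 'b \<Rightarrow> 'b" where
  "homot m g = ext (m - 1) (\<lambda>b. scal b (contraction_at m g (smono b)))"

lemma homot_Hom: "g \<in> HomA G m \<Longrightarrow> homot m g \<in> HomA G (m - 1)"
  unfolding homot_def by (rule ext_Hom) (simp add: diag_LV diag_Deg contraction_at_LV contraction_at_Deg mono_Deg)

lemma homot_smono: "g \<in> HomA G m \<Longrightarrow> sexpos b \<Longrightarrow> homot m g (smono b) = scal b (contraction m g (smono b))"
  by (simp add: homot_def ext_smono contraction_LsV smono_LsV)

text \<open>At the input \<open>b\<close>, \<open>koszul_dual\<close> uses values at inputs with one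
  \<open>sv_j\<close> removed, each multiplied by \<open>v_j\<close>; by \<open>gv_scal\<close> all
  of them are divided by the same weights.\<close>

lemma koszul_dual_homot:
  assumes g: "g \<in> HomA G m" and b: "sexpos b"
  shows "koszul_dual (m - 1) (homot m g) (smono b) = scal b (koszul_dual (m - 1) (contraction m g) (smono b))"
proof -
  have koszul_dual: "koszul_dual (m - 1) k (smono b) =
      ksign m (\<Sum>j<n. ksign ((m - 1) * int (dg G j)) (gv G j * k (partial_d (n + j) (smono b))))"
    if k: "k \<in> HomA G (m - 1)" for k
    using koszul_dual_LsV[OF k smono_LsV[OF b]]
    by (auto simp: koszul_def lin_sum[OF Hom_lin[OF k]] Hom_gv[OF k]
        intro!: sum.cong arg_cong[where f = "ksign m"])
  have "gv G j * homot m g (partial_d (n + j) (smono b)) = scal b (gv G j * contraction m g (partial_d (n + j) (smono b)))"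
    if j: "j < n" for j
  proof (cases "b j = 0")
    case True
    then have "partial_d (n + j) (smono b) = 0" by (simp add: partial_d_mono[OF b])
    then show ?thesis
      by (simp add: lin_zero[OF Hom_lin[OF homot_Hom[OF g]]] lin_zero[OF Hom_lin[OF contraction_Hom[OF g]]]
          lin_zero[OF diag_lin])
  next
    case False
    let ?b = "b(j := b j - 1)"
    have b': "sexpos ?b"
      using expos_dec[OF b, of "n + j"] j by (simp add: upd_def)
    have partial_d: "partial_d (n + j) (smono b) =
        of_nat (b j) *s ksign (sgn_at (n + j) (ex (\<lambda>_. 0, b))) (smono ?b)"
      by (simp add: partial_d_mono[OF b]) (simp add: upd_def)
    have "homot m g (partial_d (n + j) (smono b)) = scal ?b (contraction m g (partial_d (n + j) (smono b)))"
      unfolding partial_d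
      by (simp only: homot_smono[OF g b'] lin_scale[OF Hom_lin[OF homot_Hom[OF g]]]
          lin_ksign[OF Hom_lin[OF homot_Hom[OF g]]] lin_scale[OF Hom_lin[OF contraction_Hom[OF g]]]
          lin_ksign[OF Hom_lin[OF contraction_Hom[OF g]]] lin_scale[OF diag_lin] lin_ksign[OF diag_lin])
    then show ?thesis
      using gv_scal[OF j, of b] False by simp
  qed
  then show ?thesis
    unfolding koszul_dual[OF homot_Hom[OF g]] koszul_dual[OF contraction_Hom[OF g]]
    by (simp add: lin_ksign[OF diag_lin] lin_sum[OF diag_lin])
qed

text \<open>The classical formal dimension: the sum of the odd degrees minus the sum of
  \<open>dg i - 1\<close> over the even ones.\<close>

definition top_deg :: int where
  "top_deg = mdeg G (top_a, \<lambda>_. 0) - mdeg G (\<lambda>_. 0, top_b)"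

definition top_gen :: "'b \<Rightarrow> 'b" where
  "top_gen = ext top_deg (\<lambda>b. if b = top_b then mono G (top_a, \<lambda>_. 0) else 0)"

definition top_coef :: "('b \<Rightarrow> 'b) \<Rightarrow> 'k" where
  "top_coef g = coef (top_a, \<lambda>_. 0) (g (smono top_b))"

lemma top_gen_Hom: "top_gen \<in> HomA G top_deg"
  unfolding top_gen_def
  using mono_Deg[OF top_expos(1)] mono_LV[OF top_expos(1)]
  by (intro ext_Hom) (auto simp: top_deg_def LV_zero Deg_zero)

lemma top_gen_smono: "sexpos b \<Longrightarrow>
    top_gen (smono b) = (if b = top_b then mono G (top_a, \<lambda>_. 0) else 0)"
  by (simp add: top_gen_def ext_smono)

lemma top_coef_deg: "g \<in> HomA G m \<Longrightarrow> top_coef g \<noteq> 0 \<Longrightarrow> m = top_deg"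
  using Hom_deg[OF _ mono_Deg[OF top_expos(2)], of g m]
  by (auto simp: top_coef_def top_deg_def Deg_iff supp_def)

lemma top_coef_gen: "top_coef top_gen = 1"
  by (simp add: top_coef_def top_gen_smono top_expos coef_mono)

lemma top_coef_diff: "top_coef (g - h) = top_coef g - top_coef h"
  and top_coef_scale: "top_coef (\<lambda>x. c *s g x) = c * top_coef g"
  by (simp_all add: top_coef_def)

text \<open>A nonzero coefficient forces \<open>m = top_deg\<close>; otherwise the map is zero,
  which has every degree.\<close>

lemma top_part_Hom: "g \<in> HomA G m \<Longrightarrow> (\<lambda>x. top_coef g *s top_gen x) \<in> HomA G m"
  using top_coef_deg[of g m] Hom_scale[OF top_gen_Hom] Hom_zero[of m]
  by (cases "top_coef g = 0") (auto simp: zero_fun_def)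

lemma homotopy:
  assumes g: "g \<in> HomA G m"
  shows "koszul_dual (m - 1) (homot m g) + homot (m + 1) (koszul_dual m g) = g - (\<lambda>x. top_coef g *s top_gen x)"
proof (rule Hom_eqI)
  show "koszul_dual (m - 1) (homot m g) + homot (m + 1) (koszul_dual m g) \<in> HomA G m"
    using koszul_dual_Hom[OF homot_Hom[OF g]] homot_Hom[OF koszul_dual_Hom[OF g]] by (simp add: Hom_add)
  show "g - (\<lambda>x. top_coef g *s top_gen x) \<in> HomA G m"
    by (intro Hom_diff top_part_Hom g)
  fix b assume b: "sexpos b"
  have "(koszul_dual (m - 1) (homot m g) + homot (m + 1) (koszul_dual m g)) (smono b) =
      scal b (koszul_dual (m - 1) (contraction m g) (smono b) + contraction (m + 1) (koszul_dual m g) (smono b))"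
    by (simp add: koszul_dual_homot[OF g b] homot_smono[OF koszul_dual_Hom[OF g] b] lin_add[OF diag_lin])
  also have "\<dots> = g (smono b) -
      (if b = top_b then coef (top_a, \<lambda>_. 0) (g (smono b)) *s mono G (top_a, \<lambda>_. 0) else 0)"
    unfolding anticommutator[OF g b] by (rule scal_weight[OF Hom_LV[OF g] b])
  finally show "(koszul_dual (m - 1) (homot m g) + homot (m + 1) (koszul_dual m g)) (smono b) =
      (g - (\<lambda>x. top_coef g *s top_gen x)) (smono b)"
    by (simp add: top_gen_smono[OF b] top_coef_def)
qed

lemma koszul_dual_top_gen: "koszul_dual top_deg top_gen = 0"
proof (rule Hom_eqI[OF koszul_dual_Hom[OF top_gen_Hom] Hom_zero])
  fix b assume b: "sexpos b"
  have "gv G j * top_gen (partial_d (n + j) (smono b)) = 0" if j: "j < n" for j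
  proof (cases "b j > 0 \<and> b(j := b j - 1) = top_b")
    \<comment> \<open>Deleting one \<open>sv_j\<close> from \<open>b\<close> gives
      \<open>top_b\<close>. For even \<open>v_j\<close> this would need exponent 2, so
      \<open>v_j\<close> is odd; it then already divides the top monomial and multiplication by it
      gives zero.\<close>
    case True
    then have "b j - 1 = top_b j"
      using fun_upd_same[of b j "b j - 1"] by simp
    moreover have "even (dg G j) \<Longrightarrow> b j \<le> 1"
      using b j by (simp add: expos_def)
    ultimately have "odd (dg G j)"
      using j by (auto simp: top_b_def)
    then have "gv G j * mono G (top_a, \<lambda>_. 0) = 0"
      using gen_mono_zero[of j "(top_a, \<lambda>_. 0)"] j by (simp add: top_a_def)
    moreover have "partial_d (n + j) (smono b) =
        of_nat (b j) *s ksign (sgn_at (n + j) (ex (\<lambda>_. 0, b))) (smono top_b)"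
      using True by (simp add: partial_d_mono[OF b]) (simp add: upd_def)
    ultimately show ?thesis
      by (simp add: lin_scale[OF Hom_lin[OF top_gen_Hom]] lin_ksign[OF Hom_lin[OF top_gen_Hom]]
          top_gen_smono top_expos)
  next
    case False
    have "sexpos (b(j := b j - 1))"
      using expos_dec[OF b, of "n + j"] j by (simp add: upd_def)
    moreover have "partial_d (n + j) (smono b) =
        of_nat (b j) *s ksign (sgn_at (n + j) (ex (\<lambda>_. 0, b))) (smono (b(j := b j - 1)))"
      by (simp add: partial_d_mono[OF b]) (simp add: upd_def)
    ultimately show ?thesis
      using False by (auto simp: lin_scale[OF Hom_lin[OF top_gen_Hom]]
          lin_ksign[OF Hom_lin[OF top_gen_Hom]] top_gen_smono)
  qed
  then show "koszul_dual top_deg top_gen (smono b) = 0 (smono b)"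
    by (simp add: koszul_dual_LsV[OF top_gen_Hom smono_LsV[OF b]] koszul_def lin_sum[OF Hom_lin[OF top_gen_Hom]]
        Hom_gv[OF top_gen_Hom])
qed

text \<open>Each term carries a factor \<open>v_j\<close> and a derivative along
  \<open>sv_j\<close>. For even \<open>v_j\<close> the factor is absent from the top output, and for
  odd \<open>v_j\<close> the input has no \<open>sv_j\<close> to differentiate.\<close>

lemma top_coef_koszul_dual:
  assumes g: "g \<in> HomA G m"
  shows "top_coef (koszul_dual m g) = 0"
proof -
  have "coef (top_a, \<lambda>_. 0) (gv G j * g (partial_d (n + j) (smono top_b))) = 0" if j: "j < n" for j
  proof (cases "even (dg G j)")
    case True
    show ?thesis
    proof (rule ccontr)
      assume "\<not> ?thesis"
      then have "(top_a, \<lambda>_. 0) \<in> supp (gen j * g (partial_d (n + j) (smono top_b)))"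
        using j by (simp add: supp_def)
      then obtain e where "(top_a, \<lambda>_. 0) = inc j e"
        using supp_gen_mult[of j] j by (metis mult_2 trans_less_add1)
      then have "ex (top_a, \<lambda>_. 0) j = Suc (ex e j)"
        by (simp only: ex_upd refl if_True)
      then show False using True j by (simp add: top_a_def)
    qed
  next
    case False
    then have "partial_d (n + j) (smono top_b) = 0"
      by (simp add: partial_d_mono[OF top_expos(2)] top_b_def)
    then show ?thesis by (simp add: lin_zero[OF Hom_lin[OF g]])
  qed
  then have "(\<Sum>j<n. coef (top_a, \<lambda>_. 0)
      (ksign (m * int (dg G j)) (gv G j * g (partial_d (n + j) (smono top_b))))) = 0"
    by (intro sum.neutral) simp
  then show ?thesis
    by (simp add: top_coef_def koszul_dual_LsV[OF g smono_LsV[OF top_expos(2)]] koszul_def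
        lin_sum[OF Hom_lin[OF g]] Hom_gv[OF g] coef_sum)
qed

section \<open>Filtrations\<close>

text \<open>One family covers both filtrations in use: \<open>c = 1\<close> and
  \<open>\<epsilon> = 0\<close> give \<open>Fil\<close>, while \<open>c = len_wt\<close> and
  \<open>\<epsilon> = 1\<close> give the weight that governs convergence.\<close>

definition filt :: "int \<Rightarrow> int \<Rightarrow> int \<Rightarrow> int \<Rightarrow> ('b \<Rightarrow> 'b) set" where
  "filt c \<epsilon> w m = {g \<in> HomA G m.
     \<forall>b. sexpos b \<longrightarrow> (\<forall>e\<in>supp (g (smono b)). w \<le> c * va e - \<epsilon> * vlen G b)}"

lemma filt_Hom: "g \<in> filt c \<epsilon> w m \<Longrightarrow> g \<in> HomA G m"
  by (simp add: filt_def)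

lemma filt_I: "g \<in> HomA G m \<Longrightarrow>
    (\<And>b e. sexpos b \<Longrightarrow> e \<in> supp (g (smono b)) \<Longrightarrow> w \<le> c * va e - \<epsilon> * vlen G b) \<Longrightarrow> g \<in> filt c \<epsilon> w m"
  by (simp add: filt_def)

lemma filt_D: "g \<in> filt c \<epsilon> w m \<Longrightarrow> sexpos b \<Longrightarrow> e \<in> supp (g (smono b)) \<Longrightarrow> w \<le> c * va e - \<epsilon> * vlen G b"
  by (auto simp: filt_def)

lemma filt_mono: "g \<in> filt c \<epsilon> w m \<Longrightarrow> w' \<le> w \<Longrightarrow> g \<in> filt c \<epsilon> w' m"
  by (auto simp: filt_def) force

lemma filt_add: "g \<in> filt c \<epsilon> w m \<Longrightarrow> h \<in> filt c \<epsilon> w m \<Longrightarrow> g + h \<in> filt c \<epsilon> w m"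
  and filt_diff: "g \<in> filt c \<epsilon> w m \<Longrightarrow> h \<in> filt c \<epsilon> w m \<Longrightarrow> g - h \<in> filt c \<epsilon> w m"
  and filt_zero: "0 \<in> filt c \<epsilon> w m"
  and filt_scale: "g \<in> filt c \<epsilon> w m \<Longrightarrow> (\<lambda>x. a *s g x) \<in> filt c \<epsilon> w m"
  unfolding filt_def using supp_add supp_diff supp_scale
  by (fastforce intro: Hom_add Hom_diff Hom_zero Hom_scale)+

lemma filt_supp:
  assumes g: "g \<in> filt c \<epsilon> w m" and e: "e \<in> supp (g x)"
  shows "\<exists>e0\<in>supp x. w \<le> c * va e - c * va e0 - \<epsilon> * vb e0"
proof -
  obtain e0 where e0: "e0 \<in> supp x" "e \<in> supp (g (mono G e0))"
    using supp_lin[OF Hom_lin[OF filt_Hom[OF g]], of x] e by blast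
  note exp = supp_expos[OF e0(1)]
  have "e \<in> supp (mono G (fst e0, \<lambda>_. 0) * g (smono (snd e0)))"
    using e0(2) Hom_mono[OF filt_Hom[OF g], of "fst e0" "snd e0"] exp by simp
  then obtain e2 where "e2 \<in> supp (g (smono (snd e0)))" "va e = va e0 + va e2"
    by (rule supp_multE) (auto simp: supp_mono expos_fst[OF exp])
  then show ?thesis
    using filt_D[OF g expos_snd[OF exp], of e2] e0(1) by (intro bexI[of _ e0]) (auto simp: algebra_simps)
qed

lemma Fil_eq: "Fil G p m = filt 1 0 p m"
proof (intro set_eqI iffI)
  fix g assume g: "g \<in> Fil G p m"
  show "g \<in> filt 1 0 p m"
  proof (rule filt_I)
    show "g \<in> HomA G m" using g by (simp add: Fil_def)
    fix b e assume b: "sexpos b" "e \<in> supp (g (smono b))"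
    then have "g (smono b) \<in> LVge G p"
      using g smono_LsV[OF b(1)] by (auto simp: Fil_def)
    with b(2) show "p \<le> 1 * va e - 0 * vlen G b" by (simp add: LVge_iff)
  qed
next
  fix g assume g: "g \<in> filt 1 0 p m"
  have "g x \<in> LVge G p" if x: "x \<in> LsV G" for x
    unfolding LVge_iff
  proof
    fix e assume e: "e \<in> supp (g x)"
    then show "va e \<ge> p \<and> vb e = 0"
      using filt_supp[OF g e] x Hom_LV[OF filt_Hom[OF g], of x] by (auto simp: LsV_iff LV_iff)
  qed
  then show "g \<in> Fil G p m" using filt_Hom[OF g] by (auto simp: Fil_def)
qed

text \<open>The contraction deletes one \<open>v_i\<close> from the output, which costs c, and
  evaluates at an input one factor \<open>sv_i\<close> longer, which gains \<epsilon>. Division by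
  weights does not enlarge supports.\<close>

lemma filt_homot:
  assumes g: "g \<in> filt c \<epsilon> w m"
  shows "homot m g \<in> filt c \<epsilon> (w - c + \<epsilon>) (m - 1)"
proof (rule filt_I)
  show "homot m g \<in> HomA G (m - 1)" by (rule homot_Hom[OF filt_Hom[OF g]])
  fix b e' assume b: "sexpos b" and "e' \<in> supp (homot m g (smono b))"
  moreover have "supp (homot m g (smono b)) \<subseteq> supp (contraction_at m g (smono b))"
    by (simp add: homot_def ext_smono b supp_diag)
  moreover have "supp (contraction_at m g (smono b)) \<subseteq> (\<Union>i<n. supp (partial_d i (g (gs G i * smono b))))"
    unfolding contraction_at_def by (rule order_trans[OF supp_sum]) simp
  ultimately obtain i where i: "i < n" and "e' \<in> supp (partial_d i (g (gs G i * smono b)))"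
    by blast
  then obtain e where e: "e \<in> supp (g (gs G i * smono b))" "ex e i > 0" "e' = dec i e"
    using supp_partial_d by blast
  obtain e0 where e0: "e0 \<in> supp (gs G i * smono b)" "w \<le> c * va e - c * va e0 - \<epsilon> * vb e0"
    using filt_supp[OF g e(1)] by blast
  have "e0 = inc (n + i) (\<lambda>_. 0, b)"
    using supp_gen_mult[of "n + i" e0 "smono b"] e0(1) i b by (simp add: supp_mono)
  then have "va e0 = 0" "vb e0 = vlen G b + 1"
    using i by (simp_all add: va_upd vb_upd)
  moreover have "va e = va e' + 1"
    using e(2,3) i by (simp add: va_upd of_nat_diff)
  ultimately show "w - c + \<epsilon> \<le> c * va e' - \<epsilon> * vlen G b"
    using e0(2) by (simp only:) (simp add: algebra_simps)
qed

lemma filt_top_gen: "w \<le> c * vlen G top_a - \<epsilon> * vlen G top_b \<Longrightarrow> top_gen \<in> filt c \<epsilon> w top_deg"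
  by (rule filt_I[OF top_gen_Hom])
    (auto simp: top_gen_smono supp_mono top_expos split: if_splits)

lemma filt_top_coef:
  assumes "g \<in> filt c \<epsilon> w m" "top_coef g \<noteq> 0"
  shows "w \<le> c * vlen G top_a - \<epsilon> * vlen G top_b"
  using filt_D[OF assms(1) top_expos(2), of "(top_a, \<lambda>_. 0)"] assms(2)
  by (simp add: top_coef_def supp_def)

text \<open>The filtration with \<open>\<epsilon> = 1\<close> and \<open>c = len_wt\<close> is bounded below on each \<open>A\<^sup>m\<close>, and the homotopy operators
  strictly increase it.\<close>

definition len_wt :: int where
  "len_wt = 1 + (\<Sum>i<n. int (dg G i))"

lemma len_wt_pos: "0 < len_wt"
  by (simp add: len_wt_def sum_nonneg add_pos_nonneg)

lemma va_bounds:
  assumes "e \<in> expos G" "vb e = 0"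
  shows "mdeg G e \<le> len_wt * va e" "va e \<le> mdeg G e"
proof -
  have e: "mdeg G e = (\<Sum>i<n. int (fst e i) * int (dg G i))"
    using expos_vb_zero[OF assms] by (simp add: mdeg_def split_beta)
  have "int (dg G i) \<le> len_wt" if "i < n" for i
    using member_le_sum[of i "{..<n}" "\<lambda>i. int (dg G i)"] that by (simp add: len_wt_def)
  then have "mdeg G e \<le> (\<Sum>i<n. int (fst e i) * len_wt)"
    unfolding e by (intro sum_mono mult_left_mono) auto
  then show "mdeg G e \<le> len_wt * va e"
    by (simp add: vlen_def sum_distrib_right mult.commute sum_distrib_left)
  have "int (fst e i) * 1 \<le> int (fst e i) * int (dg G i)" if "i < n" for i
    using dg_ge_2[OF that] by (intro mult_left_mono) auto
  then show "va e \<le> mdeg G e"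
    unfolding e vlen_def by (intro sum_mono) auto
qed

lemma vlen_le_mdeg: "sexpos b \<Longrightarrow> vlen G b \<le> mdeg G (\<lambda>_. 0, b)"
proof -
  have "int (b i) * 1 \<le> int (b i) * (int (dg G i) - 1)" if "i < n" for i
    using dg_ge_2[OF that] by (intro mult_left_mono) auto
  then show ?thesis by (auto simp: vlen_def mdeg_def intro!: sum_mono)
qed

lemma Hom_supp:
  assumes "g \<in> HomA G m" "sexpos b" "e \<in> supp (g (smono b))"
  shows "vb e = 0" "mdeg G e = mdeg G (\<lambda>_. 0, b) + m"
  using Hom_LV[OF assms(1)] Hom_deg[OF assms(1) mono_Deg[OF assms(2)]] assms(3)
  by (auto simp: LV_iff Deg_iff)

text \<open>The number m is the degree of the output minus that of the input. The former is at most
  \<open>len_wt\<close> times the length of the output, the latter at least the length of the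
  input.\<close>

lemma Hom_filt: "g \<in> HomA G m \<Longrightarrow> g \<in> filt len_wt 1 m m"
proof (rule filt_I)
  fix b e assume g: "g \<in> HomA G m" and b: "sexpos b" "e \<in> supp (g (smono b))"
  show "m \<le> len_wt * va e - 1 * vlen G b"
    using va_bounds(1)[OF supp_expos[OF b(2)] Hom_supp(1)[OF g b]] Hom_supp(2)[OF g b]
      vlen_le_mdeg[OF b(1)] by simp
qed

lemma Hom_mono_eq_0: "g \<in> HomA G m \<Longrightarrow> (a, b) \<in> expos G \<Longrightarrow> g (smono b) = 0 \<Longrightarrow> g (mono G (a, b)) = 0"
  by (simp add: Hom_mono)

text \<open>At a fixed input the output has a fixed degree, hence bounded length; \<open>K\<close>
  bounds \<open>len_wt\<close> times that length. Once the filtration index exceeds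
  \<open>K\<close>, the value must be zero.\<close>

lemma filt_eventually_zero:
  assumes u: "\<And>i::nat. u i \<in> filt len_wt 1 (w + int i) m"
  shows "\<exists>M. \<forall>i\<ge>M. u i x = 0"
proof -
  have "\<forall>e\<in>supp x. True" by simp
  then show ?thesis
  proof (induction rule: supp_induct)
    case zero
    then show ?case by (simp add: lin_zero[OF Hom_lin[OF filt_Hom[OF u]]])
  next
    case (add x y)
    then obtain M M' where "\<forall>i\<ge>M. u i x = 0" "\<forall>i\<ge>M'. u i y = 0" by blast
    then show ?case
      by (intro exI[of _ "max M M'"]) (simp add: lin_add[OF Hom_lin[OF filt_Hom[OF u]]])
  next
    case (scale c x)
    then show ?case by (auto simp: lin_scale[OF Hom_lin[OF filt_Hom[OF u]]])
  next
    case (mono e)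
    let ?b = "snd e"
    note b = expos_snd[OF mono(1)]
    define K where "K = len_wt * (mdeg G (\<lambda>_. 0, ?b) + m)"
    have "u i (smono ?b) = 0" if i: "i \<ge> nat (K - w + 1)" for i
    proof (rule ccontr)
      assume "u i (smono ?b) \<noteq> 0"
      then obtain e' where e': "e' \<in> supp (u i (smono ?b))"
        using supp_empty_iff by blast
      note H = Hom_supp[OF filt_Hom[OF u] b e']
      have "w + int i \<le> len_wt * va e'"
        using filt_D[OF u b e'] vlen_nonneg[of ?b] by linarith
      also have "\<dots> \<le> K"
        unfolding K_def H(2)[symmetric] using va_bounds(2)[OF supp_expos[OF e'] H(1)] len_wt_pos
        by (intro mult_left_mono) auto
      finally show False using i by linarith
    qed
    then have "u i (mono G e) = 0" if "i \<ge> nat (K - w + 1)" for i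
      using Hom_mono_eq_0[OF filt_Hom[OF u], of "fst e" "snd e" i] mono(1) that by simp
    then show ?case by blast
  qed
qed

text \<open>Used for the pieces of D that come from a derivation lengthening words in V by at least
  r: with r = 1 for \<open>\<delta> - koszul\<close> and with r = 2 for the difference of the two
  differentials.\<close>

lemma filt_gder:
  assumes \<rho>: "gder \<rho>"
    and shift: "\<And>l e. l < 2 * n \<Longrightarrow> e \<in> supp (\<rho> (gen l)) \<Longrightarrow>
      r \<le> va e - (if l < n then 1 else 0) \<and> vb e = (if l < n then 0 else 1)"
    and g: "g \<in> filt c \<epsilon> w m" and c: "0 \<le> c" and b: "sexpos b"
    and e: "e \<in> supp (\<rho> (g (smono b)) + ksign s (g (\<rho> (smono b))))"
  shows "w + c * r \<le> c * va e - \<epsilon> * vlen G b"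
proof -
  have Sh: "\<exists>e0\<in>supp x. r + va e0 \<le> va e' \<and> vb e' = vb e0" if "e' \<in> supp (\<rho> x)" for x e'
  proof -
    have "(va e1 - (if l < n then 1 else 0), vb e1 - (if l < n then 0 else 1))
        \<in> {(i, j). r \<le> i \<and> j = 0}" if "l < 2 * n" "e1 \<in> supp (\<rho> (gen l))" for l e1
      using shift[OF that] by simp
    from gder_shift[OF \<rho> this \<open>e' \<in> supp (\<rho> x)\<close>] show ?thesis
      by (auto simp: algebra_simps)
  qed
  consider "e \<in> supp (\<rho> (g (smono b)))" | "e \<in> supp (g (\<rho> (smono b)))"
    using e subsetD[OF supp_add e] by auto
  then show ?thesis
  proof cases
    case 1
    then obtain e0 where e0: "e0 \<in> supp (g (smono b))" "r + va e0 \<le> va e"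
      using Sh by blast
    have "c * (r + va e0) \<le> c * va e"
      using e0(2) c by (rule mult_left_mono)
    then show ?thesis
      using filt_D[OF g b e0(1)] by (simp add: algebra_simps)
  next
    case 2
    then obtain e0 where e0: "e0 \<in> supp (\<rho> (smono b))" "w \<le> c * va e - c * va e0 - \<epsilon> * vb e0"
      using filt_supp[OF g] by blast
    then have "r \<le> va e0" "vb e0 = vlen G b"
      using Sh[OF e0(1)] b by (auto simp: supp_mono)
    moreover have "c * r \<le> c * va e0"
      using \<open>r \<le> va e0\<close> c by (rule mult_left_mono)
    ultimately show ?thesis using e0(2) by simp
  qed
qed

lemma homot_diff:
  assumes "g \<in> HomA G m" "h \<in> HomA G m"
  shows "homot m (g - h) = homot m g - homot m h"
proof (rule Hom_eqI)
  show "homot m (g - h) \<in> HomA G (m - 1)" "homot m g - homot m h \<in> HomA G (m - 1)"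
    using assms by (simp_all add: homot_Hom Hom_diff)
  have "contraction_at m (g - h) z = contraction_at m g z - contraction_at m h z" for z
    by (simp add: contraction_at_def lin_diff[OF partial_d_lin] sum_subtractf)
  then show "homot m (g - h) (smono b) = (homot m g - homot m h) (smono b)" if "sexpos b" for b
    using that by (simp add: homot_def ext_smono lin_diff[OF diag_lin])
qed

lemma homot_zero: "homot m 0 = 0"
  using homot_diff[OF Hom_zero Hom_zero, of m] by simp

section \<open>Series that are finite at each argument\<close>

definition limsum :: "(nat \<Rightarrow> 'b \<Rightarrow> 'b) \<Rightarrow> 'b \<Rightarrow> 'b" where
  "limsum u x = (\<Sum>i | u i x \<noteq> 0. u i x)"

lemma limsum_eq: "\<forall>i\<ge>M. u i x = 0 \<Longrightarrow> limsum u x = (\<Sum>i<M. u i x)"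
  unfolding limsum_def by (rule sum.mono_neutral_left) (auto simp: not_less[symmetric])

lemma limsum_eq_finite:
  assumes u: "\<And>i::nat. u i \<in> filt len_wt 1 (w + int i) m" and "finite X"
  shows "\<exists>M. \<forall>x\<in>X. \<forall>i\<ge>M. u i x = 0"
  using assms(2)
proof induction
  case (insert x X)
  then obtain M where "\<forall>x\<in>X. \<forall>i\<ge>M. u i x = 0" by blast
  moreover obtain M' where "\<forall>i\<ge>M'. u i x = 0"
    using filt_eventually_zero[of u, OF u] by blast
  ultimately show ?case by (intro exI[of _ "max M M'"]) auto
qed simp

lemma Hom_sum: "(\<And>i. i \<in> I \<Longrightarrow> u i \<in> HomA G m) \<Longrightarrow> (\<lambda>x. \<Sum>i\<in>I. u i x) \<in> HomA G m"
proof (induction I rule: infinite_finite_induct)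
  case (insert i I)
  then have "u i + (\<lambda>x. \<Sum>i\<in>I. u i x) \<in> HomA G m"
    by (intro Hom_add) auto
  then show ?case using insert.hyps by (simp add: plus_fun_def)
qed (use Hom_zero[of m] in \<open>simp_all add: zero_fun_def\<close>)

text \<open>Each condition in \<open>HomA\<close> involves finitely many arguments at a time, and on
  these the series agrees with a partial sum.\<close>

lemma limsum_Hom:
  assumes u: "\<And>i::nat. u i \<in> filt len_wt 1 (w + int i) m"
  shows "limsum u \<in> HomA G m"
proof -
  have approx: "\<exists>h\<in>HomA G m. \<forall>x\<in>X. limsum u x = h x" if X: "finite X" for X
  proof -
    obtain M where "\<forall>x\<in>X. \<forall>i\<ge>M. u i x = 0"
      using limsum_eq_finite[of u, OF u X] by blast
    then have "\<forall>x\<in>X. limsum u x = (\<Sum>i<M. u i x)"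
      by (simp add: limsum_eq)
    moreover have "(\<lambda>x. \<Sum>i<M. u i x) \<in> HomA G m"
      by (intro Hom_sum filt_Hom[OF u])
    ultimately show ?thesis
      by (intro bexI[of _ "\<lambda>x. \<Sum>i<M. u i x"]) auto
  qed
  show ?thesis
    unfolding HomA_iff
  proof (intro conjI allI ballI)
    show "lin (limsum u)"
    proof (rule linI)
      fix x y c
      obtain h where "h \<in> HomA G m" "\<forall>z\<in>{x, y, x + y, c *s x}. limsum u z = h z"
        using approx[of "{x, y, x + y, c *s x}"] by auto
      then show "limsum u (x + y) = limsum u x + limsum u y" "limsum u (c *s x) = c *s limsum u x"
        using lin_add[OF Hom_lin, of h m x y] lin_scale[OF Hom_lin, of h m c x] by simp_all
    qed
    fix j x
    show "limsum u x \<in> LV G \<inter> Deg G (j + m)" if x: "x \<in> Deg G j"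
    proof -
      obtain h where "h \<in> HomA G m" "limsum u x = h x" using approx[of "{x}"] by auto
      then show ?thesis using Hom_LV[of h m x] Hom_deg[of h m x j] x by simp
    qed
    show "limsum u (x * y) = ksign (m * j) (x * limsum u y)" if x: "x \<in> LV G \<inter> Deg G j" for y
    proof -
      obtain h where "h \<in> HomA G m" "\<forall>z\<in>{x * y, y}. limsum u z = h z"
        using approx[of "{x * y, y}"] by auto
      then show ?thesis using Hom_mult[of h m x j y] x by simp
    qed
  qed
qed

lemma limsum_filt:
  assumes u: "\<And>i::nat. u i \<in> filt len_wt 1 (w + int i) m" and v: "\<And>i. u i \<in> filt c \<epsilon> q m"
  shows "limsum u \<in> filt c \<epsilon> q m"
proof (rule filt_I[OF limsum_Hom[of u, OF u]])
  fix b e assume b: "sexpos b" and e: "e \<in> supp (limsum u (smono b))"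
  obtain M where "\<forall>i\<ge>M. u i (smono b) = 0"
    using filt_eventually_zero[of u, OF u] by blast
  then have "e \<in> supp (\<Sum>i<M. u i (smono b))"
    using e by (simp add: limsum_eq)
  then obtain i where "e \<in> supp (u i (smono b))"
    using supp_sum[of "\<lambda>i. u i (smono b)" "{..<M}"] by blast
  then show "q \<le> c * va e - \<epsilon> * vlen G b"
    using filt_D[OF v b] by blast
qed

definition top_len :: int where "top_len = vlen G top_a"
definition top_wt :: int where "top_wt = len_wt * vlen G top_a - vlen G top_b"

end

section \<open>The cohomology of the Hom complex\<close>

text \<open>The last two assumptions say that \<open>\<delta> - koszul\<close> lengthens words in V
  and keeps the number of factors from sV. The locale is entered for both differentials; since
  \<open>top_deg\<close>, \<open>top_len\<close> and \<open>top_wt\<close> are defined without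
  \<open>\<delta>\<close>, the two share them.\<close>

locale closure_complex = graded_free +
  fixes \<delta> :: "'b \<Rightarrow> 'b"
  assumes deriv: "derivation_on G UNIV \<delta>"
    and square_zero: "\<delta> (\<delta> x) = 0"
    and on_gv: "i < n \<Longrightarrow> \<delta> (gv G i) \<in> LVge G 2"
    and on_gs: "i < n \<Longrightarrow> e \<in> supp (\<delta> (gs G i) - gv G i) \<Longrightarrow> 1 \<le> va e \<and> vb e = 1"
begin

lemma \<delta>_gder: "gder \<delta>"
  by (rule derivation_gder[OF deriv])

lemma \<delta>_lin: "lin \<delta>"
  by (rule gder_lin[OF \<delta>_gder])

lemma \<delta>_koszul_gen:
  assumes "l < 2 * n" "e \<in> supp (\<delta> (gen l) - koszul (gen l))"
  shows "1 \<le> va e - (if l < n then 1 else 0) \<and> vb e = (if l < n then 0 else 1)"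
proof (cases "l < n")
  case True
  then show ?thesis
    using on_gv[OF True] assms koszul_gen[of l] by (auto simp: LVge_iff)
next
  case False
  then show ?thesis
    using on_gs[of "l - n" e] assms koszul_gen[of l] by (auto simp: gen_def)
qed

lemma \<delta>_koszul_gder: "gder (\<lambda>x. \<delta> x - koszul x)"
  by (rule gder_diff[OF \<delta>_gder koszul_gder])

lemma \<delta>_LV: "x \<in> LV G \<Longrightarrow> \<delta> x \<in> LV G"
proof -
  assume x: "x \<in> LV G"
  have "vb e' = 0" if "e' \<in> supp (\<delta> x - koszul x)" for e'
  proof -
    have "\<exists>e\<in>supp x. (va e' - va e, vb e' - vb e) \<in> UNIV \<times> {0}"
      using \<delta>_koszul_gen by (intro gder_shift[OF \<delta>_koszul_gder _ that]) auto
    then show ?thesis using x by (auto simp: LV_iff)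
  qed
  then show ?thesis using koszul_LV[OF x] by (simp add: LV_iff)
qed

lemma \<delta>_Deg: "x \<in> Deg G j \<Longrightarrow> \<delta> x \<in> Deg G (j + 1)"
  and \<delta>_mult: "x \<in> Deg G j \<Longrightarrow> \<delta> (x * y) = \<delta> x * y + ksign j (x * \<delta> y)"
  using deriv by (auto simp: derivation_on_def)

abbreviation D where "D \<equiv> homD \<delta>"

lemma D_Hom:
  assumes g: "g \<in> HomA G m"
  shows "D m g \<in> HomA G (m + 1)"
  unfolding HomA_iff
proof (intro conjI allI ballI)
  note lin = Hom_lin[OF g]
  show "lin (D m g)"
    unfolding homD_def by (intro lin_plus lin_signed lin_compose[OF \<delta>_lin lin] lin_compose[OF lin \<delta>_lin])
  fix j x
  show "D m g x \<in> LV G \<inter> Deg G (j + (m + 1))" if x: "x \<in> Deg G j"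
  proof -
    have "\<delta> (g x) \<in> Deg G (j + m + 1)" "g (\<delta> x) \<in> Deg G (j + 1 + m)"
      by (intro \<delta>_Deg Hom_deg[OF g] x)+
    then have "\<delta> (g x) \<in> Deg G (j + (m + 1))" "g (\<delta> x) \<in> Deg G (j + (m + 1))"
      by (simp_all add: algebra_simps)
    then show ?thesis
      unfolding homD_def by (intro IntI LV_add Deg_add LV_ksign Deg_ksign \<delta>_LV Hom_LV[OF g])
  qed
  show "D m g (x * y) = ksign ((m + 1) * j) (x * D m g y)" if x: "x \<in> LV G \<inter> Deg G j" for y
  proof -
    have x1: "\<delta> x \<in> LV G" "\<delta> x \<in> Deg G (j + 1)" using x by (auto intro: \<delta>_LV \<delta>_Deg)
    have "D m g (x * y) = ksign (m * j) (\<delta> x * g y) + ksign (m * j + j) (x * \<delta> (g y)) +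
       (ksign (m + 1 + m * (j + 1)) (\<delta> x * g y) + ksign (m + 1 + (j + m * j)) (x * g (\<delta> y)))"
      using x by (simp add: homD_def Hom_mult[OF g, of x j] Hom_mult[OF g x1(1,2)] lin_ksign[OF \<delta>_lin] \<delta>_mult[of x j]
          lin_add[OF lin] lin_ksign[OF lin])
    moreover have "ksign (m + 1 + m * (j + 1)) (\<delta> x * g y) = - ksign (m * j) (\<delta> x * g y)"
      by (rule ksign_neg_cong) auto
    moreover have "ksign (m * j + j) (x * \<delta> (g y)) = ksign ((m + 1) * j) (x * \<delta> (g y))"
      by (rule ksign_cong) auto
    moreover have "ksign (m + 1 + (j + m * j)) (x * g (\<delta> y)) =
        ksign ((m + 1) * j + (m + 1)) (x * g (\<delta> y))"
      by (rule ksign_cong) auto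
    ultimately show ?thesis
      by (simp add: homD_def algebra_simps)
  qed
qed

lemma D_D: "g \<in> HomA G m \<Longrightarrow> D (m + 1) (D m g) = 0"
proof
  fix x assume g: "g \<in> HomA G m"
  have "ksign (m + 1 + 1) (\<delta> (g (\<delta> x))) = - ksign (m + 1) (\<delta> (g (\<delta> x)))"
    by (rule ksign_neg_cong) auto
  then show "D (m + 1) (D m g) x = 0 x"
    by (simp add: homD_def lin_add[OF \<delta>_lin] lin_ksign[OF \<delta>_lin] square_zero
        lin_zero[OF Hom_lin[OF g]])
qed

lemma D_add: "D m (g + h) = D m g + D m h"
  and D_diff: "D m (g - h) = D m g - D m h"
  and D_scale: "D m (\<lambda>x. c *s g x) = (\<lambda>x. c *s D m g x)"
  and D_zero: "D m 0 = 0"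
  by (simp_all add: homD_def fun_eq_iff lin_add[OF \<delta>_lin] lin_diff[OF \<delta>_lin] lin_scale[OF \<delta>_lin]
      lin_zero[OF \<delta>_lin] V.scale_right_distrib)

lemma D_sum: "D m (\<lambda>x. \<Sum>i\<in>I. u i x) x = (\<Sum>i\<in>I. D m (u i) x)"
  by (simp add: homD_def lin_sum[OF \<delta>_lin] ksign_sum sum.distrib)

lemma filt_D_koszul_dual:
  assumes g: "g \<in> filt c \<epsilon> w m" and c: "0 \<le> c"
  shows "D m g - koszul_dual m g \<in> filt c \<epsilon> (w + c) (m + 1)"
proof (rule filt_I)
  note h = filt_Hom[OF g]
  show "D m g - koszul_dual m g \<in> HomA G (m + 1)"
    by (intro Hom_diff D_Hom koszul_dual_Hom h)
  fix b e assume b: "sexpos b" and e: "e \<in> supp ((D m g - koszul_dual m g) (smono b))"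
  have eq: "(D m g - koszul_dual m g) (smono b) = (\<delta> (g (smono b)) - koszul (g (smono b))) +
      ksign (m + 1) (g (\<delta> (smono b) - koszul (smono b)))"
    using koszul_LV[OF Hom_LV[OF h]]
    by (simp add: homD_def koszul_dual_LsV[OF h smono_LsV[OF b]] lin_diff[OF Hom_lin[OF h]])
  have "e \<in> supp (\<delta> (g (smono b)) - koszul (g (smono b)) + ksign (m + 1) (g (\<delta> (smono b) - koszul (smono b))))"
    using e unfolding eq .
  from filt_gder[OF \<delta>_koszul_gder \<delta>_koszul_gen g c b this]
  show "w + c \<le> c * va e - \<epsilon> * vlen G b"
    by (simp only: mult_1_right)
qed

text \<open>If D were \<open>koszul_dual\<close>, this would be the projection onto the line of
  \<open>top_gen\<close>, by \<open>homotopy\<close>.\<close>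

definition perturb :: "int \<Rightarrow> ('b \<Rightarrow> 'b) \<Rightarrow> 'b \<Rightarrow> 'b" where
  "perturb m g = g - D (m - 1) (homot m g) - homot (m + 1) (D m g)"

text \<open>The gain c of \<open>D - koszul_dual\<close> cancels the loss c of the homotopy and
  \<epsilon> is left over: one step forward for the weight, and no loss for
  \<open>Fil\<close>.\<close>

lemma filt_perturb:
  assumes g: "g \<in> filt c \<epsilon> w m" and c: "0 \<le> c" and top: "top_coef g = 0"
  shows "perturb m g \<in> filt c \<epsilon> (w + \<epsilon>) m"
proof -
  note h = filt_Hom[OF g]
  let ?h = "homot m g"
  have "perturb m g = - (D (m - 1) ?h - koszul_dual (m - 1) ?h) - homot (m + 1) (D m g - koszul_dual m g)"
    using homotopy[OF h] top
    by (simp add: perturb_def homot_diff[OF D_Hom[OF h] koszul_dual_Hom[OF h]] fun_eq_iff)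
  also have "\<dots> = 0 - (D (m - 1) ?h - koszul_dual (m - 1) ?h) - homot (m + 1) (D m g - koszul_dual m g)"
    by simp
  also have "\<dots> \<in> filt c \<epsilon> (w + \<epsilon>) m"
    using filt_D_koszul_dual[OF filt_homot[OF g] c] filt_homot[OF filt_D_koszul_dual[OF g c]] by (intro filt_diff[OF filt_diff[OF filt_zero]]) simp_all
  finally show ?thesis .
qed

lemma perturb_cocycle: "D m g = 0 \<Longrightarrow> perturb m g = g - D (m - 1) (homot m g)"
  by (simp add: perturb_def homot_zero)

text \<open>Iterating \<open>perturb\<close> on a cocycle subtracts coboundaries of the elements
  \<open>u i\<close>. The remainders \<open>v i\<close> climb in the weight, so the sum of the
  \<open>u i\<close> is defined and telescopes to a preimage. The hypothesis \<open>large\<close>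
  excludes a top coordinate for every remainder, which \<open>filt_perturb\<close> requires.\<close>

lemma cocycle_exact:
  assumes D: "D m g = 0" and w: "g \<in> filt len_wt 1 w m" and q: "g \<in> filt 1 0 q m"
    and large: "m \<noteq> top_deg \<or> top_wt < w \<or> top_len < q"
  shows "\<exists>\<eta>. \<eta> \<in> filt len_wt 1 (w - len_wt + 1) (m - 1) \<and> \<eta> \<in> filt 1 0 (q - 1) (m - 1) \<and> D (m - 1) \<eta> = g"
proof -
  define v where "v i = (perturb m ^^ i) g" for i
  define u where "u i = homot m (v i)" for i
  have top0: "top_coef k = 0" if "k \<in> filt len_wt 1 w m" "k \<in> filt 1 0 q m" for k
  proof (rule ccontr)
    assume "top_coef k \<noteq> 0"
    then show False
      using filt_top_coef[OF that(1)] filt_top_coef[OF that(2)] top_coef_deg[OF filt_Hom[OF that(1)]] large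
      by (auto simp: top_wt_def top_len_def)
  qed
  have v: "D m (v i) = 0 \<and> v i \<in> filt len_wt 1 (w + int i) m \<and> v i \<in> filt 1 0 q m" for i
  proof (induction i)
    case 0
    then show ?case using D w q by (simp add: v_def)
  next
    case (Suc i)
    then have t: "top_coef (v i) = 0"
      by (intro top0) (auto intro: filt_mono)
    have Suc_v: "v (Suc i) = perturb m (v i)" by (simp add: v_def)
    have "D m (D (m - 1) (homot m (v i))) = 0"
      using D_D[OF homot_Hom[OF filt_Hom[of "v i"]]] Suc by fastforce
    moreover have "D m (v (Suc i)) = D m (v i) - D m (D (m - 1) (homot m (v i)))"
      unfolding Suc_v perturb_cocycle[OF conjunct1[OF Suc]] by (rule D_diff)
    ultimately have "D m (v (Suc i)) = 0"
      using conjunct1[OF Suc] by (simp add: zero_fun_def)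
    moreover have "v (Suc i) \<in> filt len_wt 1 (w + int (Suc i)) m"
      using filt_perturb[of "v i" len_wt 1 "w + int i" m] Suc t len_wt_pos by (simp add: Suc_v algebra_simps)
    moreover have "v (Suc i) \<in> filt 1 0 q m"
      using filt_perturb[of "v i" 1 0 q m] Suc t by (simp add: Suc_v)
    ultimately show ?case by blast
  qed
  have u: "u i \<in> filt len_wt 1 (w - len_wt + 1 + int i) (m - 1)" for i
    using filt_homot[of "v i" len_wt 1 "w + int i" m] v[of i] by (simp add: u_def algebra_simps)
  \<comment> \<open>\<open>limsum_filt\<close> asks for a bound that does not grow with i.\<close>
  have u': "u i \<in> filt len_wt 1 (w - len_wt + 1) (m - 1)" for i
    using u[of i] by (rule filt_mono) simp
  have u2: "u i \<in> filt 1 0 (q - 1) (m - 1)" for i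
    using filt_homot[of "v i" 1 0 q m] v[of i] by (simp add: u_def)
  have "D (m - 1) (limsum u) x = g x" for x
  proof -
    \<comment> \<open>D of a map at x involves its values at x and at \<open>\<delta> x\<close>, so
      the series must be cut off beyond both.\<close>
    obtain M where M: "\<forall>y\<in>{x, \<delta> x}. \<forall>i\<ge>M. u i y = 0"
      using limsum_eq_finite[of u, OF u, of "{x, \<delta> x}"] by auto
    obtain M' where M': "\<forall>i\<ge>M'. v i x = 0"
      using filt_eventually_zero[of v w m x] v by blast
    let ?M = "max M M'"
    have "D (m - 1) (limsum u) x = D (m - 1) (\<lambda>y. \<Sum>i<?M. u i y) x"
      using M limsum_eq[of ?M u x] limsum_eq[of ?M u "\<delta> x"] by (simp add: homD_def)
    also have "\<dots> = (\<Sum>i<?M. D (m - 1) (u i) x)"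
      by (rule D_sum)
    also have "\<dots> = (\<Sum>i<?M. v i x - v (Suc i) x)"
      using v by (intro sum.cong) (auto simp: u_def v_def perturb_cocycle)
    also have "\<dots> = v 0 x - v ?M x"
      by (rule sum_lessThan_telescope')
    finally show ?thesis using M' by (simp add: v_def)
  qed
  then show ?thesis
    using limsum_filt[of u, OF u u'] limsum_filt[of u, OF u u2] by blast
qed

text \<open>D of \<open>top_gen\<close> is a cocycle in degree \<open>top_deg + 1\<close>, where
  everything is exact. Its preimage \<eta> has weight at least \<open>top_wt + 1\<close>, so
  subtracting it from \<open>top_gen\<close> does not touch the top coefficient.\<close>

lemma top_cocycle_exists:
  "\<exists>z. z \<in> filt len_wt 1 top_wt top_deg \<and> z \<in> filt 1 0 top_len top_deg \<and> D top_deg z = 0 \<and> top_coef z = 1"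
proof -
  have f1: "top_gen \<in> filt len_wt 1 top_wt top_deg" and f2: "top_gen \<in> filt 1 0 top_len top_deg"
    by (intro filt_top_gen; simp add: top_wt_def top_len_def)+
  have "D (top_deg + 1) (D top_deg top_gen) = 0"
    by (rule D_D[OF top_gen_Hom])
  moreover have "D top_deg top_gen \<in> filt len_wt 1 (top_wt + len_wt) (top_deg + 1)"
    "D top_deg top_gen \<in> filt 1 0 (top_len + 1) (top_deg + 1)"
    using filt_D_koszul_dual[OF f1] filt_D_koszul_dual[OF f2] len_wt_pos by (simp_all add: koszul_dual_top_gen)
  ultimately obtain \<eta> where \<eta>: "\<eta> \<in> filt len_wt 1 (top_wt + 1) top_deg"
    "\<eta> \<in> filt 1 0 top_len top_deg" "D top_deg \<eta> = D top_deg top_gen"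
    using cocycle_exact[of "top_deg + 1" "D top_deg top_gen" "top_wt + len_wt" "top_len + 1"] by auto
  have "top_coef \<eta> = 0"
    using filt_top_coef[OF \<eta>(1)] by (auto simp: top_wt_def)
  then show ?thesis
    using \<eta> f1 f2 filt_mono[OF \<eta>(1), of top_wt]
    by (intro exI[of _ "top_gen - \<eta>"]) (simp add: filt_diff D_diff top_coef_diff top_coef_gen)
qed

text \<open>A preimage of z can be pushed up to weight \<open>top_wt - len_wt + 1\<close> without
  changing its boundary. Then z differs from its \<open>koszul_dual\<close> only in weight above
  \<open>top_wt\<close>, while \<open>koszul_dual\<close> never meets the top coordinate; so z would
  have top coefficient 0.\<close>

lemma top_cocycle_not_boundary:
  assumes z: "z \<in> filt len_wt 1 top_wt top_deg" "D top_deg z = 0" "top_coef z = 1"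
    and \<eta>: "\<eta> \<in> HomA G (top_deg - 1)"
  shows "D (top_deg - 1) \<eta> \<noteq> z"
proof
  let ?m = "top_deg - 1"
  assume bd: "D ?m \<eta> = z"
  define v where "v i = ((\<lambda>k. k - D (?m - 1) (homot ?m k)) ^^ i) \<eta>" for i
  have v: "D ?m (v i) = z \<and> v i \<in> filt len_wt 1 (min (?m + int i) (top_wt - len_wt + 1)) ?m" for i
  proof (induction i)
    case 0
    then show ?case using bd filt_mono[OF Hom_filt[OF \<eta>]] by (simp add: v_def)
  next
    case (Suc i)
    let ?w = "min (?m + int i) (top_wt - len_wt + 1)"
    have Suc_v: "v (Suc i) = v i - D (?m - 1) (homot ?m (v i))" by (simp add: v_def)
    have h: "v i \<in> HomA G ?m" using Suc filt_Hom by blast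
    have "D ?m (v (Suc i)) = z"
      using D_D[OF homot_Hom[OF h]] Suc by (simp add: Suc_v D_diff)
    \<comment> \<open>Now D of \<open>v i\<close> is z and not zero, so the step differs from
      \<open>perturb\<close> by \<open>homot top_deg z\<close>. The weight of this term is the cap
      in the minimum.\<close>
    moreover have v_eq: "v (Suc i) = perturb ?m (v i) + homot top_deg z"
      using Suc by (simp add: Suc_v perturb_def)
    have "top_coef (v i) = 0"
      using top_coef_deg[OF h] by auto
    then have "perturb ?m (v i) \<in> filt len_wt 1 (?w + 1) ?m"
      using filt_perturb[of "v i" len_wt 1 ?w ?m] Suc len_wt_pos by simp
    then have "perturb ?m (v i) \<in> filt len_wt 1 (min (?m + int (Suc i)) (top_wt - len_wt + 1)) ?m"
      by (rule filt_mono) simp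
    moreover have "homot top_deg z \<in> filt len_wt 1 (top_wt - len_wt + 1) ?m"
      using filt_homot[OF z(1)] by simp
    then have "homot top_deg z \<in> filt len_wt 1 (min (?m + int (Suc i)) (top_wt - len_wt + 1)) ?m"
      by (rule filt_mono) simp
    ultimately show ?case
      using filt_add v_eq by metis
  qed
  define i where "i = nat (top_wt - len_wt + 1 - ?m)"
  have "?m + int i \<ge> top_wt - len_wt + 1" by (simp add: i_def)
  then have vi: "v i \<in> filt len_wt 1 (top_wt - len_wt + 1) ?m" "D ?m (v i) = z"
    using v[of i] by (simp_all add: min_absorb2)
  then have "z - koszul_dual ?m (v i) \<in> filt len_wt 1 (top_wt + 1) top_deg"
    using filt_D_koszul_dual[OF vi(1)] len_wt_pos by simp
  then have "top_coef (z - koszul_dual ?m (v i)) = 0"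
    using filt_top_coef by (fastforce simp: top_wt_def)
  then show False
    using z(3) top_coef_koszul_dual[OF filt_Hom[OF vi(1)]] by (simp add: top_coef_diff)
qed

text \<open>Induction on the distance of w from \<open>top_wt\<close>: subtracting a multiple of z
  clears the top coefficient, after which \<open>perturb\<close> raises the weight by one; beyond
  \<open>top_wt\<close> the cocycle is exact. The bound \<open>q \<le> top_len\<close> keeps z
  inside the filtration step of g.\<close>

lemma top_cocycle_spans:
  assumes z: "z \<in> filt len_wt 1 top_wt top_deg" "z \<in> filt 1 0 top_len top_deg" "D top_deg z = 0"
      "top_coef z = 1"
    and g: "D top_deg g = 0" "g \<in> filt len_wt 1 w top_deg" "g \<in> filt 1 0 q top_deg" and q: "q \<le> top_len"
  shows "\<exists>c. \<exists>\<eta>\<in>filt 1 0 (q - 1) (top_deg - 1). g = (\<lambda>x. c *s z x) + D (top_deg - 1) \<eta>"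
  using g
proof (induction "nat (top_wt + 1 - w)" arbitrary: w g)
  case 0
  then have "top_wt < w" by simp
  then obtain \<eta> where "\<eta> \<in> filt 1 0 (q - 1) (top_deg - 1)" "D (top_deg - 1) \<eta> = g"
    using cocycle_exact[OF 0(2,3,4)] by blast
  then show ?case by (intro exI[of _ 0] bexI[of _ \<eta>]) (auto simp: fun_eq_iff)
next
  case (Suc N)
  then have w: "w \<le> top_wt" by simp
  let ?a = "top_coef g"
  define k where "k = g - (\<lambda>x. ?a *s z x)"
  have kD: "D top_deg k = 0"
    using Suc.prems(1) z(3) by (simp add: k_def D_diff D_scale fun_eq_iff)
  have kt: "top_coef k = 0"
    using z(4) by (simp add: k_def top_coef_diff top_coef_scale)
  have kw: "k \<in> filt len_wt 1 w top_deg" and kq: "k \<in> filt 1 0 q top_deg"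
    unfolding k_def using Suc.prems filt_mono[OF z(1) w] filt_mono[OF z(2) q]
    by (auto intro!: filt_diff filt_scale)
  have perturb: "perturb top_deg k = k - D (top_deg - 1) (homot top_deg k)"
    by (rule perturb_cocycle[OF kD])
  have "D top_deg (perturb top_deg k) = 0"
    using D_D[OF homot_Hom[OF filt_Hom[OF kw]]] kD by (simp add: perturb D_diff)
  moreover have "perturb top_deg k \<in> filt len_wt 1 (w + 1) top_deg" "perturb top_deg k \<in> filt 1 0 q top_deg"
    using filt_perturb[OF kw _ kt] filt_perturb[OF kq _ kt] len_wt_pos by simp_all
  moreover have "N = nat (top_wt + 1 - (w + 1))" using Suc.hyps(2) by linarith
  ultimately obtain c \<eta> where \<eta>: "\<eta> \<in> filt 1 0 (q - 1) (top_deg - 1)"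
    "perturb top_deg k = (\<lambda>x. c *s z x) + D (top_deg - 1) \<eta>"
    using Suc.hyps(1) by blast
  have "g = (\<lambda>x. (?a + c) *s z x) + D (top_deg - 1) (homot top_deg k + \<eta>)"
  proof
    fix x
    show "g x = ((\<lambda>x. (?a + c) *s z x) + D (top_deg - 1) (homot top_deg k + \<eta>)) x"
      using fun_cong[OF perturb, of x] fun_cong[OF \<eta>(2), of x]
      by (simp add: D_add k_def V.scale_left_distrib algebra_simps)
  qed
  moreover have "homot top_deg k + \<eta> \<in> filt 1 0 (q - 1) (top_deg - 1)"
    using filt_homot[OF kq] \<eta>(1) by (intro filt_add) simp_all
  ultimately show ?case by blast
qed

section \<open>Consequences for classes, preimages and bidegrees\<close>

lemma cocycle_exact_off_top:
  assumes "D m g = 0" "g \<in> filt 1 0 q m" "m \<noteq> top_deg \<or> top_len < q"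
  shows "\<exists>\<eta>\<in>filt 1 0 (q - 1) (m - 1). D (m - 1) \<eta> = g"
  using cocycle_exact[OF assms(1) Hom_filt[OF filt_Hom[OF assms(2)]] assms(2)] assms(3) by blast

lemma Hom_filt_zero: "g \<in> HomA G m \<Longrightarrow> g \<in> filt 1 0 0 m"
  by (rule filt_I) auto

lemma top_len_nonneg: "0 \<le> top_len"
  by (simp add: top_len_def)

text \<open>Any nonzero class is a nonzero multiple of that of the cocycle z. Later it therefore
  suffices to show that a class does not vanish.\<close>

lemma nonzero_class_generates:
  assumes f: "nonzero_class G \<delta> m f"
  shows "m = top_deg" "generates_Ext G \<delta> m f"
proof -
  have fH: "f \<in> HomA G m" "D m f = 0" and nb: "f \<notin> D (m - 1) ` HomA G (m - 1)"
    using f by (auto simp: nonzero_class_def)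
  have off: "g \<in> D (j - 1) ` HomA G (j - 1)" if "j \<noteq> top_deg" "g \<in> HomA G j" "D j g = 0" for j g
    using cocycle_exact_off_top[OF that(3) Hom_filt_zero[OF that(2)]] that(1) filt_Hom by blast
  show m: "m = top_deg"
    using off fH nb by blast
  obtain z where z: "z \<in> filt len_wt 1 top_wt top_deg" "z \<in> filt 1 0 top_len top_deg" "D top_deg z = 0"
      "top_coef z = 1"
    using top_cocycle_exists by blast
  have span: "\<exists>c. \<exists>\<eta>\<in>HomA G (m - 1). g = (\<lambda>x. c *s z x) + D (m - 1) \<eta>"
    if "g \<in> HomA G m" "D m g = 0" for g
    using top_cocycle_spans[OF z _ Hom_filt Hom_filt_zero top_len_nonneg] that filt_Hom unfolding m by blast
  obtain a \<xi> where f_eq: "\<xi> \<in> HomA G (m - 1)" "f = (\<lambda>x. a *s z x) + D (m - 1) \<xi>"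
    using span[OF fH] by blast
  have "a \<noteq> 0"
  proof
    assume "a = 0"
    then have "f = D (m - 1) \<xi>" using f_eq(2) by (simp add: fun_eq_iff)
    then show False using nb f_eq(1) by blast
  qed
  have "\<exists>c. \<exists>\<eta>\<in>HomA G (m - 1). g = (\<lambda>x. c *s f x) + D (m - 1) \<eta>"
    if g: "g \<in> HomA G m" "D m g = 0" for g
  proof -
    obtain c \<eta> where c: "\<eta> \<in> HomA G (m - 1)" "g = (\<lambda>x. c *s z x) + D (m - 1) \<eta>"
      using span[OF g] by blast
    have "g = (\<lambda>x. (c / a) *s f x) + D (m - 1) (\<eta> - (\<lambda>x. (c / a) *s \<xi> x))"
      using \<open>a \<noteq> 0\<close> fun_cong[OF c(2)] fun_cong[OF f_eq(2)]
      by (simp add: fun_eq_iff D_diff D_scale V.scale_right_distrib)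
    moreover have "\<eta> - (\<lambda>x. (c / a) *s \<xi> x) \<in> HomA G (m - 1)"
      by (intro Hom_diff Hom_scale c f_eq)
    ultimately show ?thesis by blast
  qed
  then show "generates_Ext G \<delta> m f"
    unfolding generates_Ext_def using f off m by blast
qed

text \<open>Away from the top this is exactness. At the top, g is a multiple of z plus D of an
  element of the desired filtration, and the multiple is zero because z is not a coboundary.\<close>

lemma boundary_filt:
  assumes g: "g \<in> filt 1 0 q m" and \<xi>: "\<xi> \<in> HomA G (m - 1)" "D (m - 1) \<xi> = g"
  shows "\<exists>\<eta>\<in>filt 1 0 (q - 1) (m - 1). D (m - 1) \<eta> = g"
proof -
  have Dg: "D m g = 0" using D_D[OF \<xi>(1)] \<xi>(2) by simp
  show ?thesis
  proof (cases "m \<noteq> top_deg \<or> top_len < q")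
    case True
    then show ?thesis by (rule cocycle_exact_off_top[OF Dg g])
  next
    case False
    then have m: "m = top_deg" and q: "q \<le> top_len" by auto
    obtain z where z: "z \<in> filt len_wt 1 top_wt top_deg" "z \<in> filt 1 0 top_len top_deg" "D top_deg z = 0"
        "top_coef z = 1"
      using top_cocycle_exists by blast
    obtain c \<eta> where c: "\<eta> \<in> filt 1 0 (q - 1) (m - 1)" "g = (\<lambda>x. c *s z x) + D (m - 1) \<eta>"
      using top_cocycle_spans[OF z _ Hom_filt[OF filt_Hom] _ q, of g] Dg g unfolding m by blast
    have "c = 0"
    proof (rule ccontr)
      assume "c \<noteq> 0"
      have "D (m - 1) (\<lambda>x. inverse c *s (\<xi> - \<eta>) x) = z"
      proof
        fix x
        show "D (m - 1) (\<lambda>x. inverse c *s (\<xi> - \<eta>) x) x = z x"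
          using \<open>c \<noteq> 0\<close> fun_cong[OF c(2), of x] fun_cong[OF \<xi>(2), of x]
          unfolding D_scale D_diff by simp
      qed
      moreover have "(\<lambda>x. inverse c *s (\<xi> - \<eta>) x) \<in> HomA G (top_deg - 1)"
        using \<xi>(1) filt_Hom[OF c(1)] m by (intro Hom_scale Hom_diff) auto
      ultimately show False
        using top_cocycle_not_boundary[OF z(1,3,4)] m by blast
    qed
    then show ?thesis using c by (intro bexI[of _ \<eta>]) (auto simp: fun_eq_iff)
  qed
qed

text \<open>A cocycle in filtration above \<open>top_len\<close> is a coboundary. One in lower
  filtration is cohomologous to a multiple of z, which lies one step further in. So p is the number
  of generators of odd degree.\<close>

lemma bideg_top_len:
  assumes "Ext_bideg_nonzero G \<delta> p (top_deg - p)"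
  shows "p = top_len"
proof -
  obtain g where g: "g \<in> filt 1 0 p top_deg" "D top_deg g = 0"
    and no: "\<And>g' \<eta>. g' \<in> filt 1 0 (p + 1) top_deg \<Longrightarrow> \<eta> \<in> HomA G (top_deg - 1) \<Longrightarrow>
      D top_deg g' = 0 \<Longrightarrow> g \<noteq> g' + D (top_deg - 1) \<eta>"
    using assms unfolding Ext_bideg_nonzero_def Fil_eq by auto
  have "\<not> top_len < p"
    using cocycle_exact_off_top[OF g(2,1)] no[OF filt_zero _ D_zero] filt_Hom by fastforce
  moreover have "\<not> p < top_len"
  proof
    assume p: "p < top_len"
    obtain z where z: "z \<in> filt len_wt 1 top_wt top_deg" "z \<in> filt 1 0 top_len top_deg" "D top_deg z = 0"
        "top_coef z = 1"
      using top_cocycle_exists by blast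
    obtain c \<eta> where c: "\<eta> \<in> filt 1 0 (p - 1) (top_deg - 1)"
      "g = (\<lambda>x. c *s z x) + D (top_deg - 1) \<eta>"
      using top_cocycle_spans[OF z g(2) Hom_filt[OF filt_Hom[OF g(1)]] g(1)] p by auto
    have "(\<lambda>x. c *s z x) \<in> filt 1 0 (p + 1) top_deg"
      using filt_scale[OF filt_mono[OF z(2)]] p by simp
    moreover have "D top_deg (\<lambda>x. c *s z x) = 0"
      by (simp add: D_scale z(3) fun_eq_iff)
    ultimately show False using no filt_Hom[OF c(1)] c(2) by blast
  qed
  ultimately show ?thesis by simp
qed

end

section \<open>Comparison of the two differentials\<close>

text \<open>\<open>closure_k\<close> does not assert that \<open>\<delta>k\<close> has square zero;
  this is derived from the square of \<open>\<delta>\<close>.\<close>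

locale compared_closures = graded_free +
  fixes d s \<delta> \<delta>k :: "'b \<Rightarrow> 'b" and di :: "nat \<Rightarrow> 'b \<Rightarrow> 'b" and k :: nat
  assumes k: "2 \<le> k"
    and words: "word_decomposition G k d di"
    and closure: "acyclic_closure G s d \<delta>"
    and closure_k: "closure_diff G s (di k) \<delta>k"
begin

lemma s_lin: "lin s"
  using closure by (simp add: acyclic_closure_def suspension_map_def)

lemma di_gv:
  assumes "k \<le> i" "j < n"
  shows "di i (gv G j) \<in> LVlen G (int i) \<inter> Deg G (int (dg G j) + 1)"
  using words assms gv_LV[of j] gv_Deg[of j]
  unfolding word_decomposition_def derivation_on_def by blast

lemma supp_di_gv:
  assumes "k \<le> i" "j < n" "e \<in> supp (di i (gv G j))"
  shows "va e = int i" "vb e = 0" "int i \<le> int (dg G j) + 1"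
  using di_gv[OF assms(1,2)] assms(3) va_bounds(2)[OF supp_expos[OF assms(3)]]
  by (auto simp: LVlen_iff Deg_iff)

lemma supp_s_di_gv:
  assumes "k \<le> i" "j < n" "e \<in> supp (s (di i (gv G j)))"
  shows "va e = int i - 1" "vb e = 1"
proof -
  have "\<forall>r\<ge>1. \<forall>m. s ` (LVlen G r \<inter> Deg G m) \<subseteq> LVsV G (r - 1) \<inter> Deg G (m - 1)"
    using closure unfolding acyclic_closure_def suspension_map_def by blast
  moreover have "1 \<le> int i" using assms(1) k by simp
  ultimately have "s ` (LVlen G (int i) \<inter> Deg G (int (dg G j) + 1)) \<subseteq> LVsV G (int i - 1)"
    by blast
  then have "s (di i (gv G j)) \<in> LVsV G (int i - 1)"
    using di_gv[OF assms(1,2)] by blast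
  then show "va e = int i - 1" "vb e = 1"
    using assms(3) by (auto simp: LVsV_iff)
qed

section \<open>The difference of the two differentials on generators\<close>

definition higher where "higher j = {i. k < i \<and> di i (gv G j) \<noteq> 0}"

lemma d_gv:
  assumes j: "j < n"
  shows "d (gv G j) - di k (gv G j) = (\<Sum>i\<in>higher j. di i (gv G j))"
proof -
  \<comment> \<open>A word of length i has degree at least i, while \<open>di i (gv G j)\<close> has
    degree \<open>dg G j + 1\<close>. So only finitely many i contribute, and the sum over
    \<open>higher j\<close> is a genuine one.\<close>
  have bound: "i \<le> dg G j + 1" if i: "k \<le> i" "di i (gv G j) \<noteq> 0" for i
  proof -
    obtain e where "e \<in> supp (di i (gv G j))"
      using i(2) supp_empty_iff by blast
    from supp_di_gv(3)[OF i(1) j this] show ?thesis by simp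
  qed
  then have "higher j \<subseteq> {..dg G j + 1}"
    by (auto simp: higher_def less_imp_le)
  then have fin: "finite (higher j)"
    by (rule finite_subset) simp
  have "d (gv G j) = (\<Sum>i | k \<le> i \<and> di i (gv G j) \<noteq> 0. di i (gv G j))"
    using words gv_LV[OF j] by (simp add: word_decomposition_def)
  also have "\<dots> = (\<Sum>i\<in>insert k (higher j). di i (gv G j))"
    using fin by (intro sum.mono_neutral_left) (auto simp: higher_def)
  also have "\<dots> = di k (gv G j) + (\<Sum>i\<in>higher j. di i (gv G j))"
    using fin by (simp add: higher_def)
  finally show ?thesis by simp
qed

lemma supp_d_gv:
  assumes "j < n" "e \<in> supp (d (gv G j) - di k (gv G j))"
  shows "\<exists>i>k. va e = int i \<and> vb e = 0"
proof -
  obtain i where i: "i \<in> higher j" "e \<in> supp (di i (gv G j))"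
    using assms(2) supp_sum[of "\<lambda>i. di i (gv G j)" "higher j"] unfolding d_gv[OF assms(1)] by blast
  then have "k < i" by (simp add: higher_def)
  then show ?thesis
    using supp_di_gv(1,2)[OF _ assms(1) i(2)] by (intro exI[of _ i]) simp
qed

lemma supp_s_d_gv:
  assumes "j < n" "e \<in> supp (s (d (gv G j) - di k (gv G j)))"
  shows "\<exists>i>k. va e = int i - 1 \<and> vb e = 1"
proof -
  obtain i where i: "i \<in> higher j" "e \<in> supp (s (di i (gv G j)))"
    using assms(2) supp_sum[of "\<lambda>i. s (di i (gv G j))" "higher j"]
    unfolding d_gv[OF assms(1)] lin_sum[OF s_lin] by blast
  then have "k < i" by (simp add: higher_def)
  then show ?thesis
    using supp_s_di_gv[OF _ assms(1) i(2)] by (intro exI[of _ i]) simp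
qed

lemma \<delta>_on:
  assumes "j < n"
  shows "\<delta> (gv G j) = d (gv G j)" "\<delta> (gs G j) = gv G j - s (d (gv G j))"
    "\<delta>k (gv G j) = di k (gv G j)" "\<delta>k (gs G j) = gv G j - s (di k (gv G j))"
  using closure closure_k assms unfolding acyclic_closure_def closure_diff_def by blast+

lemma gder_\<delta>: "gder \<delta>" and gder_\<delta>k: "gder \<delta>k"
  using closure closure_k derivation_gder unfolding acyclic_closure_def closure_diff_def by blast+

definition rest where "rest x = \<delta> x - \<delta>k x"

lemma gder_rest: "gder rest"
  unfolding rest_def[abs_def] by (rule gder_diff[OF gder_\<delta> gder_\<delta>k])

lemma rest_gen:
  assumes "l < 2 * n" "e \<in> supp (rest (gen l))"
  shows "\<exists>i>k. va e - (if l < n then 1 else 0) = int i - 1 \<and> vb e = (if l < n then 0 else 1)"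
proof (cases "l < n")
  case True
  then have "rest (gen l) = d (gv G l) - di k (gv G l)"
    by (simp add: rest_def \<delta>_on)
  then obtain i where "k < i" "va e = int i" "vb e = 0"
    using supp_d_gv[OF True, of e] assms(2) by metis
  with True show ?thesis by (intro exI[of _ i]) simp
next
  case False
  define j where "j = l - n"
  have l: "l = n + j" "j < n" using False assms(1) by (auto simp: j_def)
  have "rest (gen l) = - s (d (gv G j) - di k (gv G j))"
    using l by (simp add: rest_def \<delta>_on lin_diff[OF s_lin])
  then have "e \<in> supp (s (d (gv G j) - di k (gv G j)))"
    using assms(2) by simp
  then obtain i where "k < i" "va e = int i - 1" "vb e = 1"
    using supp_s_d_gv[OF l(2), of e] by metis
  with l show ?thesis by (intro exI[of _ i]) simp
qed

text \<open>The first pair is the shift produced by \<open>d_k\<close>, the second that of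
  \<open>sv \<mapsto> v\<close>.\<close>

lemma \<delta>k_gen:
  assumes "l < 2 * n" "e \<in> supp (\<delta>k (gen l))"
  shows "(va e - (if l < n then 1 else 0), vb e - (if l < n then 0 else 1)) \<in> {(int k - 1, 0), (1, - 1)}"
proof (cases "l < n")
  case True
  then have "e \<in> supp (di k (gv G l))"
    using assms(2) by (simp add: \<delta>_on)
  with supp_di_gv(1,2)[OF _ True, of k e] True show ?thesis by simp
next
  case False
  define j where "j = l - n"
  have l: "l = n + j" "j < n" using False assms(1) by (auto simp: j_def)
  then have "e \<in> supp (gv G j) \<or> e \<in> supp (s (di k (gv G j)))"
    using assms(2) subsetD[OF supp_diff, of e "gv G j" "s (di k (gv G j))"] by (simp add: \<delta>_on)
  then show ?thesis
  proof
    assume "e \<in> supp (gv G j)"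
    then have "e = upd j 1 (\<lambda>_. 0, \<lambda>_. 0)"
      using supp_gen[of j] l by simp
    then have "va e = 1" "vb e = 0"
      using l by (simp_all add: va_upd vb_upd)
    with l show ?thesis by simp
  next
    assume "e \<in> supp (s (di k (gv G j)))"
    with supp_s_di_gv[of k j e] l show ?thesis by simp
  qed
qed

text \<open>In \<open>\<delta>\<^sup>2 = 0\<close> the terms of \<open>\<delta>k\<^sup>2\<close> have bidegrees that none of the others has.\<close>

lemma \<delta>k_square_zero: "\<delta>k (\<delta>k x) = 0"
proof -
  have sk: "\<exists>e\<in>supp x. (va e' - va e, vb e' - vb e) \<in> {(int k - 1, 0), (1, - 1)}"
    if "e' \<in> supp (\<delta>k x)" for e' x
    using gder_shift[OF gder_\<delta>k \<delta>k_gen that] .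
  have sr: "\<exists>e\<in>supp x. (va e' - va e, vb e' - vb e) \<in> {int k..} \<times> {0}"
    if "e' \<in> supp (rest x)" for e' x
    by (rule gder_shift[OF gder_rest _ that]) (use rest_gen in fastforce)
  have zero: "\<delta>k (\<delta>k (mono G e)) = 0" if e: "e \<in> expos G" for e
  proof -
    let ?x = "mono G e"
    let ?Z = "\<delta>k (rest ?x) + rest (\<delta>k ?x) + rest (rest ?x)"
    have "\<delta> y = \<delta>k y + rest y" for y by (simp add: rest_def)
    moreover have "\<delta> (\<delta> ?x) = 0" using closure by (simp add: acyclic_closure_def)
    ultimately have sum: "\<delta>k (\<delta>k ?x) + ?Z = 0"
      using lin_add[OF gder_lin[OF gder_\<delta>k], of "\<delta>k ?x" "rest ?x"]
        lin_add[OF gder_lin[OF gder_rest], of "\<delta>k ?x" "rest ?x"] by (simp add: algebra_simps)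
    have "supp (\<delta>k (\<delta>k ?x)) = {}"
    proof (rule equals0I)
      fix e' assume e': "e' \<in> supp (\<delta>k (\<delta>k ?x))"
      then obtain e1 where "e1 \<in> supp (\<delta>k ?x)"
        "(va e' - va e1, vb e' - vb e1) \<in> {(int k - 1, 0), (1, - 1)}"
        using sk by blast
      moreover from sk[OF this(1)] have
        "(va e1 - va e, vb e1 - vb e) \<in> {(int k - 1, 0), (1, - 1)}"
        by (simp add: supp_mono[OF e])
      \<comment> \<open>The terms of \<open>?Z\<close> shift the lengths by (x, 0) with x at least
        2k - 1, or by (x, -1) with x at least k + 1. None of these pairs is in the list found
        here.\<close>
      ultimately have 1: "(va e' - va e, vb e' - vb e) \<in> {(2 * int k - 2, 0), (int k, - 1), (2, - 2)}"
        by auto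
      have "coef e' (\<delta>k (\<delta>k ?x)) + coef e' ?Z = 0"
        using sum coef_add[of e' "\<delta>k (\<delta>k ?x)" ?Z] by simp
      then have "e' \<in> supp ?Z" using e' by (auto simp: supp_def)
      then consider "e' \<in> supp (\<delta>k (rest ?x))" | "e' \<in> supp (rest (\<delta>k ?x))"
        | "e' \<in> supp (rest (rest ?x))"
        using supp_add by blast
      then show False
      proof cases
        case 1
        then obtain e1 where "e1 \<in> supp (rest ?x)"
          "(va e' - va e1, vb e' - vb e1) \<in> {(int k - 1, 0), (1, - 1)}"
          using sk by blast
        moreover from sr[OF this(1)] have "(va e1 - va e, vb e1 - vb e) \<in> {int k..} \<times> {0}"
          by (simp add: supp_mono[OF e])
        ultimately show False using \<open>(va e' - va e, _) \<in> _\<close> k by auto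
      next
        case 2
        then obtain e1 where "e1 \<in> supp (\<delta>k ?x)"
          "(va e' - va e1, vb e' - vb e1) \<in> {int k..} \<times> {0}"
          using sr by blast
        moreover from sk[OF this(1)] have "(va e1 - va e, vb e1 - vb e) \<in> {(int k - 1, 0), (1, - 1)}"
          by (simp add: supp_mono[OF e])
        ultimately show False using \<open>(va e' - va e, _) \<in> _\<close> k by auto
      next
        case 3
        then obtain e1 where "e1 \<in> supp (rest ?x)"
          "(va e' - va e1, vb e' - vb e1) \<in> {int k..} \<times> {0}"
          using sr by blast
        moreover from sr[OF this(1)] have "(va e1 - va e, vb e1 - vb e) \<in> {int k..} \<times> {0}"
          by (simp add: supp_mono[OF e])
        ultimately show False using \<open>(va e' - va e, _) \<in> _\<close> k by auto
      qed
    qed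
    then show ?thesis by (simp add: supp_empty_iff)
  qed
  show ?thesis
    using lin_eqI[OF lin_compose[OF gder_lin gder_lin] lin_const_zero, OF gder_\<delta>k gder_\<delta>k] zero
    by blast
qed

section \<open>The two Hom complexes side by side\<close>

sublocale E: closure_complex G \<delta>
proof
  show "derivation_on G UNIV \<delta>" "\<delta> (\<delta> x) = 0" for x
    using closure by (auto simp: acyclic_closure_def closure_diff_def)
  fix i assume i: "i < n"
  have d: "d (gv G i) = (d (gv G i) - di k (gv G i)) + di k (gv G i)" by simp
  show "\<delta> (gv G i) \<in> LVge G 2"
    unfolding LVge_iff \<delta>_on(1)[OF i]
  proof
    fix e assume "e \<in> supp (d (gv G i))"
    then have "e \<in> supp (d (gv G i) - di k (gv G i)) \<union> supp (di k (gv G i))"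
      using subsetD[OF supp_add[of "d (gv G i) - di k (gv G i)" "di k (gv G i)"]] by simp
    then show "2 \<le> va e \<and> vb e = 0"
      using supp_d_gv[OF i, of e] supp_di_gv[of k i e] i k by auto
  qed
  fix e assume "e \<in> supp (\<delta> (gs G i) - gv G i)"
  then have "e \<in> supp (s (d (gv G i)))"
    by (simp add: \<delta>_on(2)[OF i])
  moreover have "s (d (gv G i)) = s (d (gv G i) - di k (gv G i)) + s (di k (gv G i))"
    by (simp add: lin_diff[OF s_lin])
  ultimately have "e \<in> supp (s (d (gv G i) - di k (gv G i))) \<union> supp (s (di k (gv G i)))"
    using supp_add by fastforce
  then show "1 \<le> va e \<and> vb e = 1"
    using supp_s_d_gv[OF i, of e] supp_s_di_gv[of k i e] i k by auto
qed

sublocale K: closure_complex G \<delta>k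
proof
  show "derivation_on G UNIV \<delta>k"
    using closure_k by (simp add: closure_diff_def)
  show "\<delta>k (\<delta>k x) = 0" for x by (rule \<delta>k_square_zero)
  fix i assume i: "i < n"
  show "\<delta>k (gv G i) \<in> LVge G 2"
    using supp_di_gv[of k i] i k by (auto simp: LVge_iff \<delta>_on)
  fix e assume "e \<in> supp (\<delta>k (gs G i) - gv G i)"
  then show "1 \<le> va e \<and> vb e = 1"
    using supp_s_di_gv[of k i e] i k by (auto simp: \<delta>_on(4)[OF i])
qed

text \<open>The difference consists of parts with \<open>i > k \<ge> 2\<close>, and such a part
  lengthens words in V by \<open>i - 1 \<ge> 2\<close>. This gain exceeds the single step lost in
  \<open>boundary_filt\<close>.\<close>

lemma filt_E_K:
  assumes g: "g \<in> filt 1 0 q m"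
  shows "homD \<delta> m g - homD \<delta>k m g \<in> filt 1 0 (q + 2) (m + 1)"
proof (rule filt_I)
  note h = filt_Hom[OF g]
  show "homD \<delta> m g - homD \<delta>k m g \<in> HomA G (m + 1)"
    by (intro Hom_diff E.D_Hom K.D_Hom h)
  have shift: "2 \<le> va e - (if l < n then 1 else 0) \<and> vb e = (if l < n then 0 else 1)"
    if "l < 2 * n" "e \<in> supp (rest (gen l))" for l e
    using rest_gen[OF that] k by auto
  fix b e assume b: "sexpos b" and e: "e \<in> supp ((homD \<delta> m g - homD \<delta>k m g) (smono b))"
  have eq: "(homD \<delta> m g - homD \<delta>k m g) (smono b) = rest (g (smono b)) + ksign (m + 1) (g (rest (smono b)))"
    by (simp add: homD_def rest_def lin_diff[OF Hom_lin[OF h]])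
  from filt_gder[OF gder_rest shift g _ b e[unfolded eq]]
  show "q + 2 \<le> 1 * va e - 0 * vlen G b" by simp
qed

lemma perturbed_class_generates:
  assumes f: "f \<in> filt 1 0 top_len top_deg" "nonzero_class G \<delta>k top_deg f"
    and \<eta>: "\<eta> \<in> filt 1 0 (top_len + 1) top_deg" and cocycle: "homD \<delta> top_deg (f - \<eta>) = 0"
  shows "generates_Ext G \<delta> top_deg (f - \<eta>)"
proof (rule E.nonzero_class_generates(2), unfold nonzero_class_def, intro conjI cocycle)
  have fil: "f - \<eta> \<in> filt 1 0 top_len top_deg"
    using f(1) filt_mono[OF \<eta>] by (intro filt_diff) simp_all
  then show "f - \<eta> \<in> HomA G top_deg" by (rule filt_Hom)
  show "f - \<eta> \<notin> homD \<delta> (top_deg - 1) ` HomA G (top_deg - 1)"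
  proof
    assume "f - \<eta> \<in> homD \<delta> (top_deg - 1) ` HomA G (top_deg - 1)"
    then obtain \<xi>0 where "\<xi>0 \<in> HomA G (top_deg - 1)" "homD \<delta> (top_deg - 1) \<xi>0 = f - \<eta>"
      by (elim imageE) simp
    from E.boundary_filt[OF fil this] obtain \<xi> where \<xi>: "\<xi> \<in> filt 1 0 (top_len - 1) (top_deg - 1)"
      "homD \<delta> (top_deg - 1) \<xi> = f - \<eta>"
      by blast
    let ?g = "f - homD \<delta>k (top_deg - 1) \<xi>"
    have g_eq: "?g = \<eta> + (homD \<delta> (top_deg - 1) \<xi> - homD \<delta>k (top_deg - 1) \<xi>)"
      unfolding \<xi>(2) by (simp add: algebra_simps)
    have "homD \<delta> (top_deg - 1) \<xi> - homD \<delta>k (top_deg - 1) \<xi> \<in> filt 1 0 (top_len + 1) top_deg"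
      using filt_E_K[OF \<xi>(1)] by (simp add: add.commute)
    then have g: "?g \<in> filt 1 0 (top_len + 1) top_deg"
      unfolding g_eq by (rule filt_add[OF \<eta>])
    have "homD \<delta>k top_deg f = 0" using f(2) by (simp add: nonzero_class_def)
    then have "homD \<delta>k top_deg ?g = 0"
      using K.D_D[OF filt_Hom[OF \<xi>(1)]] by (simp only: K.D_diff) simp
    then obtain \<zeta> where \<zeta>: "\<zeta> \<in> filt 1 0 top_len (top_deg - 1)" "homD \<delta>k (top_deg - 1) \<zeta> = ?g"
      using K.cocycle_exact_off_top[OF _ g] by auto
    have "f = homD \<delta>k (top_deg - 1) (\<xi> + \<zeta>)"
      unfolding K.D_add \<zeta>(2) by simp
    moreover have "\<xi> + \<zeta> \<in> HomA G (top_deg - 1)"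
      by (intro Hom_add filt_Hom[OF \<xi>(1)] filt_Hom[OF \<zeta>(1)])
    ultimately show False using f(2) by (auto simp: nonzero_class_def)
  qed
qed

lemma degenerates:
  assumes "2 \<le> r0"
  shows "degenerates_at G \<delta> r0"
  unfolding degenerates_at_def
proof (intro allI impI subsetI)
  fix r p m g' assume r: "r0 \<le> r" and "g' \<in> homD \<delta> m ` ss_Z G \<delta> r p m"
  then obtain g where g: "g \<in> HomA G m" "g' = homD \<delta> m g" "homD \<delta> m g \<in> Fil G (p + r) (m + 1)"
    by (auto simp: ss_Z_def Fil_def)
  then obtain \<eta> where \<eta>: "\<eta> \<in> filt 1 0 (p + r - 1) m" "homD \<delta> m \<eta> = homD \<delta> m g"
    using E.boundary_filt[of "homD \<delta> m g" "p + r" "m + 1" g] by (auto simp: Fil_eq)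
  \<comment> \<open>Membership requires filtration p + 1, and \<eta> has p + r - 1; this is where r
    must be at least 2. The boundary then lies in \<open>ss_B\<close> with zero as its first
    summand.\<close>
  have "\<eta> \<in> ss_Z G \<delta> (r - 1) (p + r - r + 1) (m + 1 - 1)"
    using filt_mono[OF \<eta>(1), of "p + 1"] \<eta>(2) g(3) assms r by (simp add: ss_Z_def Fil_eq)
  moreover have "0 \<in> ss_Z G \<delta> (r - 1) (p + r + 1) (m + 1)"
    by (simp add: ss_Z_def Fil_eq filt_zero E.D_zero)
  moreover have "g' = 0 + homD \<delta> (m + 1 - 1) \<eta>"
    using g(2) \<eta>(2) by simp
  ultimately show "g' \<in> ss_B G \<delta> r (p + r) (m + 1)"
    unfolding ss_B_def by blast
qed

lemma filt_sum: "(\<And>j. j \<in> I \<Longrightarrow> \<xi> j \<in> filt c \<epsilon> w m) \<Longrightarrow> sum \<xi> I \<in> filt c \<epsilon> w m"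
  by (induction I rule: infinite_finite_induct) (auto intro: filt_zero filt_add)

text \<open>The correction \<open>\<xi> 1\<close> is absorbed into the representative
  \<open>f - \<xi> 1\<close> of the class for \<open>\<delta>k\<close>. All later corrections lie in
  filtration p + 1 and together form the \<eta> of \<open>perturbed_class_generates\<close>.\<close>

lemma corrected_generates:
  assumes f: "f \<in> filt 1 0 top_len top_deg" "homD \<delta> top_deg f \<noteq> 0"
    and run: "correction_run G \<delta> \<delta>i k top_len top_deg f t h \<xi>"
    and keeps: "keeps_class G \<delta>k top_len top_deg f t \<xi>"
  shows "generates_Ext G \<delta> top_deg (corrected \<delta> top_deg f t \<xi>)"
proof -
  have \<xi>1: "f - \<xi> 1 \<in> filt 1 0 top_len top_deg" "nonzero_class G \<delta>k top_deg (f - \<xi> 1)"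
    and \<xi>: "\<And>j. j \<in> {2..t + 1} \<Longrightarrow> \<xi> j \<in> filt 1 0 (top_len + 1) top_deg"
    using keeps f(1) by (auto simp: keeps_class_def Fil_eq intro!: filt_diff)
  have corr: "corr_f f \<xi> u = (f - \<xi> 1) - (\<Sum>j=2..u. \<xi> j)" if "1 \<le> u" for u
    using that sum.atLeast_Suc_atMost[of 1 u \<xi>] by (simp add: corr_f_def numeral_2_eq_2 diff_diff_eq)
  have gen: "generates_Ext G \<delta> top_deg (corr_f f \<xi> u)"
    if u: "1 \<le> u" "u \<le> t + 1" "homD \<delta> top_deg (corr_f f \<xi> u) = 0" for u
    unfolding corr[OF u(1)] using u
    by (intro perturbed_class_generates[OF \<xi>1] filt_sum \<xi>) (auto simp: corr)
  show ?thesis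
  proof (cases "homD \<delta> top_deg (corr_f f \<xi> t) = 0")
    case True
    \<comment> \<open>For t = 0 nothing is subtracted and f itself would be a cocycle; splitting off
      \<open>\<xi> 1\<close> needs at least one correction.\<close>
    then have "t \<noteq> 0" using f(2) by (auto simp: corr_f_def)
    then show ?thesis using True gen[of t] by (simp add: corrected_def)
  next
    case False
    \<comment> \<open>The replacement of f^t is the next partial correction, and the recorded
      equality of \<open>homD\<close> on f^t and on \<open>\<xi> (t + 1)\<close> makes it a
      cocycle.\<close>
    have "corr_f f \<xi> (t + 1) = corr_f f \<xi> t - \<xi> (t + 1)"
      by (simp add: corr_f_def algebra_simps)
    moreover have "homD \<delta> top_deg (corr_f f \<xi> t) = homD \<delta> top_deg (\<xi> (t + 1))"
      using run False by (simp add: correction_run_def)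
    ultimately show ?thesis
      using False gen[of "t + 1"] by (simp add: corrected_def E.D_diff)
  qed
qed

end

theorem theorem4p1:
  fixes G :: "('k::field_char_0, 'b::ring_1) gens"
    and d s \<delta> f :: "'b \<Rightarrow> 'b"
    and di \<delta>i :: "nat \<Rightarrow> 'b \<Rightarrow> 'b"
    and k :: nat
    and p N :: int
  assumes "minimal_sullivan G d"
    and "elliptic G d"
    and "2 \<le> k"
    and "word_decomposition G k d di"
    and "acyclic_closure G s d \<delta>"
    and "closure_diff G s (di k) (\<delta>i k)"
    and "\<forall>i>k. closure_part G s (di i) (\<delta>i i)"
    and "Ext_bideg_nonzero G (\<delta>i k) p (N - p)"
    and "nonzero_class G (\<delta>i k) N f"
    and "f \<in> Fil G p N"
  shows "(homD \<delta> N f = 0 \<and> degenerates_at G \<delta> (int k) \<and> generates_Ext G \<delta> N f) \<or>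
         (homD \<delta> N f \<noteq> 0 \<and>
          (\<exists>\<eta>\<in>Fil G (p + 1) N. generates_Ext G \<delta> N (f - \<eta>)) \<and>
          (\<forall>t h \<xi>. correction_run G \<delta> \<delta>i k p N f t h \<xi> \<and> keeps_class G (\<delta>i k) p N f t \<xi> \<longrightarrow>
             generates_Ext G \<delta> N (corrected \<delta> N f t \<xi>)))"
proof -
  interpret compared_closures G d s \<delta> "\<delta>i k" di k
    using assms(1,3-6) by unfold_locales (auto simp: minimal_sullivan_def)
  \<comment> \<open>N and p are determined by the complex of \<open>d_k\<close>, but they equal
    constants of the generators alone and so are available for D as well.\<close>
  have N: "N = top_deg"
    by (rule K.nonzero_class_generates(1)[OF assms(9)])
  have p: "p = top_len"
    using K.bideg_top_len assms(8) N by simp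
  have f: "f \<in> filt 1 0 top_len top_deg" "nonzero_class G (\<delta>i k) top_deg f"
    using assms(9,10) by (simp_all add: N p Fil_eq)
  show ?thesis
  proof (cases "homD \<delta> N f = 0")
    case True
    moreover have "degenerates_at G \<delta> (int k)"
      using assms(3) by (intro degenerates) simp
    moreover have "generates_Ext G \<delta> N f"
      using perturbed_class_generates[OF f filt_zero] True by (simp add: N)
    ultimately show ?thesis by blast
  next
    case False
    \<comment> \<open>As f is a cocycle for \<open>d_k\<close>, all of Df lies in filtration p + 2.
      It sits in degree N + 1, off the top, so it has a preimage \<eta> in filtration p + 1, and
      \<open>f - \<eta>\<close> is a cocycle.\<close>
    have "homD \<delta> N f - homD (\<delta>i k) N f = homD \<delta> N f"
      using f(2) by (simp add: nonzero_class_def N)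
    then have "homD \<delta> N f \<in> filt 1 0 (p + 2) (N + 1)"
      using filt_E_K[OF f(1)] by (simp add: N p)
    then obtain \<eta> where \<eta>: "\<eta> \<in> filt 1 0 (p + 1) N" "homD \<delta> N \<eta> = homD \<delta> N f"
      using E.cocycle_exact_off_top[of "N + 1" "homD \<delta> N f" "p + 2"] E.D_D[OF filt_Hom[OF f(1)]]
      by (auto simp: N add.commute)
    then have "generates_Ext G \<delta> N (f - \<eta>)"
      using perturbed_class_generates[OF f, of \<eta>] by (simp add: N p E.D_diff)
    moreover have "generates_Ext G \<delta> N (corrected \<delta> N f t \<xi>)"
      if "correction_run G \<delta> \<delta>i k p N f t h \<xi>" "keeps_class G (\<delta>i k) p N f t \<xi>" for t h \<xi>
      using corrected_generates[OF f(1), of \<delta>i t h \<xi>] that False by (simp add: N p)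
    ultimately show ?thesis
      using False \<eta>(1) by (auto simp: Fil_eq)
  qed
qed

end
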